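(* Let $\alpha=(\alpha_1,\ldots,\alpha_m)$ be an $m$-part composition of $n$, let $\pi\in S_n$ have cycle type $\alpha$, and let $\beta=(\beta_2,\beta_3,\ldots)$ be a finitely supported sequence of nonnegative integers. Minimal transitive inequivalent cycle factorizations of $\pi$ with signature $\beta$ are in $\alpha_2\cdots\alpha_m$-to-one correspondence (a surjection from the factorizations onto the maps, every fibre having exactly $\alpha_2\cdots\alpha_m$ elements) with planar maps with $m$ labelled faces in which (a) every vertex is a leaf or has even degree $\ge4$; (b) face $i$ contains exactly $2\alpha_i$ leaves, for each $i$; (c) one leaf in face $1$ is distinguished; (d) there are exactly $\beta_k$ vertices of degree $2k$, for every $k\ge2$; (e) every cycle of the map has a positive even number of odd corners. More generally, for each $g\ge0$, genus $g$ inequivalent cycle factorizations of $\pi$ with signature $\beta$ are in $\alpha_2\cdots\alpha_m$-to-one correspondence in the same way with genus $g$ maps with $m$ labelled faces satisfying (a)–(e).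
   Context: Permutations are multiplied right to left. A cycle factorization of $\pi\in S_n$ is a tuple of nontrivial cycles whose product is $\pi$; its signature is $(\beta_2,\beta_3,\ldots)$ with $\beta_k$ the number of $k$-cycle factors, and its depth is $\sum_k(k-1)\beta_k$. It is transitive if the factors generate a transitive subgroup, and its genus is then the $g\ge0$ with depth $=n+\ell(\pi)-2+2g$, where $\ell(\pi)$ is the number of cycles of $\pi$; minimal transitive means genus 0. Two cycle factorizations are equivalent if one is obtained from the other by repeatedly interchanging adjacent disjoint factors; an inequivalent factorization is an equivalence class. A map is a connected graph cellularly embedded in a closed orientable surface (planar: the sphere), considered up to orientation-preserving homeomorphism preserving face labels and the distinguished leaf; a leaf lies in the face whose boundary walk passes through it. For a walk $W$ in a map and consecutive edges $e,e'$ of $W$ meeting at a vertex $v$, the corner $(e,e')$ is odd if the number of edges at $v$ lying strictly inside the angular sector at $v$ to the right of $W$ between $e$ and $e'$ (i.e. the edges crossed by a curve running alongside $W$ at vanishingly small distance on its right along $e$ and $e'$) is odd, and even otherwise. A cycle's odd corners are those of the closed walk traversing it. *)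

theory Defs
  imports
    "HOL-Combinatorics.Cycles"
    "HOL-Combinatorics.Orbits"
    "HOL-Algebra.Sym_Groups"
    "HOL-Library.Multiset"
begin

section \<open>Compositions and cycle type\<close>

definition composition :: "nat \<Rightarrow> nat list \<Rightarrow> nat \<Rightarrow> bool" where
  "composition m \<alpha> n \<longleftrightarrow> length \<alpha> = m \<and> (\<forall>a\<in>set \<alpha>. 1 \<le> a) \<and> sum_list \<alpha> = n"

text \<open>The cycles of a permutation of \<open>{1..n}\<close>, fixed points included, as sets.\<close>

definition perm_cycles :: "nat \<Rightarrow> (nat \<Rightarrow> nat) \<Rightarrow> nat set set" where
  "perm_cycles n \<pi> = orbit \<pi> ` {1..n}"

definition cycle_type :: "nat \<Rightarrow> (nat \<Rightarrow> nat) \<Rightarrow> nat multiset" where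
  "cycle_type n \<pi> = image_mset card (mset_set (perm_cycles n \<pi>))"


section \<open>Cycle factorizations\<close>

definition k_cycle :: "nat \<Rightarrow> nat \<Rightarrow> (nat \<Rightarrow> nat) \<Rightarrow> bool" where
  "k_cycle n k \<sigma> \<longleftrightarrow>
     (\<exists>cs. cycle cs \<and> length cs = k \<and> set cs \<subseteq> {1..n} \<and> \<sigma> = cycle_of_list cs)"

definition cycle_factorization ::
    "nat \<Rightarrow> (nat \<Rightarrow> nat) \<Rightarrow> (nat \<Rightarrow> nat) list \<Rightarrow> bool" where
  "cycle_factorization n \<pi> F \<longleftrightarrow>
     (\<forall>\<sigma>\<in>set F. \<exists>k\<ge>2. k_cycle n k \<sigma>) \<and> foldr (\<circ>) F id = \<pi>"

text \<open>Only the values at \<open>k \<ge> 2\<close> are meaningful.\<close>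

definition signature :: "nat \<Rightarrow> (nat \<Rightarrow> nat) list \<Rightarrow> nat \<Rightarrow> nat" where
  "signature n F k = length (filter (k_cycle n k) F)"

definition depth :: "nat \<Rightarrow> (nat \<Rightarrow> nat) list \<Rightarrow> nat" where
  "depth n F = (\<Sum>k | 2 \<le> k \<and> signature n F k \<noteq> 0. (k - 1) * signature n F k)"

definition transitive :: "nat \<Rightarrow> (nat \<Rightarrow> nat) list \<Rightarrow> bool" where
  "transitive n F \<longleftrightarrow>
     (\<forall>x\<in>{1..n}. \<forall>y\<in>{1..n}. \<exists>h\<in>generate (sym_group n) (set F). h x = y)"

definition genus_factorization ::
    "nat \<Rightarrow> (nat \<Rightarrow> nat) \<Rightarrow> nat \<Rightarrow> (nat \<Rightarrow> nat) list \<Rightarrow> bool" where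
  "genus_factorization n \<pi> g F \<longleftrightarrow>
     cycle_factorization n \<pi> F \<and> transitive n F \<and>
     int (depth n F) = int n + int (card (perm_cycles n \<pi>)) - 2 + 2 * int g"

definition minimal_transitive_factorization ::
    "nat \<Rightarrow> (nat \<Rightarrow> nat) \<Rightarrow> (nat \<Rightarrow> nat) list \<Rightarrow> bool" where
  "minimal_transitive_factorization n \<pi> F \<longleftrightarrow> genus_factorization n \<pi> 0 F"

definition disjoint_perms :: "(nat \<Rightarrow> nat) \<Rightarrow> (nat \<Rightarrow> nat) \<Rightarrow> bool" where
  "disjoint_perms \<sigma> \<tau> \<longleftrightarrow> {x. \<sigma> x \<noteq> x} \<inter> {x. \<tau> x \<noteq> x} = {}"

definition interchange :: "((nat \<Rightarrow> nat) list \<times> (nat \<Rightarrow> nat) list) set" where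
  "interchange = {(xs @ [\<sigma>, \<tau>] @ ys, xs @ [\<tau>, \<sigma>] @ ys) | xs \<sigma> \<tau> ys. disjoint_perms \<sigma> \<tau>}"

text \<open>The relation \<open>interchange\<close> is symmetric, so its reflexive transitive closure is an
  equivalence relation. Interchanges keep product, multiset of factors and generated subgroup,
  so the class of a factorization consists of factorizations of the same kind.\<close>

definition inequivalent ::
    "((nat \<Rightarrow> nat) list \<Rightarrow> bool) \<Rightarrow> (nat \<Rightarrow> nat) list set set" where
  "inequivalent P = {F. P F} // interchange\<^sup>*"


section \<open>Maps\<close>

text \<open>Maps on closed oriented surfaces are encoded as rotation systems. The elements of
  \<open>darts\<close> are the half-edges; \<open>opp\<close> exchanges the two halves of an edge, and \<open>rot\<close> sends a
  half-edge to the next one counterclockwise around its vertex. Loops and multiple edges are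
  allowed. Vertices and faces are represented as sets of half-edges. Every map with at least
  one edge arises; the only map not represented is the single vertex on the sphere.\<close>

record 'd rotation_system =
  darts :: "'d set"
  rot :: "'d \<Rightarrow> 'd"
  opp :: "'d \<Rightarrow> 'd"

definition vertex_at :: "('d, 'z) rotation_system_scheme \<Rightarrow> 'd \<Rightarrow> 'd set" where
  "vertex_at M d = orbit (rot M) d"

definition vertices :: "('d, 'z) rotation_system_scheme \<Rightarrow> 'd set set" where
  "vertices M = vertex_at M ` darts M"

definition edge_of :: "('d, 'z) rotation_system_scheme \<Rightarrow> 'd \<Rightarrow> 'd set" where
  "edge_of M d = {d, opp M d}"

definition edges :: "('d, 'z) rotation_system_scheme \<Rightarrow> 'd set set" where
  "edges M = edge_of M ` darts M"

text \<open>Read a half-edge \<open>d\<close> as its edge traversed away from the vertex of \<open>d\<close>. Arriving at the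
  far end and leaving by the next half-edge counterclockwise follows the boundary of the face
  to the right of \<open>d\<close>, so faces are the orbits of \<open>rot M \<circ> opp M\<close>.\<close>

definition faces :: "('d, 'z) rotation_system_scheme \<Rightarrow> 'd set set" where
  "faces M = orbit (rot M \<circ> opp M) ` darts M"

text \<open>In a finite map inverse steps are not needed to express connectedness.\<close>

definition connected_map :: "('d, 'z) rotation_system_scheme \<Rightarrow> bool" where
  "connected_map M \<longleftrightarrow>
     (\<forall>d\<in>darts M. \<forall>d'\<in>darts M. (d, d') \<in> {(x, y). y = rot M x \<or> y = opp M x}\<^sup>*)"

definition is_map :: "('d, 'z) rotation_system_scheme \<Rightarrow> bool" where
  "is_map M \<longleftrightarrow>
     finite (darts M) \<and> darts M \<noteq> {} \<and>
     rot M permutes darts M \<and> opp M permutes darts M \<and>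
     (\<forall>d\<in>darts M. opp M d \<noteq> d \<and> opp M (opp M d) = d) \<and>
     connected_map M"

definition genus_map :: "nat \<Rightarrow> ('d, 'z) rotation_system_scheme \<Rightarrow> bool" where
  "genus_map g M \<longleftrightarrow>
     int (card (vertices M)) - int (card (edges M)) + int (card (faces M)) = 2 - 2 * int g"

definition planar :: "('d, 'z) rotation_system_scheme \<Rightarrow> bool" where
  "planar M \<longleftrightarrow> genus_map 0 M"

text \<open>The number of half-edges at a vertex: a loop contributes two.\<close>

definition degree :: "'d set \<Rightarrow> nat" where
  "degree v = card v"

definition leaves :: "('d, 'z) rotation_system_scheme \<Rightarrow> 'd set set" where
  "leaves M = {v \<in> vertices M. degree v = 1}"

text \<open>The boundary walk of a face passes through \<open>v\<close> iff it leaves \<open>v\<close> by one of the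
  half-edges at \<open>v\<close>.\<close>

definition leaves_in :: "('d, 'z) rotation_system_scheme \<Rightarrow> 'd set \<Rightarrow> 'd set set" where
  "leaves_in M f = {v \<in> leaves M. v \<inter> f \<noteq> {}}"


subsection \<open>Cycles and odd corners\<close>

text \<open>A closed walk is the cyclic list of its edges, each given by the half-edge at which its
  traversal starts. Distinctness of the edges excludes going back and forth along one edge;
  loops (length 1) and digons (length 2) are cycles.\<close>

definition cycle_in :: "('d, 'z) rotation_system_scheme \<Rightarrow> 'd list \<Rightarrow> bool" where
  "cycle_in M W \<longleftrightarrow>
     W \<noteq> [] \<and> set W \<subseteq> darts M \<and>
     (\<forall>i<length W. vertex_at M (opp M (W ! i)) = vertex_at M (W ! ((i + 1) mod length W))) \<and>
     distinct (map (vertex_at M) W) \<and> distinct (map (edge_of M) W)"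

text \<open>Half-edges strictly between \<open>a\<close> and \<open>b\<close> counterclockwise from \<open>a\<close>. A walk that arrives
  through the half-edge \<open>a\<close> and leaves through \<open>b\<close> has exactly this sector on its right.\<close>

definition right_sector :: "('d, 'z) rotation_system_scheme \<Rightarrow> 'd \<Rightarrow> 'd \<Rightarrow> 'd set" where
  "right_sector M a b =
     {(rot M ^^ j) a | j. 1 \<le> j \<and> (\<forall>i\<in>{1..j}. (rot M ^^ i) a \<notin> {a, b})}"

definition odd_corner :: "('d, 'z) rotation_system_scheme \<Rightarrow> 'd \<Rightarrow> 'd \<Rightarrow> bool" where
  "odd_corner M e e' \<longleftrightarrow> odd (card (right_sector M (opp M e) e'))"

definition odd_corners :: "('d, 'z) rotation_system_scheme \<Rightarrow> 'd list \<Rightarrow> nat" where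
  "odd_corners M W = card {i. i < length W \<and> odd_corner M (W ! i) (W ! ((i + 1) mod length W))}"


subsection \<open>Labelled faces and distinguished leaf\<close>

text \<open>Face labels are given by listing the faces: as lists are indexed from 0, the face with
  label \<open>i\<close> is \<open>face_list M ! (i - 1)\<close>.\<close>

record 'd marked_map = "'d rotation_system" +
  face_list :: "'d set list"
  marked_leaf :: "'d set"

definition is_marked_map :: "'d marked_map \<Rightarrow> bool" where
  "is_marked_map M \<longleftrightarrow>
     is_map M \<and> distinct (face_list M) \<and> set (face_list M) = faces M \<and> marked_leaf M \<in> leaves M"

text \<open>Orientation-preserving homeomorphisms correspond to bijections commuting with \<open>rot\<close> and
  \<open>opp\<close>.\<close>

definition isomorphic :: "'d marked_map \<Rightarrow> 'd marked_map \<Rightarrow> bool" where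
  "isomorphic M M' \<longleftrightarrow>
     (\<exists>h. bij_betw h (darts M) (darts M') \<and>
          (\<forall>d\<in>darts M. h (rot M d) = rot M' (h d) \<and> h (opp M d) = opp M' (h d)) \<and>
          map (image h) (face_list M) = face_list M' \<and>
          h ` marked_leaf M = marked_leaf M')"

text \<open>Maps are finite, so those with half-edges in \<open>nat\<close> represent every isomorphism class.\<close>

definition maps_up_to_iso :: "(nat marked_map \<Rightarrow> bool) \<Rightarrow> nat marked_map set set" where
  "maps_up_to_iso P =
     {M. is_marked_map M \<and> P M} //
     {(M, M'). is_marked_map M \<and> is_marked_map M' \<and> isomorphic M M'}"

text \<open>The conjuncts after the number of faces are the conditions (a) to (e).\<close>

definition admissible :: "nat list \<Rightarrow> (nat \<Rightarrow> nat) \<Rightarrow> 'd marked_map \<Rightarrow> bool" where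
  "admissible \<alpha> \<beta> M \<longleftrightarrow>
     length (face_list M) = length \<alpha> \<and>
     (\<forall>v\<in>vertices M. v \<in> leaves M \<or> (even (degree v) \<and> degree v \<ge> 4)) \<and>
     (\<forall>i<length \<alpha>. card (leaves_in M (face_list M ! i)) = 2 * \<alpha> ! i) \<and>
     marked_leaf M \<in> leaves_in M (face_list M ! 0) \<and>
     (\<forall>k\<ge>2. card {v \<in> vertices M. degree v = 2 * k} = \<beta> k) \<and>
     (\<forall>W. cycle_in M W \<longrightarrow> odd_corners M W > 0 \<and> even (odd_corners M W))"


section \<open>Correspondences\<close>

definition to_one_correspondence :: "nat \<Rightarrow> ('a \<Rightarrow> 'b) \<Rightarrow> 'a set \<Rightarrow> 'b set \<Rightarrow> bool" where
  "to_one_correspondence r f A B \<longleftrightarrow> f ` A = B \<and> (\<forall>b\<in>B. card {a \<in> A. f a = b} = r)"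

end

theory Submission
  imports Defs "HOL-Library.Countable"
begin

text \<open>The factors of a factorization are the inner vertices of a wiring diagram, in which a
  \<open>k\<close>-cycle is met by \<open>k\<close> incoming and \<open>k\<close> outgoing edges in alternating order; the \<open>2n\<close> leaves are
  the ends of the \<open>n\<close> lines, and the faces trace out the cycles of the product. Forgetting the
  labels of the lines and marking one source leaf gives the map. In an orientation that alternates
  around the inner vertices, the odd corners of a cycle are the places where its direction changes.
  Condition (e) therefore says that such an orientation exists and has no directed cycle: an
  even number of odd corners on every cycle makes local choices consistent, and a positive number
  excludes directed cycles. The orientation is unique up to reversal, and the distinguished leaf
  fixes it. Sorting the vertices topologically recovers a factorization of some permutation of the
  same cycle type, up to interchanges. The remaining freedom is the choice of a conjugation to
  \<open>\<pi>\<close> that respects the labels of the faces and the distinguished leaf: one can rotate the labels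
  in every face but the first, in \<open>\<alpha>\<^sub>2 \<cdots> \<alpha>\<^sub>m\<close> ways, and different choices give different
  factorizations because a connected map has no automorphism fixing a half-edge.\<close>

section \<open>Orbits and nontrivial cycles\<close>

text \<open>Half-edges are named by line, level and direction, never by factor. An interchange of
  disjoint factors therefore leaves the map literally equal, not just isomorphic, and the converse
  can be read off from \<open>word_rot\<close> and \<open>height\<close> alone. One representative
  \<open>cs ! i\<close> is fixed in every cycle of \<pi>. It attaches label i + 1 to a face, and the
  lower end of line \<open>cs ! 0\<close> becomes the distinguished leaf. Pinning this one line uses
  up all the freedom in face 1, so \<open>\<alpha> ! 0\<close> is absent from the product; each
  other face only knows the cycle of its representative. The degree bound 4 says that an inner
  vertex has at least two incoming edges, that is, that its factor is not the identity. The obstacle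
  lies in condition (e): it speaks of cycles with distinct vertices, whereas orienting a map needs
  all closed walks and sorting it needs the absence of directed closed walks. Both reduce to cycles
  by \<open>closed_walk_contains_cycle\<close>. A rank function with natural values then carries the
  acyclicity through the inductions.\<close>

lemma orbit_eq_orbit:
  assumes "permutation f" "y \<in> orbit f x"
  shows "orbit f y = orbit f x"
  using cyclic_on_orbit'[OF assms(1)] assms(2) by (rule orbit_cyclic_eq3)

lemma orbit_eq_iff:
  assumes "permutation f"
  shows "orbit f y = orbit f x \<longleftrightarrow> y \<in> orbit f x"
  using orbit_eq_orbit[OF assms] permutation_self_in_orbit[OF assms] by blast

lemma card_orbit:
  assumes "permutation f"
  shows "card (orbit f x) = least_power f x"
proof -
  have "set (support f x) = orbit f x"
    unfolding support_set[OF assms] orbit_altdef_permutation[OF assms] by auto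
  then have "card (orbit f x) = length (support f x)"
    using distinct_card[OF cycle_of_permutation[OF assms, of x]] by simp
  then show ?thesis by simp
qed

text \<open>Makes exponents meaningful modulo the orbit length. This later gives both the
  consistency of alternation around a vertex of even degree and the well-definedness of
  conjugators.\<close>

lemma funpow_eq_iff:
  assumes "permutation f"
  shows "(f ^^ k) x = (f ^^ l) x \<longleftrightarrow> k mod card (orbit f x) = l mod card (orbit f x)"
proof -
  have aux: "(f ^^ k) x = (f ^^ l) x \<longleftrightarrow> k mod card (orbit f x) = l mod card (orbit f x)"
    if "k \<le> l" for k l
  proof -
    have inj: "inj (f ^^ k)"
      using permutation_bijective[OF permutation_funpow[OF assms]] by (rule bij_is_inj)
    have "(f ^^ l) x = (f ^^ k) ((f ^^ (l - k)) x)"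
      using that by (metis comp_apply funpow_add le_add_diff_inverse)
    then have "(f ^^ k) x = (f ^^ l) x \<longleftrightarrow> (f ^^ (l - k)) x = x"
      using inj by (metis injD)
    also have "\<dots> \<longleftrightarrow> card (orbit f x) dvd l - k"
      using least_power_dvd[OF assms] card_orbit[OF assms] by metis
    also have "\<dots> \<longleftrightarrow> k mod card (orbit f x) = l mod card (orbit f x)"
      using mod_eq_dvd_iff_nat[OF that, of "card (orbit f x)"] by auto
    finally show ?thesis .
  qed
  show ?thesis using aux[of k l] aux[of l k] by (cases "k \<le> l") auto
qed

definition moved :: "('a \<Rightarrow> 'a) \<Rightarrow> 'a set" where
  "moved \<sigma> = {x. \<sigma> x \<noteq> x}"

text \<open>Describes a cycle by its action, so that no list has to be chosen;
  \<open>card (moved \<sigma>)\<close> is its length. The identity is excluded because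
  \<open>cyclic_on\<close> needs a nonempty set.\<close>

definition nontrivial_cycle :: "nat \<Rightarrow> (nat \<Rightarrow> nat) \<Rightarrow> bool" where
  "nontrivial_cycle n \<sigma> \<longleftrightarrow> \<sigma> permutes {1..n} \<and> cyclic_on \<sigma> (moved \<sigma>)"

lemma moved_subset: "\<sigma> permutes A \<Longrightarrow> moved \<sigma> \<subseteq> A"
  unfolding moved_def permutes_def by auto

lemma bij_moved_iff: "bij \<sigma> \<Longrightarrow> \<sigma> (\<sigma> x) \<noteq> \<sigma> x \<longleftrightarrow> \<sigma> x \<noteq> x"
  by (auto simp: bij_def inj_eq)

lemma card_moved_ge_2:
  assumes "cyclic_on \<sigma> (moved \<sigma>)"
  shows "2 \<le> card (moved \<sigma>)"
proof -
  obtain x where x: "x \<in> moved \<sigma>" using assms unfolding cyclic_on_def by auto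
  then have "\<sigma> x \<in> moved \<sigma>" using assms by (rule cyclic_on_inI[rotated])
  then have "card {x, \<sigma> x} \<le> card (moved \<sigma>)"
    using x finite_cyclic_on[OF assms] by (intro card_mono) auto
  then show ?thesis using x by (simp add: moved_def)
qed

lemma cycle_of_list_nth:
  assumes "cycle cs" "i < length cs"
  shows "((cycle_of_list cs) ^^ k) (cs ! i) = cs ! ((i + k) mod length cs)"
proof -
  have "((cycle_of_list cs) ^^ k) (cs ! i) = map ((cycle_of_list cs) ^^ k) cs ! i"
    using assms(2) by simp
  also have "\<dots> = rotate k cs ! i" using cyclic_rotation[OF assms(1)] by simp
  finally show ?thesis using assms(2) by (simp add: nth_rotate add.commute)
qed

text \<open>Powers of \<open>cycle_of_list cs\<close> shift indices modulo k, so the orbit of the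
  first entry is the whole list; conversely \<open>support\<close> lists an orbit in cyclic order.
  For k = 1 the list would give the identity, which moves nothing.\<close>

lemma k_cycle_iff:
  assumes "2 \<le> k"
  shows "k_cycle n k \<sigma> \<longleftrightarrow> nontrivial_cycle n \<sigma> \<and> card (moved \<sigma>) = k"
proof
  assume "k_cycle n k \<sigma>"
  then obtain cs where cs: "cycle cs" "length cs = k" "set cs \<subseteq> {1..n}" "\<sigma> = cycle_of_list cs"
    unfolding k_cycle_def by blast
  have nth: "(\<sigma> ^^ j) (cs ! i) = cs ! ((i + j) mod k)" if "i < k" for i j
    using cycle_of_list_nth[OF cs(1), of i j] cs that by simp
  have "\<sigma> x \<noteq> x" if x: "x \<in> set cs" for x
  proof -
    obtain i where i: "i < k" "x = cs ! i" using x cs(2) by (auto simp: in_set_conv_nth)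
    have "(i + 1) mod k \<noteq> i" using i(1) assms by (cases "i + 1 = k") auto
    then have "cs ! ((i + 1) mod k) \<noteq> cs ! i"
      using cs(1,2) i(1) by (subst nth_eq_iff_index_eq) auto
    then show ?thesis using nth[OF i(1), of 1] i(2) by simp
  qed
  then have mv: "moved \<sigma> = set cs"
    using id_outside_supp[of _ cs] cs(4) unfolding moved_def by blast
  have perm: "permutation \<sigma>" using cs(4) permutation_of_cycle by simp
  have "orbit \<sigma> (cs ! 0) = set cs"
  proof -
    have k0: "0 < k" using assms by simp
    have eq: "orbit \<sigma> (cs ! 0) = range (\<lambda>j. cs ! (j mod k))"
      unfolding orbit_altdef_permutation[OF perm] using nth[OF k0] by auto
    have "x \<in> range (\<lambda>j. cs ! (j mod k))" if x: "x \<in> set cs" for x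
    proof -
      obtain i where "i < k" "x = cs ! i" using x cs(2) by (auto simp: in_set_conv_nth)
      then have "x = (\<lambda>j. cs ! (j mod k)) i" by simp
      then show ?thesis by blast
    qed
    moreover have "range (\<lambda>j. cs ! (j mod k)) \<subseteq> set cs" using k0 cs(2) by auto
    ultimately show ?thesis unfolding eq by blast
  qed
  moreover have "cs ! 0 \<in> set cs" using cs(2) assms by (intro nth_mem) simp
  ultimately have "cyclic_on \<sigma> (moved \<sigma>)" unfolding mv cyclic_on_def by blast
  moreover have "\<sigma> permutes {1..n}"
    using cycle_permutes[of cs] cs(3,4) permutes_subset by blast
  ultimately show "nontrivial_cycle n \<sigma> \<and> card (moved \<sigma>) = k"
    using distinct_card[OF cs(1)] cs(2) mv unfolding nontrivial_cycle_def by simp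
next
  assume asm: "nontrivial_cycle n \<sigma> \<and> card (moved \<sigma>) = k"
  then have perm: "permutation \<sigma>" and cyc: "cyclic_on \<sigma> (moved \<sigma>)" and mv: "moved \<sigma> \<subseteq> {1..n}"
    unfolding nontrivial_cycle_def using permutation_permutes moved_subset by blast+
  obtain x where x: "x \<in> moved \<sigma>" "moved \<sigma> = orbit \<sigma> x" using cyc unfolding cyclic_on_def by blast
  have set: "set (support \<sigma> x) = moved \<sigma>"
    unfolding support_set[OF perm] x(2) orbit_altdef_permutation[OF perm] by auto
  have "\<sigma> = cycle_of_list (support \<sigma> x)"
  proof
    fix y show "\<sigma> y = cycle_of_list (support \<sigma> x) y"
    proof (cases "y \<in> moved \<sigma>")
      case True then show ?thesis using cycle_restrict[OF perm] set by blast
    next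
      case False
      then show ?thesis using id_outside_supp[of y "support \<sigma> x"] set unfolding moved_def by simp
    qed
  qed
  moreover have "length (support \<sigma> x) = k"
    using asm card_orbit[OF perm, of x] x(2) by simp
  ultimately show "k_cycle n k \<sigma>"
    unfolding k_cycle_def using cycle_of_permutation[OF perm, of x] set mv by blast
qed

lemma ex_k_cycle_iff: "(\<exists>k\<ge>2. k_cycle n k \<sigma>) \<longleftrightarrow> nontrivial_cycle n \<sigma>"
  using k_cycle_iff card_moved_ge_2 unfolding nontrivial_cycle_def by blast

section \<open>The map of a list of cycles\<close>

text \<open>A list of cycles is drawn as a wiring diagram with lines \<open>1, \<dots>, n\<close> running upwards; the last
  factor acts first and is the lowest. A factor is a vertex joining the lines that it moves, so
  line \<open>x\<close> is cut into edges, numbered from \<open>0\<close> at the bottom. The half-edge \<open>(x, i, True)\<close> leaves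
  the lower end of the \<open>i\<close>-th edge of line \<open>x\<close> upwards, and \<open>(x, i, False)\<close> leaves its upper end
  downwards. Adding a factor on top turns leaves \<open>(x, height F x, False)\<close> into half-edges of the new
  vertex, around which incoming and outgoing edges alternate.\<close>

type_synonym dart = "nat \<times> nat \<times> bool"

text \<open>Each factor moving the line cuts it once more, so this is also the number of its topmost
  edge.\<close>

definition height :: "(nat \<Rightarrow> nat) list \<Rightarrow> nat \<Rightarrow> nat" where
  "height F x = length (filter (\<lambda>\<sigma>. \<sigma> x \<noteq> x) F)"

lemma height_Nil [simp]: "height [] x = 0"
  and height_Cons: "height (\<sigma> # F) x = (if \<sigma> x \<noteq> x then Suc (height F x) else height F x)"
  by (simp_all add: height_def)

text \<open>Rotation about the new vertex: the incoming half-edge of x is followed by the outgoing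
  one of \<open>\<sigma> x\<close>, and that by the incoming one of \<open>\<sigma> x\<close>. Two
  steps thus carry incoming half-edges along \<sigma>.\<close>

definition layer :: "(nat \<Rightarrow> nat) \<Rightarrow> (nat \<Rightarrow> nat) list \<Rightarrow> dart \<Rightarrow> dart" where
  "layer \<sigma> F = (\<lambda>(x, i, b).
     if \<sigma> x \<noteq> x \<and> \<not> b \<and> i = height F x then (\<sigma> x, Suc (height F (\<sigma> x)), True)
     else if \<sigma> x \<noteq> x \<and> b \<and> i = Suc (height F x) then (x, height F x, False)
     else (x, i, b))"

definition top_vertex :: "(nat \<Rightarrow> nat) \<Rightarrow> (nat \<Rightarrow> nat) list \<Rightarrow> dart set" where
  "top_vertex \<sigma> F = (\<lambda>x. (x, height F x, False)) ` moved \<sigma> \<union> (\<lambda>x. (x, Suc (height F x), True)) ` moved \<sigma>"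

text \<open>The composition is a disjoint one: \<open>layer \<sigma> F\<close> moves only half-edges
  of the new vertex, and these are fixed by \<open>word_rot F\<close>.\<close>

primrec word_rot :: "(nat \<Rightarrow> nat) list \<Rightarrow> dart \<Rightarrow> dart" where
  "word_rot [] = id"
| "word_rot (\<sigma> # F) = word_rot F \<circ> layer \<sigma> F"

definition word_darts :: "nat \<Rightarrow> (nat \<Rightarrow> nat) list \<Rightarrow> dart set" where
  "word_darts n F = {(x, i, b). x \<in> {1..n} \<and> i \<le> height F x}"

text \<open>The guard makes it the identity off the diagram, as \<open>permutes\<close>
  demands.\<close>

definition word_opp :: "nat \<Rightarrow> (nat \<Rightarrow> nat) list \<Rightarrow> dart \<Rightarrow> dart" where
  "word_opp n F = (\<lambda>(x, i, b). if x \<in> {1..n} \<and> i \<le> height F x then (x, i, \<not> b) else (x, i, b))"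

abbreviation up_dart :: "dart \<Rightarrow> bool" where
  "up_dart d \<equiv> snd (snd d)"

abbreviation cycle_word :: "nat \<Rightarrow> (nat \<Rightarrow> nat) list \<Rightarrow> bool" where
  "cycle_word n F \<equiv> \<forall>\<sigma>\<in>set F. nontrivial_cycle n \<sigma>"

section \<open>Rotation in the diagram: leaves, and alternation at inner vertices\<close>

lemma word_rot_fixed:
  assumes "(b \<and> (i = 0 \<or> i > height F x)) \<or> (\<not> b \<and> i \<ge> height F x)"
  shows "word_rot F (x, i, b) = (x, i, b)"
  using assms by (induction F) (auto simp: height_Cons layer_def split: if_splits)

text \<open>Independent of the factors: an outgoing half-edge is always followed by the incoming one
  of the same line. Only the step from incoming to outgoing depends on the factor.\<close>

lemma word_rot_up:
  assumes "0 < i" "i \<le> height F x"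
  shows "word_rot F (x, i, True) = (x, i - 1, False)"
  using assms by (induction F) (auto simp: height_Cons layer_def word_rot_fixed le_Suc_eq split: if_splits)

lemma nontrivial_cycleD:
  assumes "nontrivial_cycle n \<sigma>"
  shows "\<sigma> permutes {1..n}" "bij \<sigma>" "permutation \<sigma>" "cyclic_on \<sigma> (moved \<sigma>)"
    "moved \<sigma> \<subseteq> {1..n}" "finite (moved \<sigma>)"
  using assms permutes_bij moved_subset permutation_permutes finite_cyclic_on
  unfolding nontrivial_cycle_def by blast+

lemma word_rot_top:
  assumes "nontrivial_cycle n \<sigma>" "\<sigma> x \<noteq> x"
  shows "word_rot (\<sigma> # F) (x, height F x, False) = (\<sigma> x, Suc (height F (\<sigma> x)), True)"
    and "word_rot (\<sigma> # F) (x, Suc (height F x), True) = (x, height F x, False)"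
  using assms by (auto simp: layer_def word_rot_fixed)

lemma word_rot_down:
  assumes "cycle_word n F" "i < height F x"
  shows "\<exists>y j. word_rot F (x, i, False) = (y, j, True) \<and> 0 < j \<and> j \<le> height F y \<and> y \<in> {1..n}"
  using assms
proof (induction F)
  case (Cons \<sigma> F)
  then have \<sigma>: "nontrivial_cycle n \<sigma>" by simp
  show ?case
  proof (cases "\<sigma> x \<noteq> x \<and> i = height F x")
    case True
    then have "\<sigma> x \<in> {1..n}" "\<sigma> (\<sigma> x) \<noteq> \<sigma> x"
      using nontrivial_cycleD[OF \<sigma>] bij_moved_iff[of \<sigma> x] permutes_in_image[of \<sigma>]
      unfolding permutes_def by metis+
    then show ?thesis using True word_rot_top(1)[OF \<sigma>, of x F] by (simp add: height_Cons)
  next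
    case False
    then have "i < height F x" using Cons.prems(2) by (auto simp: height_Cons split: if_splits)
    then obtain y j where yj: "word_rot F (x, i, False) = (y, j, True)" "0 < j" "j \<le> height F y" "y \<in> {1..n}"
      using Cons by auto
    have "word_rot (\<sigma> # F) (x, i, False) = word_rot F (x, i, False)"
      using False by (auto simp: layer_def)
    then show ?thesis using yj by (auto simp: height_Cons le_SucI)
  qed
qed simp

lemma word_rot_fixed_iff:
  assumes "cycle_word n F" "(x, i, b) \<in> word_darts n F"
  shows "word_rot F (x, i, b) = (x, i, b) \<longleftrightarrow> (b \<and> i = 0) \<or> (\<not> b \<and> i = height F x)"
proof (cases "(b \<and> i = 0) \<or> (\<not> b \<and> i = height F x)")
  case True then show ?thesis using word_rot_fixed by auto
next
  case False
  have le: "i \<le> height F x" using assms(2) by (simp add: word_darts_def)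
  show ?thesis
  proof (cases b)
    case True then show ?thesis using False le word_rot_up[of i F x] by auto
  next
    case nb: False
    then have "i < height F x" using False le by auto
    then show ?thesis using word_rot_down[OF assms(1), of i x] nb False by auto
  qed
qed

text \<open>Makes \<open>up_dart\<close> an orientation that alternates around every inner
  vertex.\<close>

lemma word_rot_flip:
  assumes "cycle_word n F" "word_rot F d \<noteq> d"
  shows "up_dart (word_rot F d) \<longleftrightarrow> \<not> up_dart d"
proof -
  obtain x i b where d: "d = (x, i, b)" by (cases d) auto
  show ?thesis
  proof (cases b)
    case True
    then have "0 < i" "i \<le> height F x"
      using assms(2) d word_rot_fixed[of b i F x] by (cases "i = 0"; cases "i \<le> height F x"; simp)+
    then show ?thesis using word_rot_up d True by simp
  next
    case False
    then have "i < height F x"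
      using assms(2) d word_rot_fixed[of b i F x] by (cases "height F x \<le> i"; simp)
    then show ?thesis using word_rot_down[OF assms(1), of i x] d False by auto
  qed
qed

lemma finite_word_darts: "finite (word_darts n F)"
proof -
  have "word_darts n F = (\<Union>x\<in>{1..n}. \<Union>i\<in>{..height F x}. \<Union>b\<in>UNIV. {(x, i, b)})"
    unfolding word_darts_def by auto
  then show ?thesis by simp
qed

lemma layer_permutes:
  assumes "nontrivial_cycle n \<sigma>"
  shows "layer \<sigma> F permutes word_darts n (\<sigma> # F)"
proof (rule bij_imp_permutes)
  have inj: "inj \<sigma>" using nontrivial_cycleD(2)[OF assms] by (rule bij_is_inj)
  have perm: "\<sigma> permutes {1..n}" using nontrivial_cycleD[OF assms] by blast
  have mv: "\<sigma> (\<sigma> x) \<noteq> \<sigma> x" "x \<in> {1..n}" "\<sigma> x \<in> {1..n}" if "\<sigma> x \<noteq> x" for x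
    using that perm permutes_in_image[OF perm] inj unfolding permutes_def by (metis injD)+
  have into: "layer \<sigma> F d \<in> word_darts n (\<sigma> # F)" if "d \<in> word_darts n (\<sigma> # F)" for d
    using that mv by (cases d) (auto simp: layer_def word_darts_def height_Cons split: if_splits)
  have old: "layer \<sigma> F d = d" if "d \<notin> top_vertex \<sigma> F" for d
    using that by (cases d) (auto simp: top_vertex_def layer_def moved_def)
  have top: "layer \<sigma> F d \<in> top_vertex \<sigma> F" if "d \<in> top_vertex \<sigma> F" for d
    using that mv(1) unfolding top_vertex_def layer_def moved_def by fastforce
  \<comment> \<open>Two points outside the vertex are not moved, and a point inside cannot collide
    with one outside because the vertex is mapped into itself.\<close>
  have "d = d'" if "layer \<sigma> F d = layer \<sigma> F d'" for d d'
  proof (cases "d \<in> top_vertex \<sigma> F \<and> d' \<in> top_vertex \<sigma> F")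
    case True
    then show ?thesis using that inj_eq[OF inj] unfolding top_vertex_def layer_def moved_def
      by auto
  next
    case False
    then show ?thesis using that old top by metis
  qed
  then have "inj (layer \<sigma> F)" by (rule injI)
  then have "inj_on (layer \<sigma> F) (word_darts n (\<sigma> # F))" by (rule inj_on_subset) simp
  then show "bij_betw (layer \<sigma> F) (word_darts n (\<sigma> # F)) (word_darts n (\<sigma> # F))"
    unfolding bij_betw_def using into endo_inj_surj[OF finite_word_darts] by (metis image_subsetI)
  show "layer \<sigma> F d = d" if "d \<notin> word_darts n (\<sigma> # F)" for d
    using that mv(2) by (cases d) (auto simp: layer_def word_darts_def height_Cons split: if_splits)
qed

lemma word_darts_mono: "word_darts n F \<subseteq> word_darts n (\<sigma> # F)"
  by (auto simp: word_darts_def height_Cons le_SucI)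

lemma word_rot_permutes:
  assumes "cycle_word n F"
  shows "word_rot F permutes word_darts n F"
  using assms
proof (induction F)
  case (Cons \<sigma> F)
  then have "word_rot F permutes word_darts n F" by simp
  then have "word_rot F permutes word_darts n (\<sigma> # F)" using word_darts_mono by (rule permutes_subset)
  then show ?case using layer_permutes[of n \<sigma> F] Cons.prems
    by (auto simp: comp_def[symmetric] simp del: comp_apply intro: permutes_compose)
qed (simp add: permutes_id)

lemma word_rot_permutation: "cycle_word n F \<Longrightarrow> permutation (word_rot F)"
  using word_rot_permutes finite_word_darts permutation_permutes by blast

lemma word_opp_apply: "(x, i, b) \<in> word_darts n F \<Longrightarrow> word_opp n F (x, i, b) = (x, i, \<not> b)"
  by (simp add: word_opp_def word_darts_def)

lemma word_opp_word_opp [simp]: "word_opp n F (word_opp n F d) = d"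
  by (auto simp: word_opp_def split: prod.split)

lemma word_opp_permutes: "word_opp n F permutes word_darts n F"
proof -
  have "word_opp n F d = d" if "d \<notin> word_darts n F" for d
    using that by (auto simp: word_opp_def word_darts_def split: prod.splits)
  moreover have "\<exists>!d. word_opp n F d = d'" for d' using word_opp_word_opp by metis
  ultimately show ?thesis unfolding permutes_def by blast
qed

lemma word_opp_in: "d \<in> word_darts n F \<Longrightarrow> word_opp n F d \<in> word_darts n F"
  using permutes_in_image[OF word_opp_permutes] by blast

lemma word_rot_in: "cycle_word n F \<Longrightarrow> d \<in> word_darts n F \<Longrightarrow> word_rot F d \<in> word_darts n F"
  using permutes_in_image[OF word_rot_permutes] by blast

lemma up_word_opp: "d \<in> word_darts n F \<Longrightarrow> up_dart (word_opp n F d) \<longleftrightarrow> \<not> up_dart d"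
  by (cases d) (auto simp: word_opp_apply)

subsection \<open>Vertices\<close>

definition inner_vertices :: "(nat \<Rightarrow> nat) list \<Rightarrow> dart set set" where
  "inner_vertices F = orbit (word_rot F) ` {d. word_rot F d \<noteq> d}"

lemma card_top_vertex:
  assumes "finite (moved \<sigma>)"
  shows "card (top_vertex \<sigma> F) = 2 * card (moved \<sigma>)"
  unfolding top_vertex_def using assms
  by (subst card_Un_disjoint) (auto simp: card_image inj_on_def)

text \<open>Every second step acts on incoming half-edges as \<sigma>, which is transitive on its
  moved points, so all of them are reached. Each outgoing half-edge is the successor of an incoming
  one.\<close>

lemma orbit_word_rot_top:
  assumes \<sigma>: "nontrivial_cycle n \<sigma>" and F: "cycle_word n F" and d: "d \<in> top_vertex \<sigma> F"
  shows "orbit (word_rot (\<sigma> # F)) d = top_vertex \<sigma> F"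
proof -
  let ?f = "word_rot (\<sigma> # F)"
  have perm: "permutation ?f" using word_rot_permutation[where n = n and F = "\<sigma> # F"] \<sigma> F by simp
  have mv: "\<sigma> x \<in> moved \<sigma>" if "x \<in> moved \<sigma>" for x
    using bij_moved_iff[OF nontrivial_cycleD(2)[OF \<sigma>], of x] that by (simp add: moved_def)
  note top = word_rot_top[OF \<sigma>]
  obtain x where x: "x \<in> moved \<sigma>" using d by (auto simp: top_vertex_def)
  let ?d = "(x, height F x, False)"
  have closed: "?f e \<in> top_vertex \<sigma> F" if "e \<in> top_vertex \<sigma> F" for e
    using that mv top unfolding top_vertex_def by (auto simp: moved_def simp del: word_rot.simps)
  have "e \<in> top_vertex \<sigma> F" if "e \<in> orbit ?f ?d" for e
    using that
  proof (induction rule: orbit.induct)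
    case base
    then show ?case using x closed unfolding top_vertex_def by blast
  qed (use closed in blast)
  moreover have down: "(y, height F y, False) \<in> orbit ?f ?d" if "y \<in> moved \<sigma>" for y
  proof -
    have "y \<in> orbit \<sigma> x" using orbit_cyclic_eq3[OF nontrivial_cycleD(4)[OF \<sigma>] x] that by simp
    then show ?thesis
    proof induction
      case base
      have "?f (?f ?d) = (\<sigma> x, height F (\<sigma> x), False)"
        using x mv[OF x] top unfolding moved_def by (simp del: word_rot.simps)
      then show ?case by (metis orbit.base orbit.step)
    next
      case (step y)
      then have y: "y \<in> moved \<sigma>"
        using orbit_cyclic_eq3[OF nontrivial_cycleD(4)[OF \<sigma>] x] by simp
      have "?f (?f (y, height F y, False)) = (\<sigma> y, height F (\<sigma> y), False)"
        using y mv[OF y] top unfolding moved_def by (simp del: word_rot.simps)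
      then show ?case using step.IH by (metis orbit.step)
    qed
  qed
  moreover have "(y, Suc (height F y), True) \<in> orbit ?f ?d" if y: "y \<in> moved \<sigma>" for y
  proof -
    obtain z where z: "\<sigma> z = y" using bij_is_surj[OF nontrivial_cycleD(2)[OF \<sigma>]] by (metis surj_def)
    then have "z \<in> moved \<sigma>" using y unfolding moved_def by auto
    then have "(z, height F z, False) \<in> orbit ?f ?d" "?f (z, height F z, False) = (y, Suc (height F y), True)"
      using down[of z] top(1)[of z F] z unfolding moved_def by auto
    then show ?thesis using orbit.step by metis
  qed
  ultimately have "orbit ?f ?d = top_vertex \<sigma> F" unfolding top_vertex_def by blast
  then show ?thesis using orbit_eq_orbit[OF perm, of d ?d] d by simp
qed

lemma word_rot_top_vertex_fixed: "d \<in> top_vertex \<sigma> F \<Longrightarrow> word_rot F d = d"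
  by (auto simp: top_vertex_def word_rot_fixed)

lemma word_rot_Cons_old: "d \<notin> top_vertex \<sigma> F \<Longrightarrow> word_rot (\<sigma> # F) d = word_rot F d"
  by (cases d) (auto simp: top_vertex_def layer_def moved_def)

lemma word_rot_Cons_top_moved:
  assumes "nontrivial_cycle n \<sigma>" "d \<in> top_vertex \<sigma> F"
  shows "word_rot (\<sigma> # F) d \<noteq> d"
  using assms(2) word_rot_top[OF assms(1)] by (auto simp: top_vertex_def moved_def simp del: word_rot.simps)

text \<open>Half-edges of the new vertex were fixed before, hence lie on no other old orbit;
  elsewhere the two rotations agree.\<close>

lemma orbit_word_rot_old:
  assumes "cycle_word n F" "d \<notin> top_vertex \<sigma> F"
  shows "orbit (word_rot (\<sigma> # F)) d = orbit (word_rot F) d"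
proof (rule orbit_cong)
  have perm: "permutation (word_rot F)" using word_rot_permutation assms(1) .
  then show "d \<in> orbit (word_rot F) d" by (rule permutation_self_in_orbit)
  fix e assume e: "e \<in> orbit (word_rot F) d"
  have "e \<notin> top_vertex \<sigma> F"
  proof
    assume t: "e \<in> top_vertex \<sigma> F"
    then have "orbit (word_rot F) e = {e}" using word_rot_top_vertex_fixed orbit_eq_singleton_iff by metis
    then have "d = e" using orbit_eq_orbit[OF perm e] permutation_self_in_orbit[OF perm, of d] by auto
    then show False using t assms(2) by simp
  qed
  then show "word_rot (\<sigma> # F) e = word_rot F e" by (rule word_rot_Cons_old)
qed

lemma inner_vertices_Nil [simp]: "inner_vertices [] = {}"
  by (simp add: inner_vertices_def)

lemma inner_vertices_Cons:
  assumes \<sigma>: "nontrivial_cycle n \<sigma>" and F: "cycle_word n F"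
  shows "inner_vertices (\<sigma> # F) = insert (top_vertex \<sigma> F) (inner_vertices F)"
    and "top_vertex \<sigma> F \<notin> inner_vertices F"
proof -
  have ne: "\<exists>d. d \<in> top_vertex \<sigma> F"
    using nontrivial_cycleD(4)[OF \<sigma>] unfolding top_vertex_def cyclic_on_def by blast
  have "{d. word_rot (\<sigma> # F) d \<noteq> d} = top_vertex \<sigma> F \<union> {d. word_rot F d \<noteq> d}"
    (is "?L = ?R")
  proof (rule Set.set_eqI)
    fix d show "d \<in> ?L \<longleftrightarrow> d \<in> ?R"
      using word_rot_Cons_top_moved[OF \<sigma>, of d F] word_rot_Cons_old[of d \<sigma> F]
      by (cases "d \<in> top_vertex \<sigma> F") (simp_all del: word_rot.simps)
  qed
  moreover have "orbit (word_rot (\<sigma> # F)) d = orbit (word_rot F) d" if "word_rot F d \<noteq> d" for d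
    using orbit_word_rot_old[OF F] that word_rot_top_vertex_fixed by metis
  ultimately show "inner_vertices (\<sigma> # F) = insert (top_vertex \<sigma> F) (inner_vertices F)"
    unfolding inner_vertices_def using ne orbit_word_rot_top[OF \<sigma> F] by (auto simp: image_Un simp del: word_rot.simps)
  show "top_vertex \<sigma> F \<notin> inner_vertices F"
  proof
    assume "top_vertex \<sigma> F \<in> inner_vertices F"
    then obtain d where d: "word_rot F d \<noteq> d" "top_vertex \<sigma> F = orbit (word_rot F) d"
      by (auto simp: inner_vertices_def)
    then have "d \<in> top_vertex \<sigma> F" using permutation_self_in_orbit[OF word_rot_permutation[OF F]] by simp
    then show False using d(1) word_rot_top_vertex_fixed by simp
  qed
qed

lemma inner_vertices_facts:
  assumes "cycle_word n F"
  shows "finite (inner_vertices F)" "card (inner_vertices F) = length F"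
    "v \<in> inner_vertices F \<Longrightarrow> even (card v) \<and> 4 \<le> card v"
    "2 \<le> k \<Longrightarrow> card {v \<in> inner_vertices F. card v = 2 * k} = signature n F k"
proof -
  have "finite (inner_vertices F) \<and> card (inner_vertices F) = length F \<and>
    (\<forall>v\<in>inner_vertices F. even (card v) \<and> 4 \<le> card v) \<and>
    (\<forall>k\<ge>2. card {v \<in> inner_vertices F. card v = 2 * k} = signature n F k)"
    using assms
  proof (induction F)
    case (Cons \<sigma> F)
    then have \<sigma>: "nontrivial_cycle n \<sigma>" and F: "cycle_word n F" by auto
    note IH = Cons.IH[OF F]
    note inner = inner_vertices_Cons[OF \<sigma> F]
    have c: "card (top_vertex \<sigma> F) = 2 * card (moved \<sigma>)"
      using card_top_vertex nontrivial_cycleD[OF \<sigma>] by blast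
    have "card {v \<in> inner_vertices (\<sigma> # F). card v = 2 * k} = signature n (\<sigma> # F) k" if "2 \<le> k" for k
    proof -
      have "{v \<in> inner_vertices (\<sigma> # F). card v = 2 * k} =
        (if card (moved \<sigma>) = k then insert (top_vertex \<sigma> F) {v \<in> inner_vertices F. card v = 2 * k}
         else {v \<in> inner_vertices F. card v = 2 * k})"
        using inner c by auto
      then show ?thesis using IH inner(2) that \<sigma> k_cycle_iff[OF that, of n \<sigma>]
        by (simp add: signature_def)
    qed
    then show ?case using IH inner c card_moved_ge_2[OF nontrivial_cycleD(4)[OF \<sigma>]] by auto
  qed (simp add: signature_def)
  then show "finite (inner_vertices F)" "card (inner_vertices F) = length F"
    "v \<in> inner_vertices F \<Longrightarrow> even (card v) \<and> 4 \<le> card v"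
    "2 \<le> k \<Longrightarrow> card {v \<in> inner_vertices F. card v = 2 * k} = signature n F k" by blast+
qed

text \<open>\<open>cs\<close> is meant to contain one line from each cycle of the product, in the
  order of the labels. A face is labelled through the lower end of its line, and the first line
  carries the distinguished leaf.\<close>

definition word_map :: "nat \<Rightarrow> nat list \<Rightarrow> (nat \<Rightarrow> nat) list \<Rightarrow> dart marked_map" where
  "word_map n cs F =
     \<lparr>darts = word_darts n F, rot = word_rot F, opp = word_opp n F,
      face_list = map (\<lambda>c. orbit (word_rot F \<circ> word_opp n F) (c, 0, True)) cs,
      marked_leaf = {(cs ! 0, 0, True)}\<rparr>"

lemma word_map_simps [simp]:
  "darts (word_map n cs F) = word_darts n F" "rot (word_map n cs F) = word_rot F" "opp (word_map n cs F) = word_opp n F"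
  "face_list (word_map n cs F) = map (\<lambda>c. orbit (word_rot F \<circ> word_opp n F) (c, 0, True)) cs"
  "marked_leaf (word_map n cs F) = {(cs ! 0, 0, True)}"
  by (simp_all add: word_map_def)

definition leaf_darts :: "nat \<Rightarrow> (nat \<Rightarrow> nat) list \<Rightarrow> dart set" where
  "leaf_darts n F = (\<lambda>x. (x, 0, True)) ` {1..n} \<union> (\<lambda>x. (x, height F x, False)) ` {1..n}"

lemma leaf_darts_eq:
  assumes "cycle_word n F"
  shows "leaf_darts n F = {d \<in> word_darts n F. word_rot F d = d}"
proof (rule Set.set_eqI)
  fix d :: dart
  obtain x i b where d: "d = (x, i, b)" by (cases d) auto
  show "d \<in> leaf_darts n F \<longleftrightarrow> d \<in> {d \<in> word_darts n F. word_rot F d = d}"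
    using word_rot_fixed_iff[OF assms, of x i b] unfolding d
    by (cases b) (auto simp: leaf_darts_def word_darts_def)
qed

lemma vertices_word_map:
  assumes "cycle_word n F"
  shows "vertices (word_map n cs F) = (\<lambda>d. {d}) ` leaf_darts n F \<union> inner_vertices F"
proof -
  have "{d. word_rot F d \<noteq> d} \<subseteq> word_darts n F"
    using word_rot_permutes[OF assms] unfolding permutes_def by blast
  then have "word_darts n F = leaf_darts n F \<union> {d. word_rot F d \<noteq> d}"
    unfolding leaf_darts_eq[OF assms] by blast
  moreover have "orbit (word_rot F) d = {d}" if "d \<in> leaf_darts n F" for d
    using that orbit_eq_singleton_iff[of "word_rot F" d] unfolding leaf_darts_eq[OF assms] by blast
  ultimately show ?thesis
    unfolding vertices_def vertex_at_def inner_vertices_def by (auto simp: image_Un)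
qed

lemma leaves_word_map:
  assumes "cycle_word n F"
  shows "leaves (word_map n cs F) = (\<lambda>d. {d}) ` leaf_darts n F"
proof -
  have "card v \<noteq> 1" if "v \<in> inner_vertices F" for v
    using inner_vertices_facts(3)[OF assms that] by auto
  then show ?thesis unfolding leaves_def vertices_word_map[OF assms] degree_def by auto
qed

lemma card_leaf_darts: "card (leaf_darts n F) = 2 * n"
  unfolding leaf_darts_def by (subst card_Un_disjoint) (auto simp: card_image inj_on_def)

section \<open>Counting vertices and edges, and their relation to depth\<close>

lemma card_vertices_word_map:
  assumes "cycle_word n F"
  shows "card (vertices (word_map n cs F)) = 2 * n + length F"
proof -
  have fin: "finite ((\<lambda>d. {d}) ` leaf_darts n F)" by (simp add: leaf_darts_def)
  have "card v = 1" if "v \<in> (\<lambda>d. {d}) ` leaf_darts n F" for v using that by auto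
  moreover have "card v \<noteq> 1" if "v \<in> inner_vertices F" for v
    using inner_vertices_facts(3)[OF assms that] by auto
  ultimately have "(\<lambda>d. {d}) ` leaf_darts n F \<inter> inner_vertices F = {}" by blast
  then show ?thesis
    unfolding vertices_word_map[OF assms]
    using inner_vertices_facts(1,2)[OF assms] fin card_leaf_darts[of n F]
    by (simp add: card_Un_disjoint card_image)
qed

text \<open>Double counting of the pairs of a factor occurrence and a line that it moves.\<close>

lemma sum_height:
  assumes "cycle_word n F"
  shows "(\<Sum>x\<in>{1..n}. height F x) = sum_list (map (\<lambda>\<sigma>. card (moved \<sigma>)) F)"
  using assms
proof (induction F)
  case (Cons \<sigma> F)
  then have mv: "moved \<sigma> \<subseteq> {1..n}" using nontrivial_cycleD by auto
  have "(\<Sum>x\<in>{1..n}. height (\<sigma> # F) x) = (\<Sum>x\<in>{1..n}. (if x \<in> moved \<sigma> then 1 else 0) + height F x)"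
    by (rule sum.cong) (auto simp: height_Cons moved_def)
  also have "\<dots> = card (moved \<sigma>) + (\<Sum>x\<in>{1..n}. height F x)"
    using mv by (simp add: sum.distrib sum.If_cases Int_absorb1)
  finally show ?case using Cons by simp
qed simp

lemma card_edges_word_map:
  assumes "cycle_word n F"
  shows "card (edges (word_map n cs F)) = n + sum_list (map (\<lambda>\<sigma>. card (moved \<sigma>)) F)"
proof -
  let ?e = "\<lambda>(x, i). {(x, i, True), (x, i, False)}"
  let ?I = "SIGMA x:{1..n}. {..height F x}"
  have eq: "edge_of (word_map n cs F) (x, i, b) = ?e (x, i)" if "(x, i, b) \<in> word_darts n F" for x i b
    using word_opp_apply[OF that] unfolding edge_of_def by (cases b) auto
  have "edges (word_map n cs F) = ?e ` ?I"
    unfolding edges_def word_map_simps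
  proof (intro equalityI subsetI)
    fix e assume "e \<in> edge_of (word_map n cs F) ` word_darts n F"
    then obtain x i b where "(x, i, b) \<in> word_darts n F" "e = edge_of (word_map n cs F) (x, i, b)" by auto
    then show "e \<in> ?e ` ?I" using eq[of x i b] by (auto simp: word_darts_def intro!: image_eqI[of _ _ "(x, i)"])
  next
    fix e assume "e \<in> ?e ` ?I"
    then obtain x i where "(x, i, True) \<in> word_darts n F" "e = ?e (x, i)" by (auto simp: word_darts_def)
    then show "e \<in> edge_of (word_map n cs F) ` word_darts n F" using eq[of x i True] by blast
  qed
  moreover have "inj_on ?e ?I" by (auto simp: inj_on_def doubleton_eq_iff)
  ultimately have "card (edges (word_map n cs F)) = card ?I" by (simp add: card_image)
  also have "\<dots> = (\<Sum>x\<in>{1..n}. Suc (height F x))" by (simp add: card_SigmaI)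
  also have "\<dots> = n + (\<Sum>x\<in>{1..n}. height F x)" by (simp add: sum_Suc)
  finally show ?thesis using sum_height[OF assms] by simp
qed

lemma depth_eq:
  assumes "cycle_word n F"
  shows "depth n F + length F = sum_list (map (\<lambda>\<sigma>. card (moved \<sigma>)) F)"
proof -
  \<comment> \<open>The index set in \<open>depth\<close> varies with F. The fixed range {2..n}
    makes induction on F possible, since a cycle inside {1..n} has length at most n.\<close>
  have sub: "{k. 2 \<le> k \<and> signature n F k \<noteq> 0} \<subseteq> {2..n}"
  proof
    fix k assume "k \<in> {k. 2 \<le> k \<and> signature n F k \<noteq> 0}"
    then have k: "2 \<le> k" "filter (k_cycle n k) F \<noteq> []" by (auto simp: signature_def)
    then obtain \<sigma> where "k_cycle n k \<sigma>" by (auto simp: filter_empty_conv)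
    then have "card (moved \<sigma>) = k" "moved \<sigma> \<subseteq> {1..n}"
      using k_cycle_iff[OF k(1)] nontrivial_cycleD by blast+
    then have "k \<le> n" using card_mono[of "{1..n}" "moved \<sigma>"] by simp
    then show "k \<in> {2..n}" using k by simp
  qed
  have "depth n F = (\<Sum>k\<in>{2..n}. (k - 1) * signature n F k)"
    unfolding depth_def using sub by (intro sum.mono_neutral_left) auto
  moreover have "(\<Sum>k\<in>{2..n}. (k - 1) * signature n F k) + length F = sum_list (map (\<lambda>\<sigma>. card (moved \<sigma>)) F)"
    using assms
  proof (induction F)
    case (Cons \<sigma> F)
    then have \<sigma>: "nontrivial_cycle n \<sigma>" by simp
    let ?c = "card (moved \<sigma>)"
    have c2: "2 \<le> ?c" using card_moved_ge_2 nontrivial_cycleD(4)[OF \<sigma>] by blast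
    have cn: "?c \<le> n" using card_mono[of "{1..n}" "moved \<sigma>"] nontrivial_cycleD(5)[OF \<sigma>] by simp
    have "(\<Sum>k\<in>{2..n}. (k - 1) * signature n (\<sigma> # F) k)
      = (\<Sum>k\<in>{2..n}. (if k = ?c then k - 1 else 0) + (k - 1) * signature n F k)"
      using \<sigma> k_cycle_iff by (intro sum.cong) (auto simp: signature_def)
    also have "\<dots> = (?c - 1) + (\<Sum>k\<in>{2..n}. (k - 1) * signature n F k)"
      using c2 cn by (simp add: sum.distrib sum.delta)
    finally show ?case using Cons c2 by simp
  qed (simp add: signature_def)
  ultimately show ?thesis by simp
qed

lemma top_vertex_closed:
  assumes "nontrivial_cycle n \<sigma>" "cycle_word n F" "d \<in> top_vertex \<sigma> F"
  shows "word_rot (\<sigma> # F) d \<in> top_vertex \<sigma> F"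
  using orbit_word_rot_top[OF assms] orbit.base[of "word_rot (\<sigma> # F)" d] by simp

text \<open>Time flows along the edges, so directed cycles are impossible.\<close>

lemma word_map_rank:
  assumes "cycle_word n F"
  shows "\<exists>rk :: dart \<Rightarrow> nat. \<forall>d\<in>word_darts n F. rk (word_rot F d) = rk d \<and>
    (up_dart d \<longrightarrow> rk d < rk (word_opp n F d))"
  using assms
proof (induction F)
  case Nil
  show ?case by (rule exI[where x = "\<lambda>(x, i, b). if b then 0 else 1"]) (auto simp: word_opp_def word_darts_def)
next
  case (Cons \<sigma> F)
  then have \<sigma>: "nontrivial_cycle n \<sigma>" and F: "cycle_word n F" by auto
  obtain rk :: "dart \<Rightarrow> nat" where rk: "\<And>d. d \<in> word_darts n F \<Longrightarrow> rk (word_rot F d) = rk d"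
    "\<And>d. d \<in> word_darts n F \<Longrightarrow> up_dart d \<Longrightarrow> rk d < rk (word_opp n F d)"
    using Cons.IH[OF F] by blast
  define N where "N = Max (rk ` word_darts n F)"
  have N: "rk d \<le> N" if "d \<in> word_darts n F" for d
    unfolding N_def using that finite_word_darts by (intro Max_ge) auto
  \<comment> \<open>The new vertex is placed above everything old and the far ends of its outgoing
    edges above it. Its incoming half-edges, so far leaves, are raised to N + 1, which only
    lengthens the increase along their edges.\<close>
  define rk' where "rk' d = (if d \<in> top_vertex \<sigma> F then N + 1
    else if d \<in> word_darts n F then rk d else N + 2)" for d
  have "rk' (word_rot (\<sigma> # F) d) = rk' d" for d
  proof (cases "d \<in> top_vertex \<sigma> F")
    case True
    then show ?thesis using top_vertex_closed[OF \<sigma> F True] unfolding rk'_def by (simp del: word_rot.simps)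
  next
    case False
    have inj: "inj (word_rot F)" using word_rot_permutes[OF F] permutes_inj by blast
    have "word_rot F d \<notin> top_vertex \<sigma> F"
    proof
      assume "word_rot F d \<in> top_vertex \<sigma> F"
      then have "word_rot F (word_rot F d) = word_rot F d" by (rule word_rot_top_vertex_fixed)
      then have "word_rot F d = d" using inj by (simp add: inj_eq)
      then show False using False \<open>word_rot F d \<in> top_vertex \<sigma> F\<close> by simp
    qed
    then show ?thesis
      using False word_rot_Cons_old[OF False] rk(1) permutes_in_image[OF word_rot_permutes[OF F]]
      unfolding rk'_def by (simp del: word_rot.simps)
  qed
  moreover have "rk' d < rk' (word_opp n (\<sigma> # F) d)" if d: "d \<in> word_darts n (\<sigma> # F)" "up_dart d" for d
  proof -
    obtain x i where xi: "d = (x, i, True)" using d(2) by (cases d) auto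
    have opp: "word_opp n (\<sigma> # F) d = (x, i, False)" using word_opp_apply d(1) xi by simp
    show ?thesis
    proof (cases "d \<in> top_vertex \<sigma> F")
      case True
      then have "i = Suc (height F x)" using xi by (auto simp: top_vertex_def)
      then have "(x, i, False) \<notin> top_vertex \<sigma> F" "(x, i, False) \<notin> word_darts n F"
        by (auto simp: top_vertex_def word_darts_def)
      then show ?thesis using True opp unfolding rk'_def by simp
    next
      case False
      then have dF: "d \<in> word_darts n F"
        using d(1) xi by (auto simp: word_darts_def top_vertex_def height_Cons moved_def split: if_splits)
      then have dF': "(x, i, False) \<in> word_darts n F" using xi by (simp add: word_darts_def)
      have "word_opp n F d = (x, i, False)" using word_opp_apply dF xi by simp
      then have "rk d < rk (x, i, False)" using rk(2)[OF dF d(2)] by simp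
      then show ?thesis using False dF dF' opp N[OF dF] unfolding rk'_def by simp
    qed
  qed
  ultimately show ?case by (intro exI[where x = rk']) blast
qed

subsection \<open>Faces\<close>

definition word_prod :: "(nat \<Rightarrow> nat) list \<Rightarrow> nat \<Rightarrow> nat" where
  "word_prod F = foldr (\<circ>) F id"

lemma word_prod_simps [simp]: "word_prod [] = id" "word_prod (\<sigma> # F) = \<sigma> \<circ> word_prod F"
  by (simp_all add: word_prod_def)

lemma word_prod_permutes: "cycle_word n F \<Longrightarrow> word_prod F permutes {1..n}"
proof (induction F)
  case (Cons \<sigma> F)
  then have "word_prod F permutes {1..n}" "\<sigma> permutes {1..n}" using nontrivial_cycleD(1) by auto
  then show ?case unfolding word_prod_simps by (rule permutes_compose)
qed (simp add: permutes_id)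

text \<open>The value at the end of the computation of \<^term>\<open>word_prod F\<close> that starts on the
  \<open>i\<close>-th edge of line \<open>x\<close>.\<close>

primrec exit_line :: "(nat \<Rightarrow> nat) list \<Rightarrow> nat \<Rightarrow> nat \<Rightarrow> nat" where
  "exit_line [] x i = x"
| "exit_line (\<sigma> # F) x i = (if height F x < i then x else \<sigma> (exit_line F x i))"

lemma exit_line_top: "exit_line F x (height F x) = x"
  by (induction F) (auto simp: height_Cons)

lemma exit_line_0: "exit_line F x 0 = word_prod F x"
  by (induction F) auto

text \<open>At a vertex an ascending boundary walk changes from line x to the image of x under the
  factor, which is exactly one step in evaluating the product.\<close>

lemma exit_line_word_rot:
  assumes "cycle_word n F" "i < height F x" "word_rot F (x, i, False) = (y, j, True)"
  shows "exit_line F y j = exit_line F x i"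
  using assms
proof (induction F arbitrary: y j)
  case (Cons \<sigma> F)
  then have \<sigma>: "nontrivial_cycle n \<sigma>" and F: "cycle_word n F" by auto
  show ?case
  proof (cases "\<sigma> x \<noteq> x \<and> i = height F x")
    case True
    then have "y = \<sigma> x" "j = Suc (height F (\<sigma> x))"
      using Cons.prems(3) word_rot_top(1)[OF \<sigma>, of x F] by auto
    then show ?thesis using True exit_line_top by simp
  next
    case False
    then have i: "i < height F x" using Cons.prems(2) by (auto simp: height_Cons split: if_splits)
    have "word_rot F (x, i, False) = (y, j, True)"
      using Cons.prems(3) False by (auto simp: layer_def)
    moreover from this have "j \<le> height F y" using word_rot_down[OF F i] by auto
    ultimately show ?thesis using Cons.IH[OF F i] i by simp
  qed
qed simp

lemma exit_line_in: "cycle_word n F \<Longrightarrow> x \<in> {1..n} \<Longrightarrow> exit_line F x i \<in> {1..n}"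
proof (induction F)
  case (Cons \<sigma> F)
  then show ?case using permutes_in_image[OF nontrivial_cycleD(1), of n \<sigma>] by auto
qed simp

text \<open>A boundary walk ascends to an upper leaf, turns, and descends straight along that line;
  the label is the line of this upper leaf. It stays constant until the walk passes a lower leaf,
  where the product is applied to it. Hence faces correspond to cycles of the product.\<close>

definition face_label :: "(nat \<Rightarrow> nat) list \<Rightarrow> dart \<Rightarrow> nat" where
  "face_label F = (\<lambda>(x, i, b). if b then exit_line F x i else x)"

lemma face_label_in: "cycle_word n F \<Longrightarrow> d \<in> word_darts n F \<Longrightarrow> face_label F d \<in> {1..n}"
  using exit_line_in by (auto simp: face_label_def word_darts_def simp del: atLeastAtMost_iff split: prod.splits)

abbreviation face_rot :: "nat \<Rightarrow> (nat \<Rightarrow> nat) list \<Rightarrow> dart \<Rightarrow> dart" where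
  "face_rot n F \<equiv> word_rot F \<circ> word_opp n F"

lemma face_rot_permutes: "cycle_word n F \<Longrightarrow> face_rot n F permutes word_darts n F"
  using word_rot_permutes word_opp_permutes permutes_compose by blast

lemma face_rot_permutation: "cycle_word n F \<Longrightarrow> permutation (face_rot n F)"
  using face_rot_permutes finite_word_darts permutation_permutes by blast

lemma face_rot_cases:
  assumes "cycle_word n F" "d \<in> word_darts n F"
  obtains (up) x i where "d = (x, i, True)" "i < height F x" "up_dart (face_rot n F d)"
      "face_rot n F d \<in> word_darts n F" "face_label F (face_rot n F d) = face_label F d"
  | (turn) x where "d = (x, height F x, True)" "face_rot n F d = (x, height F x, False)"
  | (down) x i where "d = (x, Suc i, False)" "face_rot n F d = (x, i, False)"
  | (source) x where "d = (x, 0, False)" "face_rot n F d = (x, 0, True)"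
proof -
  obtain x i b where d: "d = (x, i, b)" by (cases d) auto
  have le: "i \<le> height F x" using assms(2) d by (simp add: word_darts_def)
  have opp: "word_opp n F d = (x, i, \<not> b)" using word_opp_apply assms(2) d by simp
  consider "b" "i < height F x" | "b" "i = height F x" | "\<not> b" "i = 0" | "\<not> b" "0 < i"
    using le by linarith
  then show thesis
  proof cases
    case 1
    obtain y j where y: "word_rot F (x, i, False) = (y, j, True)" using word_rot_down[OF assms(1) 1(2)] by blast
    then have e: "face_rot n F d = (y, j, True)" using opp 1(1) by simp
    moreover have "face_label F (y, j, True) = face_label F d"
      using exit_line_word_rot[OF assms(1) 1(2) y] d 1(1) by (simp add: face_label_def)
    moreover have "face_rot n F d \<in> word_darts n F"
      using assms(2) permutes_in_image[OF face_rot_permutes[OF assms(1)]] by metis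
    ultimately show thesis using up[of x i] d 1 by simp
  next
    case 2 then show thesis using turn[of x] d opp word_rot_fixed[of False i F x] by simp
  next
    case 3 then show thesis using source[of x] d opp word_rot_fixed[of True i F x] by simp
  next
    case 4 then show thesis using down[of x "i - 1"] d opp word_rot_up[of i F x] le by simp
  qed
qed

lemma face_label_source: "face_label F (x, 0, True) = word_prod F x"
  by (simp add: face_label_def exit_line_0)

lemma face_label_step:
  assumes "cycle_word n F" "d \<in> word_darts n F"
  shows "face_label F (face_rot n F d) \<in> {face_label F d, word_prod F (face_label F d)}"
  using assms
proof (cases rule: face_rot_cases)
  case (turn x) then show ?thesis by (simp add: face_label_def exit_line_top)
next
  case (source x) then show ?thesis using face_label_source by (simp add: face_label_def)
qed (simp_all add: face_label_def)

text \<open>Every ascending step raises the rank, so an ascent is finite. It ends at the upper leaf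
  of the line named by the label, from which the walk descends to the bottom.\<close>

lemma face_reach_source:
  assumes F: "cycle_word n F" and d: "d \<in> word_darts n F"
  shows "(face_label F d, 0, False) \<in> orbit (face_rot n F) d"
proof -
  let ?\<phi> = "face_rot n F"
  have self: "e \<in> orbit ?\<phi> e" for e using permutation_self_in_orbit[OF face_rot_permutation[OF F]] .
  have step: "t \<in> orbit ?\<phi> d" if "t \<in> orbit ?\<phi> (?\<phi> d)" for t d
    using that orbit_trans orbit.base by metis
  have down_x: "(x, 0, False) \<in> orbit ?\<phi> (x, i, False)" if "(x, i, False) \<in> word_darts n F" for x i
    using that
  proof (induction i)
    case (Suc i)
    have "?\<phi> (x, Suc i, False) = (x, i, False)"
      using F Suc.prems by (cases rule: face_rot_cases) auto
    moreover have "(x, i, False) \<in> word_darts n F" using Suc.prems by (simp add: word_darts_def)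
    ultimately show ?case using Suc.IH step by metis
  qed (rule self)
  obtain rk :: "dart \<Rightarrow> nat" where rk: "\<And>d. d \<in> word_darts n F \<Longrightarrow> rk (word_rot F d) = rk d"
    "\<And>d. d \<in> word_darts n F \<Longrightarrow> up_dart d \<Longrightarrow> rk d < rk (word_opp n F d)"
    using word_map_rank[OF F] by blast
  define N where "N = Max (rk ` word_darts n F)"
  have N: "rk d \<le> N" if "d \<in> word_darts n F" for d
    unfolding N_def using that finite_word_darts by (intro Max_ge) auto
  show ?thesis using d
  proof (induction "N - rk d" arbitrary: d rule: less_induct)
    case less
    note d = less.prems
    from F d show ?case
    proof (cases rule: face_rot_cases)
      case (up x i)
      have "rk d < rk (word_opp n F d)" using rk(2)[OF d] up(1) by simp
      also have "\<dots> = rk (?\<phi> d)" using rk(1)[OF word_opp_in[OF d]] by simp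
      finally have "N - rk (?\<phi> d) < N - rk d" using N[OF up(4)] by linarith
      then show ?thesis using less.hyps[OF _ up(4)] up(5) step by metis
    next
      case (turn x)
      have "(x, height F x, False) \<in> word_darts n F" using d turn(1) by (simp add: word_darts_def)
      then have "(x, 0, False) \<in> orbit ?\<phi> (?\<phi> d)" using turn(2) down_x by simp
      then have "(x, 0, False) \<in> orbit ?\<phi> d" by (rule step)
      then show ?thesis using turn(1) by (simp add: face_label_def exit_line_top)
    next
      case (down x i)
      then show ?thesis using d down_x[of x "Suc i"] by (simp add: face_label_def)
    next
      case (source x) then show ?thesis using self by (simp add: face_label_def)
    qed
  qed
qed

text \<open>One inclusion holds because a step changes the label at most by the product. For the
  other, every half-edge shares its orbit with the bottom of the line that labels it, and the
  bottoms of y and of its image under the product share an orbit.\<close>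

lemma orbit_face_rot:
  assumes F: "cycle_word n F" and d: "d \<in> word_darts n F"
  shows "orbit (face_rot n F) d
    = {e \<in> word_darts n F. face_label F e \<in> orbit (word_prod F) (face_label F d)}" (is "?L = ?R")
proof
  let ?\<phi> = "face_rot n F" and ?\<pi> = "word_prod F"
  have \<pi>: "permutation ?\<pi>"
    using word_prod_permutes[OF F] permutation_permutes by blast
  have in_D: "?\<phi> e \<in> word_darts n F" if "e \<in> word_darts n F" for e
    using that face_rot_permutes[OF F] permutes_in_image by metis
  have lab: "face_label F (?\<phi> e) \<in> orbit ?\<pi> y" if "e \<in> word_darts n F" "face_label F e \<in> orbit ?\<pi> y" for e y
    using face_label_step[OF F that(1)] orbit.step[OF that(2)] that(2) by auto
  show "?L \<subseteq> ?R"
  proof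
    fix e assume "e \<in> ?L"
    then show "e \<in> ?R"
    proof (induction rule: orbit.induct)
      case base
      show ?case using in_D[OF d] lab[OF d permutation_self_in_orbit[OF \<pi>]] by blast
    next
      case (step e) then show ?case using in_D lab by blast
    qed
  qed
  have perm: "permutation ?\<phi>" by (rule face_rot_permutation[OF F])
  have eq: "orbit ?\<phi> (face_label F e, 0, False) = orbit ?\<phi> e" if "e \<in> word_darts n F" for e
    using orbit_eq_orbit[OF perm face_reach_source[OF F that]] .
  have D0: "(y, 0, b) \<in> word_darts n F" if "y \<in> {1..n}" for y b using that by (simp add: word_darts_def)
  \<comment> \<open>Turning at the lower leaf of y starts an ascent whose label is the image of
    y.\<close>
  have nxt: "orbit ?\<phi> (?\<pi> y, 0, False) = orbit ?\<phi> (y, 0, False)" if y: "y \<in> {1..n}" for y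
  proof -
    have "?\<phi> (y, 0, False) = (y, 0, True)" using F D0[OF y, of False] by (cases rule: face_rot_cases) auto
    then have "(y, 0, True) \<in> orbit ?\<phi> (y, 0, False)" using orbit.base by metis
    then show ?thesis using eq[OF D0[OF y, of True]] face_label_source orbit_eq_orbit[OF perm] by metis
  qed
  have "orbit ?\<phi> (z, 0, False) = orbit ?\<phi> (y, 0, False) \<and> z \<in> {1..n}" if "z \<in> orbit ?\<pi> y" "y \<in> {1..n}" for y z
    using that
  proof (induction rule: orbit.induct)
    case base then show ?case using nxt permutes_in_image[OF word_prod_permutes[OF F]] by blast
  next
    case (step z) then show ?case using nxt permutes_in_image[OF word_prod_permutes[OF F]] by metis
  qed
  then have src: "orbit ?\<phi> (z, 0, False) = orbit ?\<phi> (y, 0, False)"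
    if "z \<in> orbit ?\<pi> y" "y \<in> {1..n}" for y z using that by blast
  have "orbit ?\<phi> e = orbit ?\<phi> d" if "e \<in> ?R" for e
  proof -
    have "orbit ?\<phi> (face_label F e, 0, False) = orbit ?\<phi> (face_label F d, 0, False)"
      using that src face_label_in[OF F d] by blast
    then show ?thesis using that eq[of e] eq[OF d] by simp
  qed
  then show "?R \<subseteq> ?L" using permutation_self_in_orbit[OF perm] by blast
qed

text \<open>The half-edge starting at the lower leaf of c has label \<open>word_prod F c\<close>
  instead of c, but both are on the same cycle.\<close>

lemma orbit_face_rot_source:
  assumes F: "cycle_word n F" and c: "c \<in> {1..n}"
  shows "orbit (face_rot n F) (c, 0, True)
    = {e \<in> word_darts n F. face_label F e \<in> orbit (word_prod F) c}"
proof -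
  have \<pi>: "permutation (word_prod F)"
    using word_prod_permutes[OF F] permutation_permutes by blast
  have "(c, 0, True) \<in> word_darts n F" using c by (simp add: word_darts_def)
  then show ?thesis using orbit_face_rot[OF F] face_label_source permutation_orbit_step[OF \<pi>] by simp
qed

lemma faces_word_map:
  assumes F: "cycle_word n F"
  shows "faces (word_map n cs F) = (\<lambda>c. orbit (face_rot n F) (c, 0, True)) ` {1..n}"
    and "faces (word_map n cs F) = (\<lambda>C. {e \<in> word_darts n F. face_label F e \<in> C}) ` perm_cycles n (word_prod F)"
    and "card (faces (word_map n cs F)) = card (perm_cycles n (word_prod F))"
proof -
  let ?G = "\<lambda>C. {e \<in> word_darts n F. face_label F e \<in> C}" and ?\<pi> = "word_prod F"
  have D0: "(y, 0, b) \<in> word_darts n F" if "y \<in> {1..n}" for y b using that by (simp add: word_darts_def)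
  have src: "orbit (face_rot n F) (c, 0, True) = ?G (orbit ?\<pi> c)" if "c \<in> {1..n}" for c
    using orbit_face_rot_source[OF F that] .
  have "orbit (face_rot n F) d = ?G (orbit ?\<pi> (face_label F d))" if "d \<in> word_darts n F" for d
    using orbit_face_rot[OF F that] .
  then have "orbit (face_rot n F) d = orbit (face_rot n F) (face_label F d, 0, True)"
    if "d \<in> word_darts n F" for d using that src[OF face_label_in[OF F that]] by simp
  then show 1: "faces (word_map n cs F) = (\<lambda>c. orbit (face_rot n F) (c, 0, True)) ` {1..n}"
    unfolding faces_def word_map_simps using face_label_in[OF F] D0 by blast
  then show 2: "faces (word_map n cs F) = ?G ` perm_cycles n ?\<pi>"
    unfolding perm_cycles_def image_image using src by simp
  have "inj_on ?G (perm_cycles n ?\<pi>)"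
  proof (rule inj_onI)
    fix C C' assume C: "C \<in> perm_cycles n ?\<pi>" "C' \<in> perm_cycles n ?\<pi>" and eq: "?G C = ?G C'"
    have sub: "C \<subseteq> {1..n}" "C' \<subseteq> {1..n}"
      using C permutes_orbit_subset[OF word_prod_permutes[OF F]] unfolding perm_cycles_def by blast+
    have "y \<in> C \<longleftrightarrow> y \<in> C'" if "y \<in> {1..n}" for y
    proof -
      \<comment> \<open>The downward half-edge at the bottom of y has label y, so a face determines
        its cycle.\<close>
      have "(y, 0, False) \<in> ?G C \<longleftrightarrow> (y, 0, False) \<in> ?G C'" using eq by simp
      then show ?thesis using D0[OF that] by (simp add: face_label_def)
    qed
    then show "C = C'" using sub by blast
  qed
  then show "card (faces (word_map n cs F)) = card (perm_cycles n ?\<pi>)" using 2 by (simp add: card_image)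
qed

text \<open>The upper leaf of x has label x and the lower one the image of x. Both belong to the
  face exactly if x is on the cycle, whence the factor 2.\<close>

lemma card_leaves_in_word_map:
  assumes F: "cycle_word n F" and c: "c \<in> {1..n}"
  shows "card (leaves_in (word_map n cs F) (orbit (face_rot n F) (c, 0, True)))
    = 2 * card (orbit (word_prod F) c)"
proof -
  let ?\<pi> = "word_prod F"
  let ?O = "orbit ?\<pi> c"
  have \<pi>: "permutation ?\<pi>" using word_prod_permutes[OF F] permutation_permutes by blast
  have sub: "?O \<subseteq> {1..n}" using permutes_orbit_subset[OF word_prod_permutes[OF F] c] .
  have pre: "?\<pi> x \<in> ?O \<longleftrightarrow> x \<in> ?O" for x
    using permutation_orbit_step[OF \<pi>, of x] orbit_eq_iff[OF \<pi>] by metis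
  let ?L = "(\<lambda>x. (x, 0, True)) ` ?O \<union> (\<lambda>x. (x, height F x, False)) ` ?O"
  have "leaves_in (word_map n cs F) (orbit (face_rot n F) (c, 0, True))
    = (\<lambda>d. {d}) ` {d \<in> leaf_darts n F. face_label F d \<in> ?O}"
    unfolding leaves_in_def leaves_word_map[OF F] orbit_face_rot_source[OF F c]
    using leaf_darts_eq[OF F] by auto
  also have "{d \<in> leaf_darts n F. face_label F d \<in> ?O} = ?L"
  proof (rule Set.set_eqI)
    fix d :: dart
    obtain x i b where d: "d = (x, i, b)" by (cases d) auto
    show "d \<in> {d \<in> leaf_darts n F. face_label F d \<in> ?O} \<longleftrightarrow> d \<in> ?L"
      using sub pre[of x] unfolding d leaf_darts_def
      by (cases b) (auto simp: face_label_def exit_line_0 image_iff)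
  qed
  also have "card ((\<lambda>d. {d}) ` ?L) = card ?L" by (simp add: card_image)
  also have "\<dots> = 2 * card ?O"
    using finite_subset[OF sub] by (subst card_Un_disjoint) (auto simp: card_image inj_on_def)
  finally show ?thesis .
qed

text \<open>Vertices minus edges is (2n + length F) - (n + depth + length F) = n - depth, so the
  Euler characteristic is the depth formula rearranged.\<close>

lemma genus_word_map_iff:
  assumes F: "cycle_word n F"
  shows "genus_map g (word_map n cs F) \<longleftrightarrow>
    int (depth n F) = int n + int (card (perm_cycles n (word_prod F))) - 2 + 2 * int g"
  unfolding genus_map_def card_vertices_word_map[OF F] card_edges_word_map[OF F] faces_word_map(3)[OF F]
    depth_eq[OF F, symmetric] by auto

subsection \<open>Connectedness and transitivity\<close>

definition dart_steps :: "('d, 'z) rotation_system_scheme \<Rightarrow> ('d \<times> 'd) set" where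
  "dart_steps M = {(x, y). y = rot M x \<or> y = opp M x}"

lemma connected_map_alt:
  "connected_map M \<longleftrightarrow> (\<forall>d\<in>darts M. \<forall>d'\<in>darts M. (d, d') \<in> (dart_steps M)\<^sup>*)"
  unfolding connected_map_def dart_steps_def ..

text \<open>A permutation of finite order has its inverse among its powers.\<close>

lemma sym_dart_steps:
  assumes "permutation (rot M)" "permutation (opp M)"
  shows "sym ((dart_steps M)\<^sup>*)"
proof -
  have inverse_step: "(f x, x) \<in> (dart_steps M)\<^sup>*"
    if f: "permutation f" "\<And>x. (x, f x) \<in> dart_steps M" for f x
  proof -
    have "(y, z) \<in> (dart_steps M)\<^sup>*" if "z \<in> orbit f y" for y z
      using that by induction (use f(2) in \<open>blast intro: rtrancl.rtrancl_into_rtrancl\<close>)+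
    moreover have "x \<in> orbit f (f x)"
      using permutation_orbit_step[OF f(1)] permutation_self_in_orbit[OF f(1)] by blast
    ultimately show ?thesis by blast
  qed
  have single: "(y, x) \<in> (dart_steps M)\<^sup>*" if "(x, y) \<in> dart_steps M" for x y
    using that inverse_step[of "rot M"] inverse_step[of "opp M"] assms unfolding dart_steps_def by auto
  have "(y, x) \<in> (dart_steps M)\<^sup>*" if "(x, y) \<in> (dart_steps M)\<^sup>*" for x y
    using that
  proof induction
    case (step y z)
    show ?case using single[OF step.hyps(2)] step.IH by (rule rtrancl_trans)
  qed simp
  then show ?thesis by (intro symI)
qed

text \<open>Lines x and \<open>\<sigma> x\<close> meet at the vertex of \<sigma>, so the action of a
  factor can be imitated by a path in the map.\<close>

lemma word_rot_crosses:
  assumes "cycle_word n F" "\<sigma> \<in> set F" "\<sigma> x \<noteq> x"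
  shows "\<exists>i j. i < height F x \<and> j \<le> height F (\<sigma> x) \<and> word_rot F (x, i, False) = (\<sigma> x, j, True)"
  using assms
proof (induction F)
  case (Cons \<tau> F)
  show ?case
  proof (cases "\<tau> = \<sigma>")
    case True
    have \<sigma>: "nontrivial_cycle n \<sigma>" using Cons.prems True by simp
    then have "\<sigma> (\<sigma> x) \<noteq> \<sigma> x" using bij_moved_iff[of \<sigma> x] nontrivial_cycleD(2) Cons.prems(3) by blast
    then show ?thesis using word_rot_top(1)[OF \<sigma> Cons.prems(3), of F] True Cons.prems(3)
      by (intro exI[where x = "height F x"] exI[where x = "Suc (height F (\<sigma> x))"]) (simp add: height_Cons del: word_rot.simps)
  next
    case False
    then obtain i j where ij: "i < height F x" "j \<le> height F (\<sigma> x)" "word_rot F (x, i, False) = (\<sigma> x, j, True)"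
      using Cons by auto
    then have "(x, i, False) \<notin> top_vertex \<tau> F" by (auto simp: top_vertex_def)
    then have "word_rot (\<tau> # F) (x, i, False) = (\<sigma> x, j, True)" using word_rot_Cons_old ij(3) by simp
    then show ?thesis using ij
      by (intro exI[where x = i] exI[where x = j]) (auto simp: height_Cons simp del: word_rot.simps)
  qed
qed simp

lemma fst_word_rot:
  assumes "cycle_word n F"
  shows "fst (word_rot F d) = fst d \<or> (\<exists>\<sigma>\<in>set F. fst (word_rot F d) = \<sigma> (fst d))"
  using assms
proof (induction F)
  case (Cons \<sigma> F)
  show ?case
  proof (cases "d \<in> top_vertex \<sigma> F")
    case True
    then show ?thesis using word_rot_top[of n \<sigma> _ F] Cons.prems
      by (auto simp: top_vertex_def moved_def simp del: word_rot.simps)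
  next
    case False then show ?thesis using word_rot_Cons_old[OF False] Cons by auto
  qed
qed simp

text \<open>A step in the map stays on its line or applies a factor to it. Conversely each line is
  connected in itself and a factor joins x to \<open>\<sigma> x\<close>; inverses in the generated
  group are handled by the symmetry of reachability.\<close>

lemma transitive_iff_connected:
  assumes F: "cycle_word n F"
  shows "connected_map (word_map n cs F) \<longleftrightarrow> transitive n F"
proof
  let ?M = "word_map n cs F" and ?G = "generate (sym_group n) (set F)"
  have one: "id \<in> ?G" using generate.one[of "sym_group n" "set F"] by (simp add: sym_group_one)
  have mult: "g \<circ> h \<in> ?G" if "g \<in> ?G" "h \<in> ?G" for g h
    using generate.eng[OF that] by (simp add: sym_group_mult)
  assume con: "connected_map ?M"
  show "transitive n F" unfolding transitive_def
  proof (intro ballI)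
    fix x y assume x: "x \<in> {1..n}" "y \<in> {1..n}"
    have "\<exists>h\<in>?G. h x = fst d" if "((x, 0, True), d) \<in> (dart_steps ?M)\<^sup>*" for d
      using that
    proof (induction rule: rtrancl_induct)
      case base show ?case using one by (intro bexI[where x = id]) auto
    next
      case (step d e)
      then obtain h where h: "h \<in> ?G" "h x = fst d" by blast
      have "fst (word_opp n F d) = fst d" by (simp add: word_opp_def split: prod.split)
      then consider "fst e = fst d" | \<sigma> where "\<sigma> \<in> set F" "fst e = \<sigma> (fst d)"
        using step.hyps(2) fst_word_rot[OF F, of d] unfolding dart_steps_def by auto
      then show ?case
      proof cases
        case 1 then show ?thesis using h by (intro bexI[where x = h]) auto
      next
        case 2
        then show ?thesis using h mult[OF generate.incl[of \<sigma>] h(1)]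
          by (intro bexI[where x = "\<sigma> \<circ> h"]) auto
      qed
    qed
    moreover have "((x, 0, True), (y, 0, True)) \<in> (dart_steps ?M)\<^sup>*"
      using con x unfolding connected_map_alt by (auto simp: word_darts_def)
    ultimately show "\<exists>h\<in>?G. h x = y" by fastforce
  qed
next
  let ?M = "word_map n cs F" and ?G = "generate (sym_group n) (set F)"
  assume tr: "transitive n F"
  let ?R = "(dart_steps ?M)\<^sup>*"
  have sym: "sym ?R" using sym_dart_steps[of ?M] word_rot_permutation[OF F] word_opp_permutes[of n F]
      finite_word_darts permutation_permutes by auto
  have rot: "(d, word_rot F d) \<in> ?R" and opp: "(d, word_opp n F d) \<in> ?R" for d
    unfolding dart_steps_def by auto
  have down: "((x, i, True), (x, 0, True)) \<in> ?R" if "(x, i, True) \<in> word_darts n F" for x i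
    using that
  proof (induction i)
    case (Suc i)
    have r: "word_rot F (x, Suc i, True) = (x, i, False)" using word_rot_up[of "Suc i" F x] Suc.prems by (simp add: word_darts_def)
    have i: "(x, i, b) \<in> word_darts n F" for b using Suc.prems by (simp add: word_darts_def)
    have "((x, Suc i, True), (x, i, False)) \<in> ?R" using rot[of "(x, Suc i, True)"] r by simp
    moreover have "((x, i, False), (x, i, True)) \<in> ?R" using opp[of "(x, i, False)"] word_opp_apply[OF i] by simp
    ultimately show ?case using Suc.IH[OF i] by (meson rtrancl_trans)
  qed simp
  have base: "(d, (fst d, 0, True)) \<in> ?R" if d: "d \<in> word_darts n F" for d
  proof -
    obtain x i b where e: "d = (x, i, b)" by (cases d) auto
    have i: "(x, i, b) \<in> word_darts n F" for b using d e by (simp add: word_darts_def)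
    show ?thesis
    proof (cases b)
      case True then show ?thesis using down[OF i] e by simp
    next
      case False
      then have "(d, (x, i, True)) \<in> ?R" using opp[of d] e word_opp_apply[OF i] by simp
      then show ?thesis using down[OF i] e by (simp add: rtrancl_trans)
    qed
  qed
  have "\<forall>x\<in>{1..n}. h x \<in> {1..n} \<and> ((x, 0, True), (h x, 0, True)) \<in> ?R" if "h \<in> ?G" for h
    using that
  proof induction
    case one then show ?case by (simp add: sym_group_one)
  next
    have gen: "\<sigma> x \<in> {1..n} \<and> ((x, 0, True), (\<sigma> x, 0, True)) \<in> ?R" if \<sigma>: "\<sigma> \<in> set F" and x: "x \<in> {1..n}" for \<sigma> x
    proof (cases "\<sigma> x = x")
      case False
      have sx: "\<sigma> x \<in> {1..n}" using nontrivial_cycleD(1) F \<sigma> x permutes_in_image by metis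
      obtain i j where ij: "i < height F x" "j \<le> height F (\<sigma> x)" "word_rot F (x, i, False) = (\<sigma> x, j, True)"
        using word_rot_crosses[OF F \<sigma> False] by blast
      have "((x, i, False), (\<sigma> x, j, True)) \<in> ?R" using rot[of "(x, i, False)"] ij(3) by simp
      moreover have "((x, 0, True), (x, i, False)) \<in> ?R"
        using base[of "(x, i, False)"] ij(1) x sym by (auto simp: word_darts_def dest: symD)
      moreover have "((\<sigma> x, j, True), (\<sigma> x, 0, True)) \<in> ?R"
        using down[of "\<sigma> x" j] ij(2) sx by (simp add: word_darts_def)
      ultimately show ?thesis using sx by (meson rtrancl_trans)
    qed (use x in simp)
    {
      case (incl h) then show ?case using gen by blast
    next
      case (inv h)
      have perm: "h permutes {1..n}" using nontrivial_cycleD(1) F inv by blast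
      then have eq: "inv\<^bsub>sym_group n\<^esub> h = inv' h"
        using sym_group_inv_equality sym_group_carrier by blast
      show ?case unfolding eq
      proof
        fix x assume x: "x \<in> {1..n}"
        then have y: "inv' h x \<in> {1..n}" using permutes_in_image[OF permutes_inv[OF perm]] by metis
        have "((inv' h x, 0, True), (x, 0, True)) \<in> ?R"
          using gen[OF inv y] permutes_inverses(1)[OF perm] by simp
        then show "inv' h x \<in> {1..n} \<and> ((x, 0, True), (inv' h x, 0, True)) \<in> ?R"
          using y symD[OF sym] by blast
      qed
    next
      case (eng g h)
      show ?case
      proof
        fix x assume "x \<in> {1..n}"
        then have "h x \<in> {1..n}" "((x, 0, True), (h x, 0, True)) \<in> ?R" using eng.IH(2) by blast+
        moreover from this have "g (h x) \<in> {1..n}" "((h x, 0, True), (g (h x), 0, True)) \<in> ?R"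
          using eng.IH(1) by blast+
        ultimately show "(g \<otimes>\<^bsub>sym_group n\<^esub> h) x \<in> {1..n} \<and>
            ((x, 0, True), ((g \<otimes>\<^bsub>sym_group n\<^esub> h) x, 0, True)) \<in> ?R"
          by (metis comp_apply rtrancl_trans sym_group_mult)
      qed
    }
  qed
  then have src: "((x, 0, True), (y, 0, True)) \<in> ?R" if "x \<in> {1..n}" "y \<in> {1..n}" for x y
    using tr that unfolding transitive_def by metis
  show "connected_map ?M" unfolding connected_map_alt
  proof (intro ballI)
    fix d e assume d: "d \<in> darts ?M" "e \<in> darts ?M"
    then have "fst d \<in> {1..n}" "fst e \<in> {1..n}" by (auto simp: word_darts_def)
    then have "((fst d, 0, True), (fst e, 0, True)) \<in> ?R" by (rule src)
    moreover have "(d, (fst d, 0, True)) \<in> ?R" using base d by simp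
    moreover have "((fst e, 0, True), e) \<in> ?R" using base[of e] d symD[OF sym] by simp
    ultimately show "(d, e) \<in> ?R" by (meson rtrancl_trans)
  qed
qed

lemma is_map_word_map_iff:
  assumes F: "cycle_word n F" and n: "1 \<le> n"
  shows "is_map (word_map n cs F) \<longleftrightarrow> transitive n F"
proof -
  have "(1, 0, True) \<in> word_darts n F" using n by (simp add: word_darts_def)
  moreover have "word_opp n F d \<noteq> d" if "d \<in> word_darts n F" for d using up_word_opp[OF that] by auto
  ultimately show ?thesis
    unfolding is_map_def transitive_iff_connected[OF F]
    using finite_word_darts word_rot_permutes[OF F] word_opp_permutes by auto
qed

section \<open>Alternating orientations of rotation systems\<close>

text \<open>A choice of in and out made at each vertex separately: the two halves of an edge may
  clash. An orientation additionally satisfies \<open>up (opp M d) \<noteq> up d\<close>. Leaves are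
  exempt, being fixed by the rotation.\<close>

definition alternating :: "('d, 'z) rotation_system_scheme \<Rightarrow> ('d \<Rightarrow> bool) \<Rightarrow> bool" where
  "alternating M s \<longleftrightarrow> (\<forall>d\<in>darts M. rot M d \<noteq> d \<longrightarrow> s (rot M d) \<noteq> s d)"

lemma is_mapD:
  assumes "is_map M"
  shows "finite (darts M)" "darts M \<noteq> {}" "rot M permutes darts M" "opp M permutes darts M"
    "connected_map M" "permutation (rot M)" "permutation (opp M)"
    "d \<in> darts M \<Longrightarrow> opp M d \<noteq> d" "d \<in> darts M \<Longrightarrow> opp M (opp M d) = d"
    "d \<in> darts M \<Longrightarrow> opp M d \<in> darts M" "d \<in> darts M \<Longrightarrow> rot M d \<in> darts M"
  using assms by (auto simp: is_map_def permutation_permutes permutes_in_image)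

section \<open>Odd corners as seen by alternating labellings\<close>

lemma alternate_funpow:
  assumes "\<And>d. d \<in> orbit f a \<Longrightarrow> s (f d) \<noteq> s d" "a \<in> orbit f a"
  shows "s ((f ^^ k) a) \<longleftrightarrow> (s a \<longleftrightarrow> even k)"
proof (induction k)
  case (Suc k)
  have "(f ^^ k) a \<in> orbit f a" using funpow_in_orbit[OF assms(2)] .
  then show ?case using assms(1) Suc by auto
qed simp

text \<open>If b is k steps after a, the sector contains k - 1 half-edges, and an alternating s
  reveals the parity of k.\<close>

lemma odd_card_right_sector:
  assumes perm: "permutation (rot M)" and b: "b \<in> orbit (rot M) a" "a \<noteq> b"
    and s: "\<And>d. d \<in> orbit (rot M) a \<Longrightarrow> s (rot M d) \<noteq> s d"
  shows "odd (card (right_sector M a b)) \<longleftrightarrow> (s a \<longleftrightarrow> s b)"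
proof -
  let ?f = "rot M"
  define k where "k = funpow_dist ?f a b"
  have fk: "(?f ^^ k) a = b" unfolding k_def using b(1) by (rule funpow_dist_prop)
  then have k0: "0 < k" using b(2) by (cases k) auto
  have inj: "inj_on (\<lambda>j. (?f ^^ j) a) {0..k}" unfolding k_def using b(1) by (rule inj_on_funpow_dist)
  have ne: "(?f ^^ j) a \<notin> {a, b}" if "1 \<le> j" "j < k" for j
  proof -
    have "(?f ^^ j) a \<noteq> (?f ^^ 0) a" using that inj_onD[OF inj, of j 0] by auto
    moreover have "(?f ^^ j) a \<noteq> (?f ^^ k) a" using that inj_onD[OF inj, of j k] by auto
    ultimately show ?thesis using fk by auto
  qed
  have "right_sector M a b = (\<lambda>j. (?f ^^ j) a) ` {1..<k}"
  proof (intro equalityI subsetI)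
    fix d assume "d \<in> right_sector M a b"
    then obtain j where j: "d = (?f ^^ j) a" "1 \<le> j" "\<forall>i\<in>{1..j}. (?f ^^ i) a \<notin> {a, b}"
      unfolding right_sector_def by blast
    have "j < k"
    proof (rule ccontr)
      assume "\<not> j < k"
      then have "k \<in> {1..j}" using k0 by auto
      then show False using j(3) fk by blast
    qed
    then show "d \<in> (\<lambda>j. (?f ^^ j) a) ` {1..<k}" using j by auto
  next
    fix d assume "d \<in> (\<lambda>j. (?f ^^ j) a) ` {1..<k}"
    then obtain j where "d = (?f ^^ j) a" "1 \<le> j" "j < k" by auto
    then show "d \<in> right_sector M a b"
      unfolding right_sector_def using ne by (intro CollectI exI[where x = j]) auto
  qed
  moreover have "inj_on (\<lambda>j. (?f ^^ j) a) {1..<k}" using inj by (rule inj_on_subset) auto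
  ultimately have "card (right_sector M a b) = k - 1" by (simp add: card_image)
  moreover have "s b \<longleftrightarrow> (s a \<longleftrightarrow> even k)"
    using alternate_funpow[of ?f a s k] s permutation_self_in_orbit[OF perm] fk by simp
  ultimately show ?thesis using k0 by auto
qed

lemma alternating_on_orbit:
  assumes M: "is_map M" and s: "alternating M s" and a: "a \<in> darts M" "rot M a \<noteq> a"
    and d: "d \<in> orbit (rot M) a"
  shows "s (rot M d) \<noteq> s d" "rot M d \<noteq> d"
proof -
  have "d \<in> darts M" using permutes_orbit_subset[OF is_mapD(3)[OF M] a(1)] d by blast
  moreover show "rot M d \<noteq> d"
  proof
    assume "rot M d = d"
    then have "orbit (rot M) d = {d}" by (simp add: orbit_eq_singleton_iff)
    moreover have "a \<in> orbit (rot M) d"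
      using orbit_eq_orbit[OF is_mapD(6)[OF M] d] permutation_self_in_orbit[OF is_mapD(6)[OF M]] by metis
    ultimately show False using a(2) \<open>rot M d = d\<close> by simp
  qed
  ultimately show "s (rot M d) \<noteq> s d" using s unfolding alternating_def by blast
qed

lemma cycle_in_odd_corner:
  assumes M: "is_map M" and s: "alternating M s" and W: "cycle_in M W" and i: "i < length W"
  shows "odd_corner M (W ! i) (W ! ((i + 1) mod length W))
    \<longleftrightarrow> (s (opp M (W ! i)) \<longleftrightarrow> s (W ! ((i + 1) mod length W)))"
proof -
  let ?j = "(i + 1) mod length W"
  let ?a = "opp M (W ! i)" and ?b = "W ! ?j"
  have j: "?j < length W" using i by (intro mod_less_divisor) auto
  have Wi: "W ! i \<in> darts M" "?b \<in> darts M"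
    using W i j nth_mem unfolding cycle_in_def by blast+
  have perm: "permutation (rot M)" using is_mapD(6)[OF M] .
  have "orbit (rot M) ?a = orbit (rot M) ?b"
    using W i unfolding cycle_in_def vertex_at_def by blast
  then have b: "?b \<in> orbit (rot M) ?a" using permutation_self_in_orbit[OF perm] by simp
  have ab: "?a \<noteq> ?b"
  proof
    assume eq: "?a = ?b"
    then have "edge_of M ?b = edge_of M (W ! i)"
      using is_mapD(9)[OF M Wi(1)] unfolding edge_of_def by auto
    then have "map (edge_of M) W ! ?j = map (edge_of M) W ! i" using i j by simp
    \<comment> \<open>Distinct edges leave only a loop traversed on its own, and its two halves are
      different.\<close>
    then have "?j = i" using W i j nth_eq_iff_index_eq[of "map (edge_of M) W" ?j i]
      unfolding cycle_in_def by auto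
    then show False using eq is_mapD(8)[OF M Wi(1)] by simp
  qed
  have "rot M ?a \<noteq> ?a"
  proof
    assume "rot M ?a = ?a"
    then have "orbit (rot M) ?a = {?a}" by (simp add: orbit_eq_singleton_iff)
    then show False using b ab by simp
  qed
  then have "s (rot M d) \<noteq> s d" if "d \<in> orbit (rot M) ?a" for d
    using alternating_on_orbit(1)[OF M s is_mapD(10)[OF M Wi(1)]] that by blast
  then show ?thesis
    unfolding odd_corner_def using odd_card_right_sector[OF perm b ab, of s] by blast
qed

text \<open>The sign -1 marks an edge on which the choices at its ends clash, both halves counting
  as outgoing or both as incoming.\<close>

definition twist :: "('d, 'z) rotation_system_scheme \<Rightarrow> ('d \<Rightarrow> bool) \<Rightarrow> 'd \<Rightarrow> int" where
  "twist M s d = (if s d = s (opp M d) then -1 else 1)"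

definition twists :: "('d, 'z) rotation_system_scheme \<Rightarrow> ('d \<Rightarrow> bool) \<Rightarrow> 'd list \<Rightarrow> int" where
  "twists M s W = prod_list (map (twist M s) W)"

lemma twists_simps [simp]:
  "twists M s [] = 1" "twists M s (d # W) = twist M s d * twists M s W"
  "twists M s (W @ W') = twists M s W * twists M s W'"
  by (simp_all add: twists_def)

lemma twists_unit: "twists M s W = 1 \<or> twists M s W = -1"
  by (induction W) (auto simp: twist_def)

lemma neg_one_power_card:
  "finite A \<Longrightarrow> (-1 :: int) ^ card {i \<in> A. P i} = (\<Prod>i\<in>A. if P i then -1 else 1)"
  by (subst prod.inter_filter[symmetric]) simp_all

text \<open>Around a cycle the signs of the corners regroup into signs of the edges.\<close>

lemma odd_corners_parity:
  assumes M: "is_map M" and s: "alternating M s" and W: "cycle_in M W"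
  shows "(-1) ^ odd_corners M W = twists M s W"
proof -
  let ?k = "length W" and ?\<epsilon> = "\<lambda>b. if b then 1 else - 1 :: int"
  let ?n = "\<lambda>i. (i + 1) mod ?k"
  have k: "0 < ?k" using W unfolding cycle_in_def by simp
  \<comment> \<open>Each corner joins the end of one edge to the start of the next; reindexing by
    this cyclic shift moves both signs to the same edge.\<close>
  have "bij_betw ?n {..<?k} {..<?k}"
  proof -
    have "inj_on ?n {..<?k}"
    proof (rule inj_onI)
      fix i j assume ij: "i \<in> {..<?k}" "j \<in> {..<?k}" and eq: "?n i = ?n j"
      have "?n i = (if Suc i = ?k then 0 else Suc i)" "?n j = (if Suc j = ?k then 0 else Suc j)"
        using ij by auto
      then show "i = j" using eq by (auto split: if_splits)
    qed
    moreover have "?n ` {..<?k} \<subseteq> {..<?k}" using k by auto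
    ultimately show ?thesis unfolding bij_betw_def using endo_inj_surj[of "{..<?k}" ?n] by simp
  qed
  then have shift: "(\<Prod>i<?k. ?\<epsilon> (s (W ! ?n i))) = (\<Prod>i<?k. ?\<epsilon> (s (W ! i)))"
    by (rule prod.reindex_bij_betw)
  have oc: "odd_corners M W = card {i \<in> {..<?k}. s (opp M (W ! i)) = s (W ! ?n i)}"
    unfolding odd_corners_def using cycle_in_odd_corner[OF M s W]
    by (intro arg_cong[where f = card]) auto
  have "(-1) ^ odd_corners M W = (\<Prod>i<?k. if s (opp M (W ! i)) = s (W ! ?n i) then -1 else 1 :: int)"
    unfolding oc by (rule neg_one_power_card) simp
  \<comment> \<open>The sign of a corner factors over its two half-edges, with an extra minus
    because agreement counts as odd.\<close>
  also have "\<dots> = (\<Prod>i<?k. - ?\<epsilon> (s (opp M (W ! i))) * ?\<epsilon> (s (W ! ?n i)))"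
    by (rule prod.cong) auto
  also have "\<dots> = (\<Prod>i<?k. - ?\<epsilon> (s (opp M (W ! i)))) * (\<Prod>i<?k. ?\<epsilon> (s (W ! i)))"
    unfolding prod.distrib shift ..
  also have "\<dots> = (\<Prod>i<?k. twist M s (W ! i))"
    unfolding prod.distrib[symmetric] by (rule prod.cong) (auto simp: twist_def)
  also have "\<dots> = twists M s W"
    unfolding twists_def prod.list_conv_set_nth by (simp add: atLeast0LessThan)
  finally show ?thesis .
qed

text \<open>An orientation has no clashing edges, so the product of signs is 1 and the number of odd
  corners is even. With no odd corner the cycle would be directed and the rank monotone all the way
  around.\<close>

lemma oriented_cycle_corners:
  assumes M: "is_map M" and up: "alternating M up" "\<And>d. d \<in> darts M \<Longrightarrow> up (opp M d) \<noteq> up d"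
    and rk: "\<And>d. d \<in> darts M \<Longrightarrow> rk (rot M d) = (rk d :: nat)"
      "\<And>d. d \<in> darts M \<Longrightarrow> up d \<Longrightarrow> rk d < rk (opp M d)"
    and W: "cycle_in M W"
  shows "0 < odd_corners M W \<and> even (odd_corners M W)"
proof
  have sub: "set W \<subseteq> darts M" using W unfolding cycle_in_def by blast
  then have "twists M up W = 1"
    using up(2) by (induction W) (auto simp: twist_def)
  then show "even (odd_corners M W)"
    using odd_corners_parity[OF M up(1) W] by (cases "even (odd_corners M W)") auto
  show "0 < odd_corners M W"
  proof (rule ccontr)
    let ?k = "length W" and ?n = "\<lambda>i. (i + 1) mod length W"
    assume "\<not> 0 < odd_corners M W"
    then have none: "{i. i < ?k \<and> odd_corner M (W ! i) (W ! ?n i)} = {}"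
      unfolding odd_corners_def by simp
    have k: "0 < ?k" using W unfolding cycle_in_def by simp
    have D: "W ! i \<in> darts M" if "i < ?k" for i using sub that by auto
    have dir: "up (W ! ?n i) = up (W ! i)" if i: "i < ?k" for i
    proof -
      have "\<not> odd_corner M (W ! i) (W ! ?n i)" using none i by blast
      then show ?thesis using cycle_in_odd_corner[OF M up(1) W i] up(2)[OF D[OF i]] by blast
    qed
    have dir0: "up (W ! i) = up (W ! 0)" if "i < ?k" for i
      using that
    proof (induction i)
      case (Suc i) then show ?case using dir[of i] by simp
    qed simp
    have orbit_rk: "rk e = rk d" if "e \<in> orbit (rot M) d" "d \<in> darts M" for d e
    proof -
      have "rk e = rk d \<and> e \<in> darts M" using that
        by (induction rule: orbit.induct) (use rk(1) is_mapD(11)[OF M] in auto)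
      then show ?thesis by simp
    qed
    have nxt: "rk (W ! ?n i) = rk (opp M (W ! i))" if i: "i < ?k" for i
    proof -
      have "vertex_at M (opp M (W ! i)) = vertex_at M (W ! ?n i)"
        using W i unfolding cycle_in_def by blast
      then have "W ! ?n i \<in> orbit (rot M) (opp M (W ! i))"
        using permutation_self_in_orbit[OF is_mapD(6)[OF M]] unfolding vertex_at_def by metis
      then show ?thesis using orbit_rk is_mapD(10)[OF M D[OF i]] by blast
    qed
    have mono: "rk (W ! i) < rk (W ! ?n i)" if "i < ?k" "up (W ! 0)" for i
      using nxt[OF that(1)] rk(2)[OF D[OF that(1)]] dir0[OF that(1)] that(2) by simp
    have mono': "rk (W ! ?n i) < rk (W ! i)" if i: "i < ?k" and u: "\<not> up (W ! 0)" for i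
    proof -
      have "up (opp M (W ! i))" using up(2)[OF D[OF i]] dir0[OF i] u by blast
      then show ?thesis
        using nxt[OF i] rk(2)[OF is_mapD(10)[OF M D[OF i]]] is_mapD(9)[OF M D[OF i]] by simp
    qed
    \<comment> \<open>A vertex of largest rank refutes a cycle running upwards, one of smallest rank
      a cycle running downwards.\<close>
    let ?A = "(\<lambda>i. rk (W ! i)) ` {..<?k}"
    have A: "finite ?A" "?A \<noteq> {}" using k by auto
    obtain p where p: "p < ?k" "Max ?A = rk (W ! p)" using Max_in[OF A] by auto
    have pmax: "rk (W ! i) \<le> rk (W ! p)" if "i < ?k" for i
      unfolding p(2)[symmetric] using A(1) that by (intro Max_ge) auto
    obtain q where q: "q < ?k" "Min ?A = rk (W ! q)" using Min_in[OF A] by auto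
    have qmin: "rk (W ! q) \<le> rk (W ! i)" if "i < ?k" for i
      unfolding q(2)[symmetric] using A(1) that by (intro Min_le) auto
    have "?n p < ?k" "?n q < ?k" using k by simp_all
    then show False using mono[OF p(1)] pmax[of "?n p"] mono'[OF q(1)] qmin[of "?n q"] by linarith
  qed
qed

text \<open>At every vertex alternate by the distance from a base half-edge; even degree makes this
  consistent after a full turn.\<close>

lemma alternating_exists:
  assumes M: "is_map M" and deg: "\<And>v. v \<in> vertices M \<Longrightarrow> v \<in> leaves M \<or> even (degree v)"
  shows "\<exists>s. alternating M s"
proof -
  let ?f = "rot M"
  have perm: "permutation ?f" using is_mapD(6)[OF M] .
  define b where "b d = (SOME e. e \<in> orbit ?f d)" for d
  have b: "b d \<in> orbit ?f d" for d
    unfolding b_def using permutation_self_in_orbit[OF perm] by (rule someI)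
  define s where "s d = even (funpow_dist ?f (b d) d)" for d
  have "s (?f d) \<noteq> s d" if d: "d \<in> darts M" "?f d \<noteq> d" for d
  proof -
    have orb: "orbit ?f (?f d) = orbit ?f d" using permutation_orbit_step[OF perm] .
    \<comment> \<open>The choice depends on the orbit only, so all half-edges of a vertex share
      their base.\<close>
    then have eq: "b (?f d) = b d" unfolding b_def by simp
    have orb_b: "orbit ?f (b d) = orbit ?f d" using orbit_eq_orbit[OF perm b] .
    let ?k = "funpow_dist ?f (b d) d" and ?l = "funpow_dist ?f (b d) (?f d)"
    have "d \<in> orbit ?f (b d)" "?f d \<in> orbit ?f (b d)"
      using orb_b permutation_self_in_orbit[OF perm] orbit.base by metis+
    then have "(?f ^^ ?k) (b d) = d" "(?f ^^ ?l) (b d) = ?f d" by (simp_all add: funpow_dist_prop)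
    then have "(?f ^^ Suc ?k) (b d) = (?f ^^ ?l) (b d)" by simp
    then have mod: "Suc ?k mod card (orbit ?f d) = ?l mod card (orbit ?f d)"
      using funpow_eq_iff[OF perm] orb_b by metis
    have v: "orbit ?f d \<in> vertices M" using d unfolding vertices_def vertex_at_def by blast
    have "card (orbit ?f d) \<noteq> 1"
    proof
      assume "card (orbit ?f d) = 1"
      then have "orbit ?f d = {d}"
        using permutation_self_in_orbit[OF perm, of d] by (metis card_1_singletonE singletonD)
      then show False using d(2) orbit_eq_singleton_iff by metis
    qed
    then have "even (card (orbit ?f d))"
      using deg[OF v] unfolding leaves_def degree_def by auto
    then have "even (Suc ?k) = even ?l" using mod by (metis dvd_mod_iff)
    then show ?thesis unfolding s_def eq by auto
  qed
  then show ?thesis unfolding alternating_def by blast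
qed

subsection \<open>Closed walks\<close>

primrec walk :: "('d, 'z) rotation_system_scheme \<Rightarrow> 'd set \<Rightarrow> 'd list \<Rightarrow> 'd set \<Rightarrow> bool" where
  "walk M u [] v \<longleftrightarrow> u = v"
| "walk M u (d # W) v \<longleftrightarrow>
     d \<in> darts M \<and> vertex_at M d = u \<and> walk M (vertex_at M (opp M d)) W v"

lemma walk_append: "walk M u (W @ W') v \<longleftrightarrow> (\<exists>w. walk M u W w \<and> walk M w W' v)"
  by (induction W arbitrary: u) auto

lemma walk_rev:
  assumes "is_map M" "walk M u W v"
  shows "walk M v (rev (map (opp M) W)) u"
  using assms(2)
proof (induction W arbitrary: u)
  case (Cons d W)
  then have d: "d \<in> darts M" by simp
  show ?case using Cons is_mapD(9,10)[OF assms(1) d] by (auto simp: walk_append)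
qed simp

lemma walk_darts: "walk M u W v \<Longrightarrow> set W \<subseteq> darts M"
  by (induction W arbitrary: u) auto

lemma walk_hd: "walk M u W v \<Longrightarrow> W \<noteq> [] \<Longrightarrow> vertex_at M (W ! 0) = u"
  by (cases W) auto

lemma walk_nth:
  "walk M u W v \<Longrightarrow> i < length W \<Longrightarrow>
    vertex_at M (opp M (W ! i)) = (if Suc i < length W then vertex_at M (W ! Suc i) else v)"
proof (induction W arbitrary: u i)
  case (Cons d W)
  then show ?case
  proof (cases i)
    case 0
    then show ?thesis using Cons.prems walk_hd[of M _ W v] by (cases W) auto
  next
    case (Suc j) then show ?thesis using Cons by auto
  qed
qed simp

text \<open>A shortest closed walk with the property \<open>P\<close> visits no vertex twice.\<close>

lemma closed_walk_contains_cycle: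
  assumes M: "is_map M"
    and split: "\<And>xs ys zs. P (xs @ ys @ zs) \<Longrightarrow> P ys \<or> P (xs @ zs)"
    and nonempty: "\<not> P []" and spur: "\<And>d. d \<in> darts M \<Longrightarrow> \<not> P [d, opp M d]"
    and W0: "walk M u0 W0 u0" "P W0"
  shows "\<exists>W. cycle_in M W \<and> P W"
proof -
  let ?vx = "vertex_at M"
  let ?Q = "\<lambda>W. P W \<and> (\<exists>u. walk M u W u)"
  obtain W where W: "?Q W" and least: "\<And>W'. ?Q W' \<Longrightarrow> length W \<le> length W'"
    using ex_has_least_nat[of ?Q W0 length] W0 by blast
  then obtain u where PW: "P W" and u: "walk M u W u" by blast
  have ne: "W \<noteq> []" using PW nonempty by blast
  have dv: "distinct (map ?vx W)"
  proof (rule ccontr)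
    assume "\<not> distinct (map ?vx W)"
    then obtain A B C v where "map ?vx W = A @ [v] @ B @ [v] @ C"
      using not_distinct_decomp by blast
    then obtain as d bs e cs where dec: "W = as @ (d # bs) @ (e # cs)" "?vx d = v" "?vx e = v"
      by (auto simp: map_eq_append_conv map_eq_Cons_conv append_eq_map_conv Cons_eq_map_conv)
    obtain w w' where w: "walk M u as w" "walk M w (d # bs) w'" "walk M w' (e # cs) u"
      using u unfolding dec(1) walk_append by blast
    then have "w = v" "w' = v" using dec by auto
    then have "walk M v (d # bs) v" "walk M u (as @ (e # cs)) u"
      using w unfolding walk_append by blast+
    \<comment> \<open>Cutting at a repeated vertex gives two shorter closed walks, one of which
      keeps P.\<close>
    moreover have "P (d # bs) \<or> P (as @ (e # cs))" using split PW unfolding dec(1) by blast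
    ultimately have "length W \<le> length (d # bs) \<or> length W \<le> length (as @ (e # cs))"
      using least by blast
    then show False unfolding dec(1) by simp
  qed
  have step: "?vx (opp M (W ! i)) = ?vx (W ! ((i + 1) mod length W))" if "i < length W" for i
  proof (cases "Suc i < length W")
    case True then show ?thesis using walk_nth[OF u that] by simp
  next
    case False
    then have "Suc i = length W" using that by simp
    then show ?thesis using walk_nth[OF u that] walk_hd[OF u ne] by simp
  qed
  have D: "W ! i \<in> darts M" if "i < length W" for i using walk_darts[OF u] that by auto
  have inj: "i = j" if "?vx (W ! i) = ?vx (W ! j)" "i < length W" "j < length W" for i j
    using nth_eq_iff_index_eq[OF dv, of i j] that by simp
  \<comment> \<open>The starting vertices being distinct, a repeated edge is traversed in opposite
    directions, and each traversal must immediately follow the other. The walk is then a single edge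
    there and back, which \<open>spur\<close> excludes.\<close>
  have de: "edge_of M (W ! i) \<noteq> edge_of M (W ! j)" if ij: "i < j" "j < length W" for i j
  proof
    assume eq: "edge_of M (W ! i) = edge_of M (W ! j)"
    have i: "i < length W" using ij by simp
    have "W ! j \<noteq> W ! i" using inj[of j i] ij by auto
    then have opp: "W ! j = opp M (W ! i)" "W ! i = opp M (W ! j)"
      using eq is_mapD(9)[OF M D[OF ij(2)]] unfolding edge_of_def by (auto simp: doubleton_eq_iff)
    have "(i + 1) mod length W = Suc i" using ij by simp
    then have "?vx (W ! j) = ?vx (W ! Suc i)" using step[OF i] opp(1) by simp
    then have j: "j = Suc i" using inj[of j "Suc i"] ij by simp
    have "?vx (W ! i) = ?vx (W ! ((j + 1) mod length W))" using step[OF ij(2)] opp(2) by simp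
    moreover have "(j + 1) mod length W < length W" using i by (intro mod_less_divisor) auto
    ultimately have i_mod: "i = (j + 1) mod length W" using inj i by blast
    have "j + 1 = length W"
    proof (rule ccontr)
      assume "j + 1 \<noteq> length W"
      then have "(j + 1) mod length W = j + 1" using ij(2) by (intro mod_less) simp
      then show False using i_mod j by linarith
    qed
    moreover from this have "i = 0" using i_mod by (metis mod_self)
    ultimately have "i = 0" "length W = 2" using j by simp_all
    then have "W = [W ! 0, opp M (W ! 0)]"
      using opp(1) j by (intro nth_equalityI) (auto simp: less_2_cases_iff)
    then show False using spur[OF D[of 0]] PW i \<open>i = 0\<close> by metis
  qed
  have "distinct (map (edge_of M) W)"
    unfolding distinct_conv_nth
  proof (intro allI impI)
    fix i j assume "i < length (map (edge_of M) W)" "j < length (map (edge_of M) W)" "i \<noteq> j"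
    then show "map (edge_of M) W ! i \<noteq> map (edge_of M) W ! j"
      using de[of i j] de[of j i] by (cases "i < j") auto
  qed
  then have "cycle_in M W" unfolding cycle_in_def using ne walk_darts[OF u] step dv by blast
  then show ?thesis using PW by blast
qed

lemma walk_exists:
  assumes M: "is_map M" and d: "d \<in> darts M" "e \<in> darts M"
  shows "\<exists>W. walk M (vertex_at M d) W (vertex_at M e)"
proof -
  have "(d, e) \<in> {(x, y). y = rot M x \<or> y = opp M x}\<^sup>*"
    using is_mapD(5)[OF M] d unfolding connected_map_def by blast
  then have "e \<in> darts M \<and> (\<exists>W. walk M (vertex_at M d) W (vertex_at M e))"
  proof (induction rule: rtrancl_induct)
    case base show ?case using d by (auto intro: exI[where x = "[]"])
  next
    case (step x y)
    then obtain W where W: "walk M (vertex_at M d) W (vertex_at M x)" and x: "x \<in> darts M" by blast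
    show ?case
    proof (cases "y = rot M x")
      case True
      then have "vertex_at M y = vertex_at M x"
        unfolding vertex_at_def using permutation_orbit_step[OF is_mapD(6)[OF M]] by simp
      then show ?thesis using W True is_mapD(11)[OF M x] by auto
    next
      case False
      then have "y = opp M x" using step.hyps by simp
      moreover from this have "walk M (vertex_at M d) (W @ [x]) (vertex_at M y)"
        using W x by (auto simp: walk_append)
      ultimately show ?thesis using is_mapD(10)[OF M x] by blast
    qed
  qed
  then show ?thesis by blast
qed

text \<open>The twists form a sign cocycle. It is trivial on cycles by parity, hence on all closed
  walks, hence the coboundary of a sign T on vertices; reversing the local choices according to T
  removes every clash.\<close>

lemma orientation_exists:
  assumes M: "is_map M" and s: "alternating M s"
    and even: "\<And>W. cycle_in M W \<Longrightarrow> even (odd_corners M W)"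
  shows "\<exists>up. alternating M up \<and> (\<forall>d\<in>darts M. up (opp M d) \<noteq> up d)"
proof -
  let ?t = "twists M s" and ?vx = "vertex_at M"
  have closed: "?t W = 1" if "walk M u W u" for u W
  proof (rule ccontr)
    assume "?t W \<noteq> 1"
    then have "?t W = -1" using twists_unit by metis
    moreover have "?t ys = -1 \<or> ?t (xs @ zs) = -1" if "?t (xs @ ys @ zs) = -1" for xs ys zs
      using that twists_unit[of M s ys] by auto
    moreover have "?t [d, opp M d] \<noteq> -1" if "d \<in> darts M" for d
      using is_mapD(9)[OF M that] by (auto simp: twist_def)
    ultimately obtain W' where "cycle_in M W'" "?t W' = -1"
      using closed_walk_contains_cycle[OF M, of "\<lambda>W. ?t W = -1" u W] \<open>walk M u W u\<close> by auto
    then show False using odd_corners_parity[OF M s] even by fastforce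
  qed
  obtain d0 where d0: "d0 \<in> darts M" using is_mapD(2)[OF M] by blast
  define T where "T v = ?t (SOME W. walk M (?vx d0) W v)" for v
  have T: "\<exists>W. walk M (?vx d0) W (?vx d) \<and> T (?vx d) = ?t W" if "d \<in> darts M" for d
    unfolding T_def using someI_ex[OF walk_exists[OF M d0 that]] by blast
  have rev: "?t (rev (map (opp M) W)) = ?t W" if "set W \<subseteq> darts M" for W
    using that is_mapD(9)[OF M] by (induction W) (auto simp: twist_def)
  have step: "T (?vx (opp M d)) = T (?vx d) * twist M s d" if d: "d \<in> darts M" for d
  proof -
    obtain W where W: "walk M (?vx d0) W (?vx d)" "T (?vx d) = ?t W" using T[OF d] by blast
    obtain V where V: "walk M (?vx d0) V (?vx (opp M d))" "T (?vx (opp M d)) = ?t V"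
      using T[OF is_mapD(10)[OF M d]] by blast
    \<comment> \<open>A chosen path to the start of d, the edge d, and the reverse of the chosen
      path to its end close up. This makes T multiplicative along edges although the chosen paths
      are unrelated.\<close>
    have "walk M (?vx d0) (W @ [d] @ rev (map (opp M) V)) (?vx d0)"
      using W(1) d walk_rev[OF M V(1)] by (auto simp: walk_append)
    then have "?t W * twist M s d * ?t V = 1"
      using closed rev[OF walk_darts[OF V(1)]] by (fastforce simp: mult.assoc)
    then show ?thesis using W(2) V(2) twists_unit[of M s V] by auto
  qed
  \<comment> \<open>The local choice is kept where T is 1 and reversed where it is -1.\<close>
  define up where "up d \<longleftrightarrow> (s d \<longleftrightarrow> T (?vx d) = 1)" for d
  have "alternating M up"
    using s permutation_orbit_step[OF is_mapD(6)[OF M]]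
    unfolding alternating_def up_def vertex_at_def by auto
  moreover have "up (opp M d) \<noteq> up d" if d: "d \<in> darts M" for d
  proof -
    have "T (?vx d) = 1 \<or> T (?vx d) = -1" unfolding T_def by (rule twists_unit)
    then show ?thesis using step[OF d] unfolding up_def twist_def by (auto split: if_splits)
  qed
  ultimately show ?thesis by blast
qed

text \<open>A directed closed walk would contain a directed cycle, and such a cycle has no odd
  corner at all.\<close>

lemma rank_exists:
  assumes M: "is_map M" and up: "alternating M up" "\<And>d. d \<in> darts M \<Longrightarrow> up (opp M d) \<noteq> up d"
    and pos: "\<And>W. cycle_in M W \<Longrightarrow> 0 < odd_corners M W"
  shows "\<exists>rk. \<forall>d\<in>darts M. rk (rot M d) = (rk d :: nat) \<and> (up d \<longrightarrow> rk d < rk (opp M d))"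
proof -
  let ?vx = "vertex_at M"
  define R where "R = {(?vx d, ?vx (opp M d)) | d. d \<in> darts M \<and> up d}"
  have "R = (\<lambda>d. (?vx d, ?vx (opp M d))) ` {d \<in> darts M. up d}" unfolding R_def by auto
  then have "finite R" using is_mapD(1)[OF M] by simp
  then have fin: "finite (R\<^sup>+)" by simp
  have walk: "\<exists>W. walk M u W v \<and> W \<noteq> [] \<and> (\<forall>d\<in>set W. up d)" if "(u, v) \<in> R\<^sup>+" for u v
    using that
  proof induction
    case (base v)
    then obtain d where "d \<in> darts M" "up d" "u = ?vx d" "v = ?vx (opp M d)" unfolding R_def by blast
    then show ?case by (intro exI[where x = "[d]"]) simp
  next
    case (step v w)
    then obtain W where W: "walk M u W v" "\<forall>d\<in>set W. up d" by blast
    obtain d where "d \<in> darts M" "up d" "v = ?vx d" "w = ?vx (opp M d)"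
      using step.hyps(2) unfolding R_def by blast
    then show ?case using W by (intro exI[where x = "W @ [d]"]) (auto simp: walk_append)
  qed
  have acyclic: "(v, v) \<notin> R\<^sup>+" for v
  proof
    \<comment> \<open>Pieces of a directed walk are directed, while going back along an edge never
      is. Nonemptiness keeps the empty walk from qualifying.\<close>
    let ?P = "\<lambda>W. W \<noteq> [] \<and> (\<forall>d\<in>set W. up d)"
    assume "(v, v) \<in> R\<^sup>+"
    then obtain W where "walk M v W v" "?P W" using walk by blast
    moreover have "?P ys \<or> ?P (xs @ zs)" if "?P (xs @ ys @ zs)" for xs ys zs using that by auto
    moreover have "\<not> ?P [d, opp M d]" if "d \<in> darts M" for d using up(2)[OF that] by auto
    ultimately obtain W' where W': "cycle_in M W'" "?P W'"
      using closed_walk_contains_cycle[OF M, of ?P v W] by blast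
    have "\<not> odd_corner M (W' ! i) (W' ! ((i + 1) mod length W'))" if i: "i < length W'" for i
    proof -
      have "W' ! i \<in> darts M" using W'(1) i unfolding cycle_in_def by auto
      then have "\<not> up (opp M (W' ! i))" using up(2) W'(2) i by auto
      moreover have "up (W' ! ((i + 1) mod length W'))"
        using W'(2) i by (metis mod_less_divisor nth_mem length_greater_0_conv)
      ultimately show ?thesis using cycle_in_odd_corner[OF M up(1) W'(1) i] by simp
    qed
    then have "odd_corners M W' = 0" unfolding odd_corners_def by (simp add: card_eq_0_iff)
    then show False using pos[OF W'(1)] by simp
  qed
  \<comment> \<open>The number of vertices from which there is a directed path to the vertex of d.
    By acyclicity it grows strictly along edges: the start of an edge precedes its end but not
    itself.\<close>
  define rk where "rk d = card {u. (u, ?vx d) \<in> R\<^sup>+}" for d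
  have "rk (rot M d) = rk d" for d
    unfolding rk_def vertex_at_def using permutation_orbit_step[OF is_mapD(6)[OF M]] by simp
  moreover have "rk d < rk (opp M d)" if d: "d \<in> darts M" "up d" for d
    unfolding rk_def
  proof (rule psubset_card_mono)
    have "{u. (u, ?vx (opp M d)) \<in> R\<^sup>+} \<subseteq> fst ` (R\<^sup>+)" by force
    then show "finite {u. (u, ?vx (opp M d)) \<in> R\<^sup>+}" using fin finite_subset by blast
    have "(?vx d, ?vx (opp M d)) \<in> R" using d unfolding R_def by blast
    then show "{u. (u, ?vx d) \<in> R\<^sup>+} \<subset> {u. (u, ?vx (opp M d)) \<in> R\<^sup>+}"
      using acyclic by (auto intro: trancl_into_trancl)
  qed
  ultimately show ?thesis by blast
qed

section \<open>Reading a list of cycles off an oriented map\<close>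

text \<open>A vertex of maximal rank sends all its outgoing edges to leaves. Removing these edges turns
  the incoming ones into edges that end at leaves, and adding the vertex back is one layer.\<close>

lemma oriented_map_of_word:
  fixes D :: "'d set" and r p :: "'d \<Rightarrow> 'd" and up :: "'d \<Rightarrow> bool" and rk :: "'d \<Rightarrow> nat"
  assumes "finite D" "r permutes D"
    and p: "\<And>d. d \<in> D \<Longrightarrow> p d \<in> D" "\<And>d. d \<in> D \<Longrightarrow> p (p d) = d" "\<And>d. d \<in> D \<Longrightarrow> up (p d) \<noteq> up d"
    and alt: "\<And>d. d \<in> D \<Longrightarrow> r d \<noteq> d \<Longrightarrow> up (r d) \<noteq> up d"
    and deg: "\<And>d. d \<in> D \<Longrightarrow> r d \<noteq> d \<Longrightarrow> r (r d) \<noteq> d"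
    and rk: "\<And>d. d \<in> D \<Longrightarrow> rk (r d) = rk d" "\<And>d. d \<in> D \<Longrightarrow> up d \<Longrightarrow> rk d < rk (p d)"
    and lab: "bij_betw lab {d \<in> D. up d \<and> r d = d} {1..n}"
  shows "\<exists>G h. cycle_word n G \<and> bij_betw h D (word_darts n G) \<and>
    (\<forall>d\<in>D. h (r d) = word_rot G (h d) \<and> h (p d) = word_opp n G (h d) \<and> (up_dart (h d) \<longleftrightarrow> up d)) \<and>
    (\<forall>d\<in>D. up d \<and> r d = d \<longrightarrow> h d = (lab d, 0, True))"
  using assms
proof (induction "card {d \<in> D. r d \<noteq> d}" arbitrary: D r rule: less_induct)
  case less
  note fin = less.prems(1) and perm = less.prems(2) and p = less.prems(3-5) and alt = less.prems(6)
    and deg = less.prems(7) and rk = less.prems(8,9) and lab = less.prems(10)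
  let ?m = "{d \<in> D. r d \<noteq> d}"
  show ?case
  proof (cases "?m = {}")
    case True
    then have fix_all: "r d = d" if "d \<in> D" for d using that by blast
    \<comment> \<open>Without inner vertices every edge is a complete line, named by its source.
      Such a disconnected map is reached because the induction does not keep the map
      connected.\<close>
    define h :: "'d \<Rightarrow> dart" where "h d = (if up d then (lab d, 0, True) else (lab (p d), 0, False))" for d
    have lab: "bij_betw lab {d \<in> D. up d} {1..n}"
    proof -
      have "{d \<in> D. up d \<and> r d = d} = {d \<in> D. up d}" using fix_all by blast
      then show ?thesis using lab by simp
    qed
    have lab_in: "lab d \<in> {1..n}" if "d \<in> D" "up d" for d
      using bij_betwE[OF lab] that by blast
    have lab_inj: "d = e" if "lab d = lab e" "d \<in> D" "up d" "e \<in> D" "up e" for d e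
      using inj_onD[OF bij_betw_imp_inj_on[OF lab] that(1)] that by blast
    have "inj_on h D"
    proof (rule inj_onI)
      fix d e assume d: "d \<in> D" "e \<in> D" and eq: "h d = h e"
      show "d = e"
      proof (cases "up d")
        case True then show ?thesis using eq d lab_inj[of d e] by (auto simp: h_def split: if_splits)
      next
        case False
        then have "\<not> up e" "lab (p d) = lab (p e)" using eq by (auto simp: h_def split: if_splits)
        moreover have "up (p d)" "up (p e)" using p(3) d False \<open>\<not> up e\<close> by blast+
        ultimately have "p d = p e" using lab_inj[of "p d" "p e"] p(1) d by simp
        then show ?thesis using p(2) d by metis
      qed
    qed
    moreover have "h ` D = word_darts n []"
    proof (intro equalityI subsetI)
      fix e assume "e \<in> h ` D"
      then show "e \<in> word_darts n []" using lab_in p by (auto simp: h_def word_darts_def split: if_splits)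
    next
      fix e assume "e \<in> word_darts n []"
      then obtain x b where e: "e = (x, 0, b)" "x \<in> {1..n}" by (cases e) (auto simp: word_darts_def)
      then have "x \<in> lab ` {d \<in> D. up d}" using bij_betw_imp_surj_on[OF lab] by simp
      then obtain d where d: "d \<in> D" "up d" "lab d = x" by auto
      show "e \<in> h ` D"
      proof (cases b)
        case True then show ?thesis using d e by (intro image_eqI[of _ _ d]) (auto simp: h_def)
      next
        case False
        then show ?thesis using d e p by (intro image_eqI[of _ _ "p d"]) (auto simp: h_def)
      qed
    qed
    ultimately have "bij_betw h D (word_darts n [])" unfolding bij_betw_def ..
    moreover have "h (p d) = word_opp n [] (h d)" if "d \<in> D" for d
      using that p[OF that] lab_in[of d] lab_in[of "p d"] by (auto simp: h_def word_opp_def)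
    ultimately show ?thesis using fix_all
      by (intro exI[where x = "[]"] exI[where x = h]) (auto simp: h_def)
  next
    case False
    have finm: "finite ?m" using fin by simp
    obtain a where a: "a \<in> D" "r a \<noteq> a" and amax: "\<And>d. d \<in> D \<Longrightarrow> r d \<noteq> d \<Longrightarrow> rk d \<le> rk a"
    proof -
      have "Max (rk ` ?m) \<in> rk ` ?m" using finm False by (intro Max_in) auto
      then obtain a where "a \<in> ?m" "Max (rk ` ?m) = rk a" by auto
      then show thesis using that[of a] finm Max_ge[of "rk ` ?m"] by auto
    qed
    have rperm: "permutation r" using fin perm permutation_permutes by blast
    have rinj: "inj r" using perm by (rule permutes_inj)
    have rD: "r d \<in> D \<longleftrightarrow> d \<in> D" for d using permutes_in_image[OF perm] .
    define v where "v = orbit r a"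
    have cyc: "cyclic_on r v" unfolding v_def using cyclic_on_orbit'[OF rperm] .
    have av: "a \<in> v" unfolding v_def using permutation_self_in_orbit[OF rperm] .
    have vD: "v \<subseteq> D" unfolding v_def using permutes_orbit_subset[OF perm a(1)] .
    have rv: "r d \<in> v \<longleftrightarrow> d \<in> v" for d
      using cyclic_on_f_in[OF perm cyc] cyclic_on_inI[OF cyc] by blast
    have vrk: "rk d = rk a" if "d \<in> v" for d
    proof -
      have "rk d = rk a \<and> d \<in> D" using that unfolding v_def
        by (induction rule: orbit.induct) (use rk(1) a(1) rD in auto)
      then show ?thesis ..
    qed
    have vmv: "r d \<noteq> d" if "d \<in> v" for d
    proof
      assume "r d = d"
      then have "orbit r d = {d}" by (simp add: orbit_eq_singleton_iff)
      then have "a = d" using orbit_cyclic_eq3[OF cyc that] av by simp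
      then show False using \<open>r d = d\<close> a(2) by simp
    qed
    define U V where "U = {d \<in> v. up d}" and "V = {d \<in> v. \<not> up d}"
    have UD: "U \<subseteq> D" "V \<subseteq> D" "U \<subseteq> v" "V \<subseteq> v" using vD by (auto simp: U_def V_def)
    have rU: "r d \<in> V" if "d \<in> U" for d
      using that rv alt[of d] vmv[of d] UD unfolding U_def V_def by auto
    have rV: "r d \<in> U" if "d \<in> V" for d
      using that rv alt[of d] vmv[of d] UD unfolding U_def V_def by auto
    have pU_fix: "r (p d) = p d" if "d \<in> U" for d
    proof (rule ccontr)
      assume "r (p d) \<noteq> p d"
      then have "rk (p d) \<le> rk a" using amax p(1) that UD by blast
      moreover have "rk d < rk (p d)" using rk(2) that UD unfolding U_def by blast
      ultimately show False using vrk[of d] that UD by auto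
    qed
    have pU_v: "p d \<notin> v" if "d \<in> U" for d using pU_fix[OF that] vmv by blast
    have pU_up: "\<not> up (p d)" if "d \<in> U" for d using p(3) that UD unfolding U_def by blast
    \<comment> \<open>Both halves of each outgoing edge disappear, while the incoming half-edges
      stay and become fixed points of \<open>r'\<close>, that is, upper leaves.\<close>
    define D' where "D' = D - U - p ` U"
    define r' where "r' d = (if d \<in> v then d else r d)" for d
    have D'D: "D' \<subseteq> D" unfolding D'_def by blast
    have VD': "V \<subseteq> D'" unfolding D'_def using UD pU_v by (auto simp: U_def V_def)
    have split: "D = D' \<union> (U \<union> p ` U)" unfolding D'_def using UD p(1) by blast
    have "r' = perm_restrict r (D - v)"
      using perm unfolding r'_def perm_restrict_def permutes_def by auto
    then have "r' permutes D - v" using perm_restrict_diff_cyclic[OF perm cyc] by simp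
    then have r'_perm: "r' permutes D'"
    proof (rule permutes_superset)
      fix d assume "d \<in> D - v - D'"
      then have "d \<in> p ` U" using UD unfolding D'_def by auto
      then show "r' d = d" using pU_fix by (auto simp: r'_def)
    qed
    have m': "{d \<in> D'. r' d \<noteq> d} \<subset> ?m"
    proof -
      have "{d \<in> D'. r' d \<noteq> d} \<subseteq> ?m" using D'D by (auto simp: r'_def)
      moreover have "a \<in> ?m" "a \<notin> {d \<in> D'. r' d \<noteq> d}" using a av by (auto simp: r'_def)
      ultimately show ?thesis by blast
    qed
    then have card: "card {d \<in> D'. r' d \<noteq> d} < card ?m" using finm by (rule psubset_card_mono[rotated])
    have pD': "p d \<in> D'" if "d \<in> D'" for d
    proof -
      have d: "d \<in> D" "d \<notin> U" "d \<notin> p ` U" using that unfolding D'_def by auto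
      have "p d \<notin> U" using d p(2) by (metis image_eqI)
      moreover have "p d \<notin> p ` U" using d p(2) UD by (metis imageE subsetD)
      ultimately show ?thesis using d p(1) unfolding D'_def by blast
    qed
    \<comment> \<open>Names are attached to sources, so this set must not change: the leaves that
      arise and those that vanish are all sinks.\<close>
    have src: "{d \<in> D'. up d \<and> r' d = d} = {d \<in> D. up d \<and> r d = d}"
    proof (intro equalityI subsetI)
      fix d assume d: "d \<in> {d \<in> D'. up d \<and> r' d = d}"
      then have "d \<notin> v" unfolding D'_def U_def by blast
      then show "d \<in> {d \<in> D. up d \<and> r d = d}" using d D'D by (auto simp: r'_def)
    next
      fix d assume d: "d \<in> {d \<in> D. up d \<and> r d = d}"
      then have "d \<notin> v" "d \<notin> p ` U" using vmv pU_up by auto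
      then show "d \<in> {d \<in> D'. up d \<and> r' d = d}" using d UD unfolding D'_def by (auto simp: r'_def)
    qed
    have "\<exists>G h. cycle_word n G \<and> bij_betw h D' (word_darts n G) \<and>
      (\<forall>d\<in>D'. h (r' d) = word_rot G (h d) \<and> h (p d) = word_opp n G (h d) \<and> (up_dart (h d) \<longleftrightarrow> up d)) \<and>
      (\<forall>d\<in>D'. up d \<and> r' d = d \<longrightarrow> h d = (lab d, 0, True))"
    proof (rule less.hyps[OF card])
      show "finite D'" using fin D'D finite_subset by blast
      show "r' permutes D'" by (rule r'_perm)
      show "up (r' d) \<noteq> up d" if "d \<in> D'" "r' d \<noteq> d" for d
        using that alt[of d] D'D by (auto simp: r'_def split: if_splits)
      show "r' (r' d) \<noteq> d" if "d \<in> D'" "r' d \<noteq> d" for d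
        using that deg[of d] D'D rv by (auto simp: r'_def split: if_splits)
      show "rk (r' d) = rk d" if "d \<in> D'" for d
        using that rk(1) D'D by (auto simp: r'_def)
      show "bij_betw lab {d \<in> D'. up d \<and> r' d = d} {1..n}" unfolding src by (rule lab)
    qed (use pD' p rk(2) D'D in auto)
    then obtain G h where G: "cycle_word n G" and hbij: "bij_betw h D' (word_darts n G)"
      and h: "\<And>d. d \<in> D' \<Longrightarrow> h (r' d) = word_rot G (h d)" "\<And>d. d \<in> D' \<Longrightarrow> h (p d) = word_opp n G (h d)"
        "\<And>d. d \<in> D' \<Longrightarrow> up_dart (h d) \<longleftrightarrow> up d"
      and hsrc: "\<And>d. d \<in> D' \<Longrightarrow> up d \<Longrightarrow> r' d = d \<Longrightarrow> h d = (lab d, 0, True)"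
      by blast
    have hin: "h d \<in> word_darts n G" if "d \<in> D'" for d using bij_betwE[OF hbij] that by blast
    have hinj: "d = e" if "h d = h e" "d \<in> D'" "e \<in> D'" for d e
      using inj_onD[OF bij_betw_imp_inj_on[OF hbij] that] .
    \<comment> \<open>For an incoming half-edge of the removed vertex, the line at whose top it now
      lies.\<close>
    define l where "l d = fst (h d)" for d
    have hV: "h d = (l d, height G (l d), False)" if d: "d \<in> V" for d
    proof -
      obtain x i b where e: "h d = (x, i, b)" by (cases "h d") auto
      have dD: "d \<in> D'" using VD' d by blast
      have "r' d = d" using d UD by (auto simp: r'_def)
      then have fx: "word_rot G (x, i, b) = (x, i, b)" using h(1)[OF dD] e by simp
      have "\<not> b" using h(3)[OF dD] d e by (auto simp: V_def)
      then have "i = height G x" using word_rot_fixed_iff[OF G, of x i b] fx hin[OF dD] e by simp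
      then show ?thesis using e \<open>\<not> b\<close> by (simp add: l_def)
    qed
    have linj: "inj_on l V"
    proof (rule inj_onI)
      fix d e assume "d \<in> V" "e \<in> V" "l d = l e"
      then show "d = e" using hV hinj VD' by (metis subsetD)
    qed
    have lin: "l d \<in> {1..n}" if "d \<in> V" for d
      using hin[of d] hV[OF that] VD' that by (auto simp: word_darts_def)
    \<comment> \<open>Two rotation steps lead from one incoming half-edge to the next, as in
      \<open>layer\<close>; this reads the factor off the vertex.\<close>
    define \<sigma> where "\<sigma> x = (if x \<in> l ` V then l (r (r (inv_into V l x))) else x)" for x
    have \<sigma>l: "\<sigma> (l d) = l (r (r d))" if "d \<in> V" for d
      using that inv_into_f_f[OF linj that] by (simp add: \<sigma>_def)
    have rrV: "r (r d) \<in> V" if "d \<in> V" for d using rU rV that by blast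
    have mv: "moved \<sigma> = l ` V"
    proof (intro equalityI subsetI)
      fix x assume "x \<in> l ` V"
      then obtain d where d: "d \<in> V" "x = l d" by blast
      \<comment> \<open>Degree 2 is excluded here: such a vertex would yield the identity in place
        of a nontrivial cycle.\<close>
      have "r (r d) \<noteq> d" using deg[of d] vmv[of d] d UD by blast
      then have "l (r (r d)) \<noteq> l d" using inj_onD[OF linj, of "r (r d)" d] rrV d by blast
      then show "x \<in> moved \<sigma>" using \<sigma>l d by (simp add: moved_def)
    qed (auto simp: moved_def \<sigma>_def split: if_splits)
    obtain a' where a': "a' \<in> V"
      using av rU[of a] by (cases "up a") (auto simp: U_def V_def)
    \<comment> \<open>Directions alternate along the single orbit of r, so the incoming half-edges
      are those an even number of steps away and form one orbit of the square of r.\<close>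
    have cycV: "cyclic_on (r \<circ> r) V"
    proof (rule cyclic_on_singleI[OF a'])
      show "V = orbit (r \<circ> r) a'"
      proof (intro equalityI subsetI)
        fix d assume d: "d \<in> V"
        have orb: "orbit r a' = v" using orbit_cyclic_eq3[OF cyc] a' UD by blast
        obtain k where k: "d = (r ^^ k) a'"
          using d UD orb orbit_altdef_permutation[OF rperm, of a'] by blast
        have "up ((r ^^ k) a') \<longleftrightarrow> (up a' \<longleftrightarrow> even k)" for k
        proof (induction k)
          case (Suc k)
          have "(r ^^ k) a' \<in> v" using cyclic_on_funpow_in[OF cyc] a' UD by blast
          then show ?case using alt[of "(r ^^ k) a'"] vmv[of "(r ^^ k) a'"] vD Suc by auto
        qed simp
        then have "even k" using d a' k by (auto simp: V_def)
        then obtain j where "k = j * 2" by (metis dvd_div_mult_self)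
        have "(r \<circ> r) ^^ j = r ^^ k"
          using funpow_mult[where f = r and m = 2 and n = j] \<open>k = j * 2\<close> by (simp add: numeral_2_eq_2 mult.commute)
        then have "d = ((r \<circ> r) ^^ j) a'" using k by simp
        moreover have perm2: "permutation (r \<circ> r)" using rperm by (simp add: permutation_compose)
        ultimately show "d \<in> orbit (r \<circ> r) a'" unfolding orbit_altdef_permutation[OF perm2] by auto
      next
        fix d assume "d \<in> orbit (r \<circ> r) a'"
        then show "d \<in> V" by (induction rule: orbit.induct) (use rrV a' in auto)
      qed
    qed
    have "cyclic_on \<sigma> (l ` V)" by (rule cyclic_on_image[OF cycV]) (simp add: \<sigma>l)
    then have cyc\<sigma>: "cyclic_on \<sigma> (moved \<sigma>)" unfolding mv .
    have "\<sigma> permutes l ` V"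
    proof (rule bij_imp_permutes)
      have finV: "finite V" using UD fin finite_subset by blast
      have "inj_on (r \<circ> r) V" using rinj by (metis inj_compose inj_on_subset subset_UNIV)
      then have "(r \<circ> r) ` V = V" using endo_inj_surj[OF finV, of "r \<circ> r"] rrV by auto
      then have "l ` ((r \<circ> r) ` V) = l ` V" by simp
      then have "\<sigma> ` (l ` V) = l ` V" using \<sigma>l by (simp add: image_image)
      then show "bij_betw \<sigma> (l ` V) (l ` V)"
        unfolding bij_betw_def using eq_card_imp_inj_on[of "l ` V" \<sigma>] finV by simp
    qed (simp add: \<sigma>_def)
    moreover have "l ` V \<subseteq> {1..n}" using lin by blast
    ultimately have "\<sigma> permutes {1..n}" by (rule permutes_subset)
    then have \<sigma>: "nontrivial_cycle n \<sigma>" using cyc\<sigma> unfolding nontrivial_cycle_def by blast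
    then have G': "cycle_word n (\<sigma> # G)" using G by simp
    have mv_l: "\<sigma> (l d) \<noteq> l d" if "d \<in> V" for d using mv that by (auto simp: moved_def)
    have rUV: "r ` U = V"
    proof (intro equalityI subsetI)
      fix d assume d: "d \<in> V"
      obtain e where e: "r e = d" using permutes_surj[OF perm] by (metis surj_def)
      then have "e \<in> v" using rv d UD by blast
      then have "e \<in> U" using alt[of e] vmv[of e] vD d e by (auto simp: U_def V_def)
      then show "d \<in> r ` U" using e by blast
    qed (use rU in blast)
    let ?t = "\<lambda>b d. (l (r d), Suc (height G (l (r d))), b) :: dart"
    \<comment> \<open>An outgoing half-edge d continues the line of the incoming half-edge
      \<open>r d\<close>, in accordance with \<open>word_rot_up\<close>; its edge is the new topmost
      one of that line.\<close>
    define h' where "h' d = (if d \<in> U then ?t True d else if d \<in> p ` U then ?t False (p d) else h d)" for d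
    have UpU: "U \<inter> p ` U = {}" using pU_up by (auto simp: U_def)
    have h'U: "h' d = ?t True d" if "d \<in> U" for d using that by (simp add: h'_def)
    have h'pU: "h' (p d) = ?t False d" if "d \<in> U" for d
      using that UpU p(2) UD by (auto simp: h'_def)
    have h'D': "h' d = h d" if "d \<in> D'" for d using that by (auto simp: h'_def D'_def)
    have t_inj: "d = e" if "l (r d) = l (r e)" "d \<in> U" "e \<in> U" for d e
    proof -
      have "r d = r e" using inj_onD[OF linj that(1)] rU that by blast
      then show ?thesis using rinj by (simp add: inj_eq)
    qed
    let ?A = "\<lambda>b. (\<lambda>x. (x, Suc (height G x), b)) ` (l ` V) :: dart set"
    have bU: "bij_betw h' U (?A True)"
    proof -
      have "inj_on h' U" using h'U t_inj by (auto intro!: inj_onI)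
      moreover have "h' ` U = ?A True" using h'U unfolding rUV[symmetric] image_image by (auto intro: image_cong)
      ultimately show ?thesis unfolding bij_betw_def ..
    qed
    have bpU: "bij_betw h' (p ` U) (?A False)"
    proof -
      have "inj_on h' (p ` U)"
      proof (rule inj_onI)
        fix x y assume "x \<in> p ` U" "y \<in> p ` U" and eq: "h' x = h' y"
        then obtain d e where de: "d \<in> U" "e \<in> U" "x = p d" "y = p e" by blast
        then have "l (r d) = l (r e)" using eq h'pU by simp
        then show "x = y" using t_inj de by blast
      qed
      moreover have "h' ` (p ` U) = ?A False"
        using h'pU unfolding rUV[symmetric] image_image by (auto intro: image_cong)
      ultimately show ?thesis unfolding bij_betw_def ..
    qed
    have bD': "bij_betw h' D' (word_darts n G)" using hbij h'D' bij_betw_cong by metis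
    have "word_darts n (\<sigma> # G) = word_darts n G \<union> (?A True \<union> ?A False)"
    proof (rule Set.set_eqI)
      fix e :: dart
      obtain x i b where e: "e = (x, i, b)" by (cases e) auto
      have "x \<in> {1..n}" if "x \<in> l ` V" using that lin by blast
      then show "e \<in> word_darts n (\<sigma> # G) \<longleftrightarrow> e \<in> word_darts n G \<union> (?A True \<union> ?A False)"
        using mv unfolding e word_darts_def moved_def
        by (cases "x \<in> l ` V"; cases b) (auto simp: height_Cons le_Suc_eq image_iff)
    qed
    moreover have "bij_betw h' D (word_darts n G \<union> (?A True \<union> ?A False))"
      unfolding split
    proof (rule bij_betw_combine[OF bD' bij_betw_combine[OF bU bpU]])
      show "?A True \<inter> ?A False = {}" by auto
      show "word_darts n G \<inter> (?A True \<union> ?A False) = {}" by (auto simp: word_darts_def)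
    qed
    ultimately have bij: "bij_betw h' D (word_darts n (\<sigma> # G))" by simp
    have h'in: "h' d \<in> word_darts n (\<sigma> # G)" if "d \<in> D" for d using bij_betwE[OF bij] that by blast
    have "h' (r d) = word_rot (\<sigma> # G) (h' d)" if d: "d \<in> D" for d
    proof -
      consider "d \<in> U" | "d \<in> V" | "d \<in> p ` U" | "d \<in> D'" "d \<notin> v"
        using d unfolding D'_def U_def V_def by blast
      then show ?thesis
      proof cases
        case 1
        have "h' (r d) = h (r d)" using h'D' VD' rU[OF 1] by blast
        then show ?thesis
          using hV[OF rU[OF 1]] h'U[OF 1] word_rot_top(2)[OF \<sigma> mv_l[OF rU[OF 1]], of G] by simp
      next
        case 2
        have "h' d = h d" using h'D' VD' 2 by blast
        then show ?thesis
          using hV[OF 2] h'U[OF rV[OF 2]] word_rot_top(1)[OF \<sigma> mv_l[OF 2], of G] \<sigma>l[OF 2] by simp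
      next
        case 3
        then obtain e where e: "e \<in> U" "d = p e" by blast
        have "height (\<sigma> # G) (l (r e)) = Suc (height G (l (r e)))" using mv_l[OF rU[OF e(1)]] by (simp add: height_Cons)
        then have "word_rot (\<sigma> # G) (h' d) = h' d"
          using h'pU[OF e(1)] e(2) word_rot_fixed[of False _ "\<sigma> # G" "l (r e)"] by (simp del: word_rot.simps)
        then show ?thesis using pU_fix e by simp
      next
        case 4
        have rd: "r d = r' d" using 4 by (simp add: r'_def)
        have "r d \<in> D'" using permutes_in_image[OF r'_perm] 4 rd by simp
        then have "h' (r d) = word_rot G (h d)" using h'D' h(1)[OF 4(1)] rd by simp
        moreover have "h d \<notin> top_vertex \<sigma> G"
        proof
          assume "h d \<in> top_vertex \<sigma> G"
          then consider x where "x \<in> l ` V" "h d = (x, height G x, False)"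
            | x where "h d = (x, Suc (height G x), True)"
            unfolding top_vertex_def mv by blast
          then show False
          proof cases
            case 1
            then obtain e where e: "e \<in> V" "h d = h e" using hV by auto
            then have "d = e" using hinj 4(1) VD' by blast
            then show False using e 4(2) UD by blast
          next
            case 2 then show False using hin[OF 4(1)] by (simp add: word_darts_def)
          qed
        qed
        ultimately show ?thesis using word_rot_Cons_old h'D' 4(1) by simp
      qed
    qed
    moreover have "h' (p d) = word_opp n (\<sigma> # G) (h' d)" if d: "d \<in> D" for d
    proof -
      consider "d \<in> U" | "d \<in> p ` U" | "d \<in> D'" using d unfolding D'_def by blast
      then show ?thesis
      proof cases
        case 1
        have "word_opp n (\<sigma> # G) (?t True d) = ?t False d"
          using word_opp_apply h'in[OF d] h'U[OF 1] by (metis (full_types))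
        then show ?thesis using h'U[OF 1] h'pU[OF 1] by simp
      next
        case 2
        then obtain e where e: "e \<in> U" "d = p e" by blast
        have "p d = e" using e p(2) UD by blast
        moreover have "word_opp n (\<sigma> # G) (?t False e) = ?t True e"
          using word_opp_apply h'in[OF d] h'pU[OF e(1)] e(2) by (metis (full_types))
        ultimately show ?thesis using h'U[OF e(1)] h'pU[OF e(1)] e by simp
      next
        case 3
        obtain x i b where e: "h d = (x, i, b)" by (cases "h d") auto
        have "word_opp n G (h d) = word_opp n (\<sigma> # G) (h d)"
          using hin[OF 3] word_darts_mono[of n G \<sigma>] word_opp_apply unfolding e by (metis subsetD)
        then show ?thesis using h'D'[OF 3] h'D'[OF pD'[OF 3]] h(2)[OF 3] by simp
      qed
    qed
    moreover have "up_dart (h' d) \<longleftrightarrow> up d" if d: "d \<in> D" for d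
    proof -
      consider "d \<in> U" | e where "e \<in> U" "d = p e" | "d \<in> D'" using d unfolding D'_def by blast
      then show ?thesis using h'U h'pU h'D' h(3) pU_up by cases (auto simp: U_def)
    qed
    moreover have "h' d = (lab d, 0, True)" if "d \<in> D" "up d" "r d = d" for d
    proof -
      have "d \<in> {d \<in> D'. up d \<and> r' d = d}" using that unfolding src by blast
      then show ?thesis using hsrc h'D' by auto
    qed
    ultimately show ?thesis using G' bij by blast
  qed
qed

section \<open>Interchanges and relabellings\<close>

lemma moved_image: "bij \<sigma> \<Longrightarrow> x \<in> moved \<sigma> \<Longrightarrow> \<sigma> x \<in> moved \<sigma>"
  using bij_moved_iff[of \<sigma> x] by (simp add: moved_def)

lemma disjoint_perms_iff: "disjoint_perms \<sigma> \<tau> \<longleftrightarrow> moved \<sigma> \<inter> moved \<tau> = {}"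
  by (simp add: disjoint_perms_def moved_def)

text \<open>Disjoint factors act on different lines, so neither changes the heights at which the
  other is inserted.\<close>

lemma layer_commute:
  assumes "bij \<sigma>" "bij \<tau>" "disjoint_perms \<sigma> \<tau>"
  shows "layer \<tau> F \<circ> layer \<sigma> (\<tau> # F) = layer \<sigma> F \<circ> layer \<tau> (\<sigma> # F)"
proof
  fix d :: dart
  obtain x i b where d: "d = (x, i, b)" by (cases d) auto
  have \<sigma>: "\<tau> x = x \<and> \<tau> (\<sigma> x) = \<sigma> x \<and> \<sigma> (\<sigma> x) \<noteq> \<sigma> x" if "\<sigma> x \<noteq> x"
    using that moved_image[OF assms(1), of x] assms(3) unfolding disjoint_perms_iff moved_def by blast
  have \<tau>: "\<sigma> x = x \<and> \<sigma> (\<tau> x) = \<tau> x \<and> \<tau> (\<tau> x) \<noteq> \<tau> x" if "\<tau> x \<noteq> x"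
    using that moved_image[OF assms(2), of x] assms(3) unfolding disjoint_perms_iff moved_def by blast
  show "(layer \<tau> F \<circ> layer \<sigma> (\<tau> # F)) d = (layer \<sigma> F \<circ> layer \<tau> (\<sigma> # F)) d"
    unfolding d using \<sigma> \<tau>
    by (cases "\<sigma> x = x"; cases "\<tau> x = x") (auto simp: layer_def height_Cons)
qed

lemma commute_disjoint:
  assumes "bij \<sigma>" "bij \<tau>" "disjoint_perms \<sigma> \<tau>"
  shows "\<sigma> \<circ> \<tau> = \<tau> \<circ> \<sigma>"
proof
  fix x
  have "\<tau> x = x \<and> \<tau> (\<sigma> x) = \<sigma> x" if "\<sigma> x \<noteq> x"
    using that moved_image[OF assms(1), of x] assms(3) unfolding disjoint_perms_iff moved_def by blast
  moreover have "\<sigma> x = x \<and> \<sigma> (\<tau> x) = \<tau> x" if "\<tau> x \<noteq> x"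
    using that moved_image[OF assms(2), of x] assms(3) unfolding disjoint_perms_iff moved_def by blast
  ultimately show "(\<sigma> \<circ> \<tau>) x = (\<tau> \<circ> \<sigma>) x" by (cases "\<sigma> x = x"; cases "\<tau> x = x") auto
qed

lemma layer_cong: "height F = height F' \<Longrightarrow> layer \<sigma> F = layer \<sigma> F'"
  by (simp add: layer_def fun_eq_iff)

text \<open>A layer sees the factors below it only through \<open>height\<close>; these two
  functions therefore carry all that matters for factors added on top.\<close>

lemma word_rot_append_cong:
  assumes "word_rot F = word_rot F'" "height F = height F'"
  shows "word_rot (A @ F) = word_rot (A @ F') \<and> height (A @ F) = height (A @ F')"
proof (induction A)
  case (Cons \<sigma> A)
  then have "layer \<sigma> (A @ F) = layer \<sigma> (A @ F')" by (intro layer_cong) simp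
  moreover have "height (\<sigma> # A @ F) = height (\<sigma> # A @ F')" using Cons by (simp add: height_Cons fun_eq_iff)
  ultimately show ?case using Cons by simp
qed (use assms in simp)

lemma word_prod_append: "word_prod (A @ B) = word_prod A \<circ> word_prod B"
  by (induction A) (simp_all add: comp_assoc)

lemma interchange_invariant:
  assumes "(F, F') \<in> interchange" "cycle_word n F"
  shows "cycle_word n F' \<and> word_rot F' = word_rot F \<and> height F' = height F \<and> word_prod F' = word_prod F"
proof -
  obtain A \<sigma> \<tau> B where e: "F = A @ [\<sigma>, \<tau>] @ B" "F' = A @ [\<tau>, \<sigma>] @ B" "disjoint_perms \<sigma> \<tau>"
    using assms(1) unfolding interchange_def by blast
  have bij: "bij \<sigma>" "bij \<tau>" using assms(2) nontrivial_cycleD(2) unfolding e(1) by auto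
  have "word_rot (\<tau> # \<sigma> # B) = word_rot (\<sigma> # \<tau> # B)"
    using layer_commute[OF bij e(3), of B] by (simp add: comp_assoc)
  moreover have "height (\<tau> # \<sigma> # B) = height (\<sigma> # \<tau> # B)" by (auto simp: height_Cons fun_eq_iff)
  ultimately have "word_rot F' = word_rot F \<and> height F' = height F"
    unfolding e(1,2) using word_rot_append_cong[of "\<tau> # \<sigma> # B" "\<sigma> # \<tau> # B" A] by simp
  moreover have "word_prod F' = word_prod F"
    unfolding e(1,2) word_prod_append using commute_disjoint[OF bij e(3)] by simp
  moreover have "cycle_word n F'" using assms(2) unfolding e(1,2) by auto
  ultimately show ?thesis by blast
qed

lemma interchanges_invariant:
  assumes "(F, F') \<in> interchange\<^sup>*" "cycle_word n F"
  shows "cycle_word n F' \<and> word_rot F' = word_rot F \<and> height F' = height F \<and> word_prod F' = word_prod F"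
  using assms(1)
proof induction
  case (step G G')
  then have "cycle_word n G" by blast
  then show ?case using interchange_invariant[OF step.hyps(2)] step.IH by metis
qed (use assms in simp)

lemma sym_interchanges: "sym (interchange\<^sup>*)"
proof (rule sym_rtrancl, rule symI)
  fix F F' assume "(F, F') \<in> interchange"
  then obtain A \<sigma> \<tau> B where "F = A @ [\<sigma>, \<tau>] @ B" "F' = A @ [\<tau>, \<sigma>] @ B" "disjoint_perms \<sigma> \<tau>"
    unfolding interchange_def by blast
  moreover from this(3) have "disjoint_perms \<tau> \<sigma>" unfolding disjoint_perms_def by blast
  ultimately show "(F', F) \<in> interchange" unfolding interchange_def by blast
qed

lemma interchanges_Cons: "(F, F') \<in> interchange\<^sup>* \<Longrightarrow> (\<sigma> # F, \<sigma> # F') \<in> interchange\<^sup>*"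
proof (induction rule: rtrancl_induct)
  case (step G G')
  then obtain A \<rho> \<tau> B where "G = A @ [\<rho>, \<tau>] @ B" "G' = A @ [\<tau>, \<rho>] @ B" "disjoint_perms \<rho> \<tau>"
    unfolding interchange_def by blast
  then have "\<sigma> # G = (\<sigma> # A) @ [\<rho>, \<tau>] @ B" "\<sigma> # G' = (\<sigma> # A) @ [\<tau>, \<rho>] @ B" by simp_all
  then have "(\<sigma> # G, \<sigma> # G') \<in> interchange"
    using \<open>disjoint_perms \<rho> \<tau>\<close> unfolding interchange_def by blast
  then show ?case using step.IH by (rule rtrancl_into_rtrancl[rotated])
qed simp

lemma interchanges_to_front:
  assumes "\<And>\<rho>. \<rho> \<in> set A \<Longrightarrow> disjoint_perms \<sigma> \<rho>"
  shows "(A @ \<sigma> # B, \<sigma> # A @ B) \<in> interchange\<^sup>*"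
  using assms
proof (induction A)
  case (Cons \<rho> A)
  then have "(\<rho> # A @ \<sigma> # B, \<rho> # \<sigma> # A @ B) \<in> interchange\<^sup>*" by (intro interchanges_Cons) simp
  moreover have "disjoint_perms \<rho> \<sigma>" using Cons.prems[of \<rho>] unfolding disjoint_perms_def by auto
  then have "([] @ [\<rho>, \<sigma>] @ (A @ B), [] @ [\<sigma>, \<rho>] @ (A @ B)) \<in> interchange"
    unfolding interchange_def by blast
  ultimately show ?case by simp
qed simp

lemma word_rot_append_untouched:
  assumes "\<And>\<rho>. \<rho> \<in> set A \<Longrightarrow> \<rho> x = x"
  shows "word_rot (A @ B) (x, i, b) = word_rot B (x, i, b) \<and> height (A @ B) x = height B x"
  using assms
proof (induction A)
  case (Cons \<rho> A)
  then have "(x, i, b) \<notin> top_vertex \<rho> (A @ B)" by (auto simp: top_vertex_def moved_def)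
  then show ?case using word_rot_Cons_old[of "(x, i, b)" \<rho> "A @ B"] Cons by (simp add: height_Cons)
qed simp

text \<open>The last factor acting on a line is visible in the map at the upper end of that line, so the
  head of one list can be brought to the front of the other and removed from both.\<close>

lemma interchanges_if_word_rot_eq:
  assumes "cycle_word n F" "cycle_word n F'" "word_rot F = word_rot F'" "height F = height F'"
  shows "(F, F') \<in> interchange\<^sup>*"
  using assms
proof (induction F arbitrary: F')
  case Nil
  have "F' = []"
  proof (cases F')
    case (Cons \<sigma> G)
    then have "nontrivial_cycle n \<sigma>" using Nil by simp
    then obtain x where "\<sigma> x \<noteq> x"
      using nontrivial_cycleD(4) unfolding cyclic_on_def moved_def by blast
    then have "height F' x \<noteq> 0" using Cons by (simp add: height_Cons)
    then show ?thesis using Nil(4) by (metis height_Nil)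
  qed
  then show ?case by simp
next
  case (Cons \<sigma> G)
  then have \<sigma>: "nontrivial_cycle n \<sigma>" and G: "cycle_word n G" by auto
  note F' = Cons.prems(2) and eq = Cons.prems(3,4)
  note b\<sigma> = nontrivial_cycleD(2)[OF \<sigma>]
  obtain x0 where x0: "x0 \<in> moved \<sigma>" using nontrivial_cycleD(4)[OF \<sigma>] unfolding cyclic_on_def by blast
  then have "height (\<sigma> # G) x0 = Suc (height G x0)" by (simp add: height_Cons moved_def)
  then have "height F' x0 \<noteq> 0" unfolding eq(2) by simp
  then obtain \<tau> where "\<tau> \<in> set F'" "\<tau> x0 \<noteq> x0" by (auto simp: height_def filter_empty_conv)
  then have "\<exists>\<tau>\<in>set F'. \<not> disjoint_perms \<sigma> \<tau>" using x0 unfolding disjoint_perms_iff moved_def by blast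
  then obtain A \<tau> B where dec: "F' = A @ \<tau> # B" "\<not> disjoint_perms \<sigma> \<tau>" "\<And>\<rho>. \<rho> \<in> set A \<Longrightarrow> disjoint_perms \<sigma> \<rho>"
    using split_list_first_prop[of F' "\<lambda>\<tau>. \<not> disjoint_perms \<sigma> \<tau>"] by blast
  have \<tau>: "nontrivial_cycle n \<tau>" using F' dec(1) by simp
  have untouched: "\<rho> x = x" if "x \<in> moved \<sigma>" "\<rho> \<in> set A" for x \<rho>
    using dec(3)[OF that(2)] that(1) unfolding disjoint_perms_iff moved_def by blast
  \<comment> \<open>On a line moved by both, each of the two factors is the topmost one, so the
    rotation at the last incoming half-edge shows both images.\<close>
  have agree: "\<tau> x = \<sigma> x" if x: "x \<in> moved \<sigma>" "x \<in> moved \<tau>" for x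
  proof -
    have mv: "\<sigma> x \<noteq> x" "\<tau> x \<noteq> x" using x by (auto simp: moved_def)
    have F'x: "word_rot F' (x, i, b) = word_rot (\<tau> # B) (x, i, b) \<and> height F' x = height (\<tau> # B) x" for i b
      unfolding dec(1) using word_rot_append_untouched untouched x(1) by blast
    then have "height G x = height B x" using eq(2) mv by (metis height_Cons nat.inject)
    then have "word_rot (\<sigma> # G) (x, height G x, False) = word_rot (\<tau> # B) (x, height B x, False)"
      unfolding eq(1) using F'x[of "height B x" False] by (simp del: word_rot.simps)
    then show ?thesis using word_rot_top(1)[OF \<sigma> mv(1), of G] word_rot_top(1)[OF \<tau> mv(2), of B] by simp
  qed
  obtain x where x: "x \<in> moved \<sigma>" "x \<in> moved \<tau>" using dec(2) unfolding disjoint_perms_iff by blast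
  have mv\<sigma>: "moved \<sigma> = orbit \<sigma> x" and mv\<tau>: "moved \<tau> = orbit \<tau> x"
    using orbit_cyclic_eq3 nontrivial_cycleD(4) \<sigma> \<tau> x by metis+
  \<comment> \<open>Agreement propagates along the orbit of a common point. The two cycles thus run
    through the same orbit and are equal.\<close>
  have sub: "y \<in> moved \<tau>" if "y \<in> orbit \<sigma> x" for y
    using that
  proof induction
    case base show ?case using moved_image[OF nontrivial_cycleD(2)[OF \<tau>] x(2)] agree[OF x] by simp
  next
    case (step y)
    then have "y \<in> moved \<sigma>" using mv\<sigma> by simp
    then show ?case
      using moved_image[OF nontrivial_cycleD(2)[OF \<tau>] step.IH] agree[OF _ step.IH] by simp
  qed
  have "orbit \<tau> x = orbit \<sigma> x"
  proof (rule orbit_cong)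
    show "x \<in> orbit \<sigma> x" using x mv\<sigma> by simp
    show "\<tau> y = \<sigma> y" if "y \<in> orbit \<sigma> x" for y using agree[of y] sub[OF that] that mv\<sigma> by simp
  qed
  then have "moved \<tau> = moved \<sigma>" using mv\<sigma> mv\<tau> by simp
  then have "\<tau> y = \<sigma> y" for y using agree[of y] by (cases "y \<in> moved \<sigma>") (auto simp: moved_def)
  then have "\<tau> = \<sigma>" by blast
  then have front: "(F', \<sigma> # A @ B) \<in> interchange\<^sup>*"
    unfolding dec(1) using interchanges_to_front dec(3) by blast
  then have inv: "cycle_word n (\<sigma> # A @ B)" "word_rot (\<sigma> # A @ B) = word_rot (\<sigma> # G)" "height (\<sigma> # A @ B) = height (\<sigma> # G)"
    using interchanges_invariant[OF front F'] eq by (simp_all del: word_rot.simps)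
  have height_eq: "height (A @ B) = height G"
  proof
    fix y
    have "height (\<sigma> # A @ B) y = height (\<sigma> # G) y" using inv(3) by simp
    then show "height (A @ B) y = height G y" by (simp add: height_Cons split: if_splits)
  qed
  then have lay: "layer \<sigma> (A @ B) = layer \<sigma> G" by (rule layer_cong)
  \<comment> \<open>The common top layer is surjective and can be cancelled on the right.\<close>
  have "word_rot (A @ B) d = word_rot G d" for d
  proof -
    obtain e where "layer \<sigma> G e = d" using permutes_surj[OF layer_permutes[OF \<sigma>]] by (metis surj_def)
    then show ?thesis using fun_cong[OF inv(2), of e] lay by simp
  qed
  then have "word_rot (A @ B) = word_rot G" by blast
  then have "(G, A @ B) \<in> interchange\<^sup>*" using Cons.IH[OF G, of "A @ B"] inv(1) height_eq by simp
  then have "(\<sigma> # G, \<sigma> # A @ B) \<in> interchange\<^sup>*" by (rule interchanges_Cons)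
  then show ?case using front symD[OF sym_interchanges] by (meson rtrancl_trans)
qed

section \<open>Conjugating all factors, that is, renaming the lines\<close>

definition relabel :: "(nat \<Rightarrow> nat) \<Rightarrow> (nat \<Rightarrow> nat) list \<Rightarrow> (nat \<Rightarrow> nat) list" where
  "relabel \<tau> F = map (\<lambda>\<sigma>. \<tau> \<circ> \<sigma> \<circ> inv' \<tau>) F"

lemma relabel_simps [simp]:
  "relabel \<tau> [] = []" "relabel \<tau> (\<sigma> # F) = (\<tau> \<circ> \<sigma> \<circ> inv' \<tau>) # relabel \<tau> F"
  by (simp_all add: relabel_def)

lemma conj_apply: "bij \<tau> \<Longrightarrow> (\<tau> \<circ> \<sigma> \<circ> inv' \<tau>) (\<tau> x) = \<tau> (\<sigma> x)"
  by (simp add: bij_is_inj)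

lemma height_relabel: "bij \<tau> \<Longrightarrow> height (relabel \<tau> F) (\<tau> x) = height F x"
  by (induction F) (auto simp: height_Cons bij_is_inj inj_eq)

lemma layer_relabel:
  assumes "bij \<tau>"
  shows "layer (\<tau> \<circ> \<sigma> \<circ> inv' \<tau>) (relabel \<tau> F) (apfst \<tau> d) = apfst \<tau> (layer \<sigma> F d)"
proof -
  obtain x i b where d: "d = (x, i, b)" by (cases d) auto
  show ?thesis
    unfolding d layer_def using assms height_relabel[OF assms] conj_apply[OF assms]
    by (simp add: bij_is_inj inj_eq)
qed

text \<open>Renaming lines leaves the levels alone, so \<open>apfst \<tau>\<close> intertwines the
  two rotations.\<close>

lemma word_rot_relabel: "bij \<tau> \<Longrightarrow> word_rot (relabel \<tau> F) (apfst \<tau> d) = apfst \<tau> (word_rot F d)"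
  by (induction F arbitrary: d) (simp_all add: layer_relabel del: comp_apply add: comp_apply[of "word_rot _"])

lemma word_prod_relabel: "bij \<tau> \<Longrightarrow> word_prod (relabel \<tau> F) = \<tau> \<circ> word_prod F \<circ> inv' \<tau>"
  by (induction F) (auto simp: fun_eq_iff bij_is_inj bij_is_surj surj_f_inv_f)

lemma nontrivial_cycle_conj:
  assumes \<tau>: "\<tau> permutes {1..n}" and \<sigma>: "nontrivial_cycle n \<sigma>"
  shows "nontrivial_cycle n (\<tau> \<circ> \<sigma> \<circ> inv' \<tau>)"
proof -
  have bij: "bij \<tau>" using permutes_bij[OF \<tau>] .
  note conj = conj_apply[OF bij]
  have "\<tau> \<circ> \<sigma> \<circ> inv' \<tau> permutes {1..n}"
    using permutes_compose permutes_inv[OF \<tau>] nontrivial_cycleD(1)[OF \<sigma>] \<tau> by blast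
  moreover have "moved (\<tau> \<circ> \<sigma> \<circ> inv' \<tau>) = \<tau> ` moved \<sigma>"
  proof (rule Set.set_eqI)
    fix y
    obtain x where y: "y = \<tau> x" using bij_is_surj[OF bij] by (metis surj_def)
    have "y \<in> moved (\<tau> \<circ> \<sigma> \<circ> inv' \<tau>) \<longleftrightarrow> \<tau> (\<sigma> x) \<noteq> \<tau> x"
      using conj[of \<sigma> x] unfolding moved_def y by simp
    then show "y \<in> moved (\<tau> \<circ> \<sigma> \<circ> inv' \<tau>) \<longleftrightarrow> y \<in> \<tau> ` moved \<sigma>"
      unfolding y using bij_is_inj[OF bij] by (auto simp: moved_def inj_eq)
  qed
  moreover have "cyclic_on (\<tau> \<circ> \<sigma> \<circ> inv' \<tau>) (\<tau> ` moved \<sigma>)"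
    using nontrivial_cycleD(4)[OF \<sigma>] conj by (rule cyclic_on_image)
  ultimately show ?thesis unfolding nontrivial_cycle_def by simp
qed

lemma cycle_word_relabel:
  "\<tau> permutes {1..n} \<Longrightarrow> cycle_word n F \<Longrightarrow> cycle_word n (relabel \<tau> F)"
  by (auto simp: relabel_def intro!: nontrivial_cycle_conj)

lemma apfst_word_darts_relabel:
  assumes \<tau>: "\<tau> permutes {1..n}"
  shows "apfst \<tau> d \<in> word_darts n (relabel \<tau> F) \<longleftrightarrow> d \<in> word_darts n F"
  using permutes_in_image[OF \<tau>] height_relabel[OF permutes_bij[OF \<tau>]]
  by (cases d) (simp add: word_darts_def del: atLeastAtMost_iff)

lemma word_opp_relabel:
  assumes \<tau>: "\<tau> permutes {1..n}"
  shows "word_opp n (relabel \<tau> F) (apfst \<tau> d) = apfst \<tau> (word_opp n F d)"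
  using permutes_in_image[OF \<tau>] height_relabel[OF permutes_bij[OF \<tau>]]
  by (cases d) (simp add: word_opp_def del: atLeastAtMost_iff)

section \<open>Isomorphisms between word maps\<close>

lemma height_outside: "cycle_word n F \<Longrightarrow> x \<notin> {1..n} \<Longrightarrow> height F x = 0"
proof (induction F)
  case (Cons \<sigma> F)
  then have "\<sigma> x = x" using nontrivial_cycleD(1)[of n \<sigma>] permutes_not_in by fastforce
  then show ?case using Cons by (simp add: height_Cons)
qed simp

text \<open>The values at the lower leaves determine h: climbing each line edge by edge shows that h
  only renames lines. Equality of rotations and heights then turns into interchanges.\<close>

lemma word_map_iso_fixing_sources:
  assumes F: "cycle_word n F" and F': "cycle_word n F'" and \<tau>: "\<tau> permutes {1..n}"
    and inj: "inj_on h (word_darts n F)"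
    and rot: "\<And>d. d \<in> word_darts n F \<Longrightarrow> h (word_rot F d) = word_rot F' (h d)"
    and opp: "\<And>d. d \<in> word_darts n F \<Longrightarrow> h (word_opp n F d) = word_opp n F' (h d)"
    and src: "\<And>x. x \<in> {1..n} \<Longrightarrow> h (x, 0, True) = (\<tau> x, 0, True)"
  shows "(relabel \<tau> F, F') \<in> interchange\<^sup>*"
proof -
  have inj': "inj (word_rot F')" using word_rot_permutes[OF F'] permutes_inj by blast
  have bij: "bij \<tau>" using permutes_bij[OF \<tau>] .
  have \<tau>in: "\<tau> x \<in> {1..n} \<longleftrightarrow> x \<in> {1..n}" for x using permutes_in_image[OF \<tau>] .
  have main: "i \<le> height F' (\<tau> x) \<and> h (x, i, True) = (\<tau> x, i, True) \<and> h (x, i, False) = (\<tau> x, i, False)"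
    if x: "x \<in> {1..n}" and "i \<le> height F x" for x i
    using that(2)
  proof (induction i)
    case 0
    have "(x, 0, True) \<in> word_darts n F" "(\<tau> x, 0, True) \<in> word_darts n F'" using x \<tau>in by (auto simp: word_darts_def)
    then show ?case using src[OF x] opp[of "(x, 0, True)"] by (simp add: word_opp_apply)
  next
    case (Suc i)
    have D: "(x, i, False) \<in> word_darts n F" "(x, Suc i, True) \<in> word_darts n F"
      using x Suc.prems by (auto simp: word_darts_def)
    have IH: "i \<le> height F' (\<tau> x)" "h (x, i, False) = (\<tau> x, i, False)" using Suc by auto
    have "word_rot F (x, Suc i, True) = (x, i, False)" using word_rot_up[of "Suc i" F x] Suc.prems by simp
    then have r: "word_rot F' (h (x, Suc i, True)) = (\<tau> x, i, False)" using rot[OF D(2)] IH by simp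
    \<comment> \<open>If the image line ended here, h would identify the incoming and the outgoing
      half-edge of x at this vertex.\<close>
    have "i \<noteq> height F' (\<tau> x)"
    proof
      assume "i = height F' (\<tau> x)"
      then have "word_rot F' (\<tau> x, i, False) = (\<tau> x, i, False)" by (simp add: word_rot_fixed)
      then have "h (x, Suc i, True) = (\<tau> x, i, False)" using r inj' by (metis injD)
      then have "h (x, Suc i, True) = h (x, i, False)" using IH by simp
      then show False using inj_onD[OF inj _ D(2) D(1)] by blast
    qed
    then have le: "Suc i \<le> height F' (\<tau> x)" using IH by simp
    then have "word_rot F' (\<tau> x, Suc i, True) = (\<tau> x, i, False)" using word_rot_up[of "Suc i" F' "\<tau> x"] by simp
    then have up: "h (x, Suc i, True) = (\<tau> x, Suc i, True)" using r inj' by (metis injD)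
    moreover have "(\<tau> x, Suc i, True) \<in> word_darts n F'" using le x \<tau>in by (auto simp: word_darts_def)
    ultimately show ?case using le opp[OF D(2)] D(2) by (simp add: word_opp_apply)
  qed
  have height_eq: "height F' (\<tau> x) = height F x" for x
  proof (cases "x \<in> {1..n}")
    case True
    let ?i = "height F x"
    have D: "(x, ?i, False) \<in> word_darts n F" using True by (auto simp: word_darts_def)
    have m: "?i \<le> height F' (\<tau> x)" "h (x, ?i, False) = (\<tau> x, ?i, False)" using main[OF True] by auto
    have "word_rot F (x, ?i, False) = (x, ?i, False)" by (simp add: word_rot_fixed)
    then have "word_rot F' (\<tau> x, ?i, False) = (\<tau> x, ?i, False)" using rot[OF D] m by simp
    moreover have "(\<tau> x, ?i, False) \<in> word_darts n F'" using m True \<tau>in by (auto simp: word_darts_def)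
    ultimately show ?thesis using word_rot_fixed_iff[OF F', of "\<tau> x" ?i False] by simp
  next
    case False then show ?thesis using height_outside F F' \<tau>in by metis
  qed
  have surj: "\<exists>x. y = \<tau> x" for y using bij_is_surj[OF bij] by (metis surj_def)
  have "height (relabel \<tau> F) y = height F' y" for y
    using surj[of y] height_eq height_relabel[OF bij] by metis
  then have height_fun: "height (relabel \<tau> F) = height F'" by blast
  have R: "cycle_word n (relabel \<tau> F)" using cycle_word_relabel[OF \<tau> F] .
  have D_eq: "word_darts n (relabel \<tau> F) = word_darts n F'" unfolding word_darts_def height_fun ..
  have "word_rot (relabel \<tau> F) e = word_rot F' e" for e
  proof (cases "e \<in> word_darts n F'")
    case True
    obtain d where d: "e = apfst \<tau> d" using surj[of "fst e"] by (cases e) (metis apfst_conv fst_conv)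
    then have dF: "d \<in> word_darts n F" using True apfst_word_darts_relabel[OF \<tau>] D_eq by metis
    have h: "h d = apfst \<tau> d" if "d \<in> word_darts n F" for d
      using main[of "fst d" "fst (snd d)"] that by (cases d; cases "snd (snd d)") (auto simp: word_darts_def)
    have "word_rot F' e = h (word_rot F d)" using rot[OF dF] h[OF dF] d by simp
    also have "\<dots> = apfst \<tau> (word_rot F d)" using h word_rot_in[OF F dF] by blast
    finally show ?thesis using word_rot_relabel[OF bij, of F d] d by simp
  next
    case False
    then show ?thesis
      using permutes_not_in[OF word_rot_permutes[OF F']] permutes_not_in[OF word_rot_permutes[OF R]] D_eq by metis
  qed
  then have "word_rot (relabel \<tau> F) = word_rot F'" by blast
  then show ?thesis using interchanges_if_word_rot_eq[OF R F'] height_fun by blast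
qed

text \<open>Directions alternate on both sides, so whether h preserves them is constant on a
  connected map. One half-edge settles it, and lower leaves then go to lower leaves, which defines
  \<tau>.\<close>

lemma word_map_iso_relabel:
  assumes F: "cycle_word n F" and F': "cycle_word n F'" and con: "connected_map (word_map n cs F)"
    and h: "bij_betw h (word_darts n F) (word_darts n F')"
    and rot: "\<And>d. d \<in> word_darts n F \<Longrightarrow> h (word_rot F d) = word_rot F' (h d)"
    and opp: "\<And>d. d \<in> word_darts n F \<Longrightarrow> h (word_opp n F d) = word_opp n F' (h d)"
    and d0: "d0 \<in> word_darts n F" "up_dart (h d0) = up_dart d0"
  shows "\<exists>\<tau>. \<tau> permutes {1..n} \<and> (\<forall>x\<in>{1..n}. h (x, 0, True) = (\<tau> x, 0, True)) \<and>
    (relabel \<tau> F, F') \<in> interchange\<^sup>*"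
proof -
  have inj: "inj_on h (word_darts n F)" using h by (rule bij_betw_imp_inj_on)
  have hin: "h d \<in> word_darts n F'" if "d \<in> word_darts n F" for d using bij_betwE[OF h] that by blast
  have keep_up: "d \<in> word_darts n F \<and> up_dart (h d) = up_dart d" if "(d0, d) \<in> (dart_steps (word_map n cs F))\<^sup>*" for d
    using that
  proof induction
    case base show ?case using d0 by blast
  next
    case (step d e)
    then have d: "d \<in> word_darts n F" "up_dart (h d) = up_dart d" by auto
    consider "e = word_rot F d" | "e = word_opp n F d" using step.hyps(2) unfolding dart_steps_def by auto
    then show ?case
    proof cases
      case 1
      show ?thesis
      proof (cases "word_rot F d = d")
        case False
        then have "word_rot F' (h d) \<noteq> h d"
          using rot[OF d(1)] inj_onD[OF inj _ word_rot_in[OF F d(1)] d(1)] by metis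
        then have "up_dart (h e) \<longleftrightarrow> \<not> up_dart (h d)" using word_rot_flip[OF F'] rot[OF d(1)] 1 by simp
        moreover have "up_dart e \<longleftrightarrow> \<not> up_dart d" using word_rot_flip[OF F False] 1 by simp
        ultimately show ?thesis using word_rot_in[OF F d(1)] d 1 by simp
      qed (use d 1 in simp)
    next
      case 2
      then show ?thesis
        using word_opp_in[OF d(1)] opp[OF d(1)] up_word_opp[OF d(1)] up_word_opp[OF hin[OF d(1)]] d by simp
    qed
  qed
  have up: "up_dart (h d) = up_dart d" if "d \<in> word_darts n F" for d
  proof -
    have "(d0, d) \<in> (dart_steps (word_map n cs F))\<^sup>*"
      using con d0(1) that unfolding connected_map_alt word_map_simps by blast
    then show ?thesis using keep_up by blast
  qed
  have D0: "(x, 0, True) \<in> word_darts n F" if "x \<in> {1..n}" for x using that by (simp add: word_darts_def)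
  have src: "\<exists>y\<in>{1..n}. h (x, 0, True) = (y, 0, True)" if x: "x \<in> {1..n}" for x
  proof -
    obtain y i b where e: "h (x, 0, True) = (y, i, b)" by (cases "h (x, 0, True)") auto
    have b: "b" using up[OF D0[OF x]] e by simp
    have yi: "(y, i, b) \<in> word_darts n F'" using hin[OF D0[OF x]] e by simp
    have "word_rot F' (y, i, b) = (y, i, b)"
      using rot[OF D0[OF x]] e word_rot_fixed[of True 0 F x] by simp
    then have "i = 0" using word_rot_fixed_iff[OF F' yi] b by simp
    then show ?thesis using e b yi by (auto simp: word_darts_def)
  qed
  define \<tau> where "\<tau> x = (if x \<in> {1..n} then fst (h (x, 0, True)) else x)" for x
  have \<tau>: "h (x, 0, True) = (\<tau> x, 0, True)" "\<tau> x \<in> {1..n}" if "x \<in> {1..n}" for x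
    using src[OF that] that by (auto simp: \<tau>_def)
  have "\<tau> permutes {1..n}"
  proof (rule bij_imp_permutes)
    have "inj_on \<tau> {1..n}"
    proof (rule inj_onI)
      fix x y assume xy: "x \<in> {1..n}" "y \<in> {1..n}" "\<tau> x = \<tau> y"
      then have "h (x, 0, True) = h (y, 0, True)" using \<tau>(1) by simp
      then show "x = y" using inj_onD[OF inj _ D0[OF xy(1)] D0[OF xy(2)]] by simp
    qed
    moreover have "\<tau> ` {1..n} \<subseteq> {1..n}" using \<tau>(2) by blast
    ultimately show "bij_betw \<tau> {1..n} {1..n}"
      unfolding bij_betw_def using endo_inj_surj[of "{1..n}" \<tau>] by blast
  qed (auto simp: \<tau>_def)
  moreover from this have "(relabel \<tau> F, F') \<in> interchange\<^sup>*"
    using word_map_iso_fixing_sources[OF F F' _ inj rot opp] \<tau>(1) by blast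
  ultimately show ?thesis using \<tau>(1) by blast
qed

text \<open>A connected map has no automorphism fixing a half-edge.\<close>

lemma relabel_rigid:
  assumes F: "cycle_word n F" and con: "connected_map (word_map n cs F)"
    and \<tau>: "\<tau> permutes {1..n}" and \<tau>': "\<tau>' permutes {1..n}"
    and eq: "(relabel \<tau> F, relabel \<tau>' F) \<in> interchange\<^sup>*" and x0: "x0 \<in> {1..n}" "\<tau> x0 = \<tau>' x0"
  shows "\<tau> = \<tau>'"
proof
  fix x
  show "\<tau> x = \<tau>' x"
  proof (cases "x \<in> {1..n}")
    case True
    \<comment> \<open>The rotations being equal, agreement of \<tau> and \<tau>' at a half-edge
      passes to its successors and spreads from line \<open>x0\<close> over the whole map.\<close>
    have "word_rot (relabel \<tau>' F) = word_rot (relabel \<tau> F)"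
      using interchanges_invariant[OF eq cycle_word_relabel[OF \<tau> F]] by blast
    then have rot: "apfst \<tau> (word_rot F d) = apfst \<tau>' (word_rot F d)" if "apfst \<tau> d = apfst \<tau>' d" for d
      using that word_rot_relabel[OF permutes_bij[OF \<tau>], of F d] word_rot_relabel[OF permutes_bij[OF \<tau>'], of F d]
      by metis
    have "apfst \<tau> d = apfst \<tau>' d" if "((x0, 0, True), d) \<in> (dart_steps (word_map n cs F))\<^sup>*" for d
      using that
    proof induction
      case base show ?case using x0 by simp
    next
      case (step d e)
      have "apfst \<tau> (word_opp n F d) = apfst \<tau>' (word_opp n F d)" using step.IH
        by (cases d) (auto simp: word_opp_def)
      moreover have "e = word_rot F d \<or> e = word_opp n F d" using step.hyps(2) by (simp add: dart_steps_def)
      ultimately show ?case using rot[OF step.IH] by metis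
    qed
    moreover have "((x0, 0, True), (x, 0, True)) \<in> (dart_steps (word_map n cs F))\<^sup>*"
      using con x0(1) True unfolding connected_map_alt by (simp add: word_darts_def)
    ultimately show ?thesis by (metis apfst_conv prod.inject)
  next
    case False then show ?thesis using \<tau> \<tau>' permutes_not_in by metis
  qed
qed

section \<open>Isomorphisms\<close>

definition rot_iso ::
    "('d \<Rightarrow> 'e) \<Rightarrow> ('d, 'y) rotation_system_scheme \<Rightarrow> ('e, 'z) rotation_system_scheme \<Rightarrow> bool" where
  "rot_iso h M M' \<longleftrightarrow> bij_betw h (darts M) (darts M') \<and>
     (\<forall>d\<in>darts M. h (rot M d) = rot M' (h d) \<and> h (opp M d) = opp M' (h d))"

text \<open>In contrast to \<^const>\<open>isomorphic\<close>, the two maps may have different types of half-edges.\<close>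

definition map_iso :: "('d \<Rightarrow> 'e) \<Rightarrow> 'd marked_map \<Rightarrow> 'e marked_map \<Rightarrow> bool" where
  "map_iso h M M' \<longleftrightarrow> rot_iso h M M' \<and>
     map (image h) (face_list M) = face_list M' \<and> h ` marked_leaf M = marked_leaf M'"

lemma isomorphic_iff: "isomorphic M M' \<longleftrightarrow> (\<exists>h. map_iso h M M')"
  unfolding isomorphic_def map_iso_def rot_iso_def by blast

lemma map_iso_trans:
  assumes "map_iso h M M'" "map_iso k M' M''"
  shows "map_iso (k \<circ> h) M M''"
proof -
  have "bij_betw h (darts M) (darts M')" "bij_betw k (darts M') (darts M'')"
    using assms unfolding map_iso_def rot_iso_def by auto
  then have "bij_betw (k \<circ> h) (darts M) (darts M'')" by (rule bij_betw_trans)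
  moreover have "h d \<in> darts M'" if "d \<in> darts M" for d
    using assms(1) that bij_betwE unfolding map_iso_def rot_iso_def by blast
  moreover have "map (image (k \<circ> h)) (face_list M) = face_list M''"
  proof -
    have "map (image (k \<circ> h)) (face_list M) = map (image k) (map (image h) (face_list M))"
      by (simp add: image_comp)
    then show ?thesis using assms unfolding map_iso_def by metis
  qed
  moreover have "(k \<circ> h) ` marked_leaf M = marked_leaf M''"
    unfolding image_comp[symmetric] using assms unfolding map_iso_def by metis
  ultimately show ?thesis using assms unfolding map_iso_def rot_iso_def by simp
qed

lemma parts_subset_darts:
  assumes "is_map M"
  shows "v \<in> vertices M \<Longrightarrow> v \<subseteq> darts M" "e \<in> edges M \<Longrightarrow> e \<subseteq> darts M"
    "f \<in> faces M \<Longrightarrow> f \<subseteq> darts M" "l \<in> leaves M \<Longrightarrow> l \<subseteq> darts M"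
proof -
  note rot = is_mapD(3)[OF assms] and opp = is_mapD(4)[OF assms]
  have "rot M \<circ> opp M permutes darts M" using permutes_compose[OF opp rot] .
  then show "f \<in> faces M \<Longrightarrow> f \<subseteq> darts M"
    unfolding faces_def using permutes_orbit_subset by fastforce
  show v: "v \<in> vertices M \<Longrightarrow> v \<subseteq> darts M" for v
    unfolding vertices_def vertex_at_def using permutes_orbit_subset[OF rot] by fastforce
  show "e \<in> edges M \<Longrightarrow> e \<subseteq> darts M"
    unfolding edges_def edge_of_def using permutes_in_image[OF opp] by auto
  show "l \<in> leaves M \<Longrightarrow> l \<subseteq> darts M" unfolding leaves_def using v by blast
qed

lemma map_iso_sym:
  assumes M: "is_marked_map M" and iso: "map_iso h M M'"
  shows "map_iso (inv_into (darts M) h) M' M"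
proof -
  let ?k = "inv_into (darts M) h"
  have m: "is_map M" using M unfolding is_marked_map_def by blast
  have bij: "bij_betw h (darts M) (darts M')"
    and h: "\<And>d. d \<in> darts M \<Longrightarrow> h (rot M d) = rot M' (h d)" "\<And>d. d \<in> darts M \<Longrightarrow> h (opp M d) = opp M' (h d)"
    using iso unfolding map_iso_def rot_iso_def by auto
  have inj: "inj_on h (darts M)" using bij by (rule bij_betw_imp_inj_on)
  have kh: "?k (h d) = d" if "d \<in> darts M" for d using inv_into_f_f[OF inj that] .
  have "?k (rot M' e) = rot M (?k e) \<and> ?k (opp M' e) = opp M (?k e)" if e: "e \<in> darts M'" for e
  proof -
    obtain d where d: "d \<in> darts M" "e = h d" using bij_betw_imp_surj_on[OF bij] e by blast
    then show ?thesis using kh h(1,2)[OF d(1), symmetric] is_mapD(10,11)[OF m d(1)] by simp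
  qed
  moreover have kim: "?k ` (h ` A) = A" if "A \<subseteq> darts M" for A
    using inv_into_image_cancel[OF inj that] .
  have "map (image ?k) (face_list M') = face_list M"
  proof -
    have "?k ` (h ` f) = f" if "f \<in> set (face_list M)" for f
    proof (rule kim)
      show "f \<subseteq> darts M" using M that parts_subset_darts(3)[OF m] unfolding is_marked_map_def by metis
    qed
    then have "map (image ?k) (map (image h) (face_list M)) = face_list M"
      by (simp add: map_idI)
    then show ?thesis using iso unfolding map_iso_def by simp
  qed
  moreover have "?k ` marked_leaf M' = marked_leaf M"
    using M parts_subset_darts(4)[OF m] kim[of "marked_leaf M"] iso
    unfolding is_marked_map_def map_iso_def by metis
  ultimately show ?thesis unfolding map_iso_def rot_iso_def using bij_betw_inv_into[OF bij] by blast
qed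

text \<open>The target is not presupposed to be a map, so this also proves that targets are maps.
  The hypotheses \<open>perm\<close> control its rotation off the half-edges, which an isomorphism
  cannot see.\<close>

lemma rot_iso_transfer:
  assumes M: "is_map M" and iso: "rot_iso h M M'"
    and perm: "rot M' permutes darts M'" "opp M' permutes darts M'"
  shows "vertices M' = image h ` vertices M" "edges M' = image h ` edges M"
    "faces M' = image h ` faces M" "is_map M'"
proof -
  have bij: "bij_betw h (darts M) (darts M')"
    and rot: "\<And>d. d \<in> darts M \<Longrightarrow> rot M' (h d) = h (rot M d)"
    and opp: "\<And>d. d \<in> darts M \<Longrightarrow> opp M' (h d) = h (opp M d)"
    using iso unfolding rot_iso_def by auto
  have img: "darts M' = h ` darts M" using bij_betw_imp_surj_on[OF bij] by simp
  have inj: "inj_on h (darts M)" using bij by (rule bij_betw_imp_inj_on)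
  have fin: "finite (darts M)" using is_mapD(1)[OF M] .
  have orb: "h ` orbit f d = orbit f' (h d)"
    if f: "f permutes darts M" "\<And>d. d \<in> darts M \<Longrightarrow> f' (h d) = h (f d)" and d: "d \<in> darts M" for f f' d
  proof (rule orbit_inverse)
    have "permutation f" using f(1) fin permutation_permutes by blast
    then show "d \<in> orbit f d" by (rule permutation_self_in_orbit)
    show "f' (h x) = h (f x)" if "x \<in> orbit f d" for x
      using f(2) permutes_orbit_subset[OF f(1) d] that by blast
  qed
  have "orbit (rot M') (h d) = h ` orbit (rot M) d" if "d \<in> darts M" for d
    using orb[OF is_mapD(3)[OF M] rot that] by simp
  then show "vertices M' = image h ` vertices M"
    unfolding vertices_def vertex_at_def img image_image by (intro image_cong) auto
  have "edge_of M' (h d) = h ` edge_of M d" if "d \<in> darts M" for d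
    using opp[OF that] unfolding edge_of_def by simp
  then show "edges M' = image h ` edges M"
    unfolding edges_def img image_image by (intro image_cong) auto
  have "orbit (rot M' \<circ> opp M') (h d) = h ` orbit (rot M \<circ> opp M) d" if "d \<in> darts M" for d
  proof (rule orb[symmetric, OF _ _ that])
    show "rot M \<circ> opp M permutes darts M" using permutes_compose is_mapD(3,4)[OF M] by blast
    show "(rot M' \<circ> opp M') (h d) = h ((rot M \<circ> opp M) d)" if "d \<in> darts M" for d
      using rot[OF is_mapD(10)[OF M that]] opp[OF that] by simp
  qed
  then show "faces M' = image h ` faces M"
    unfolding faces_def img image_image by (intro image_cong) auto
  have "connected_map M'" unfolding connected_map_def
  proof (intro ballI)
    fix a b assume "a \<in> darts M'" "b \<in> darts M'"
    then obtain d e where de: "d \<in> darts M" "e \<in> darts M" "a = h d" "b = h e" unfolding img by blast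
    have "(d, e) \<in> {(x, y). y = rot M x \<or> y = opp M x}\<^sup>*"
      using is_mapD(5)[OF M] de unfolding connected_map_def by blast
    then have "e \<in> darts M \<and> (h d, h e) \<in> {(x, y). y = rot M' x \<or> y = opp M' x}\<^sup>*"
    proof induction
      case (step y z)
      then have y: "y \<in> darts M" by blast
      then have "(h y, h z) \<in> {(x, y). y = rot M' x \<or> y = opp M' x}"
        using step.hyps(2) rot[OF y] opp[OF y] by auto
      moreover have "z \<in> darts M" using step.hyps(2) is_mapD(10,11)[OF M y] by auto
      ultimately show ?case using step.IH by (meson rtrancl_into_rtrancl)
    qed (use de in simp)
    then show "(a, b) \<in> {(x, y). y = rot M' x \<or> y = opp M' x}\<^sup>*" using de by blast
  qed
  moreover have "opp M' a \<noteq> a \<and> opp M' (opp M' a) = a" if a: "a \<in> darts M'" for a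
  proof -
    obtain d where d: "d \<in> darts M" "a = h d" using a unfolding img by blast
    have "h (opp M d) \<noteq> h d"
      using inj_onD[OF inj _ is_mapD(10)[OF M d(1)] d(1)] is_mapD(8)[OF M d(1)] by blast
    then show ?thesis
      using opp[OF d(1)] opp[OF is_mapD(10)[OF M d(1)]] is_mapD(9)[OF M d(1)] d(2) by simp
  qed
  ultimately show "is_map M'"
    unfolding is_map_def using perm fin is_mapD(2)[OF M] img by simp
qed

lemma map_iso_transfer:
  assumes M: "is_marked_map M" and iso: "map_iso h M M'"
    and perm: "rot M' permutes darts M'" "opp M' permutes darts M'"
  shows "is_marked_map M'" "genus_map g M' \<longleftrightarrow> genus_map g M"
    "leaves M' = image h ` leaves M"
    "f \<in> faces M \<Longrightarrow> card (leaves_in M' (h ` f)) = card (leaves_in M f)"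
    "card {v \<in> vertices M'. degree v = k} = card {v \<in> vertices M. degree v = k}"
    "\<forall>v\<in>vertices M. Q (v \<in> leaves M) (degree v) \<Longrightarrow> \<forall>v\<in>vertices M'. Q (v \<in> leaves M') (degree v)"
proof -
  have m: "is_map M" using M unfolding is_marked_map_def by blast
  have riso: "rot_iso h M M'" using iso unfolding map_iso_def by blast
  then have bij: "bij_betw h (darts M) (darts M')" unfolding rot_iso_def by blast
  have inj: "inj_on h (darts M)" using bij by (rule bij_betw_imp_inj_on)
  note transfer = rot_iso_transfer[OF m riso perm]
  note sub = parts_subset_darts[OF m]
  have inj_img: "inj_on (image h) S" if "\<And>A. A \<in> S \<Longrightarrow> A \<subseteq> darts M" for S
    using inj_on_subset[OF inj_on_image_Pow[OF inj]] that by blast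
  have eq_img: "h ` A = h ` B \<longleftrightarrow> A = B" if "A \<subseteq> darts M" "B \<subseteq> darts M" for A B
    using inj_on_image_eq_iff[OF inj that] .
  have deg: "degree (h ` v) = degree v" if "v \<in> vertices M" for v
    unfolding degree_def using sub(1)[OF that] inj by (meson card_image inj_on_subset)
  have cardV: "card (vertices M') = card (vertices M)" "card (edges M') = card (edges M)"
    "card (faces M') = card (faces M)"
    unfolding transfer(1-3) using inj_img sub by (metis card_image)+
  then show "genus_map g M' \<longleftrightarrow> genus_map g M" unfolding genus_map_def by simp
  show leaves: "leaves M' = image h ` leaves M"
    unfolding leaves_def transfer(1) using deg by auto
  have fl: "face_list M' = map (image h) (face_list M)" "marked_leaf M' = h ` marked_leaf M"
    using iso unfolding map_iso_def by auto
  show "is_marked_map M'"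
    using M inj_img[of "faces M"] sub(3)
    unfolding is_marked_map_def fl leaves transfer(3) by (auto simp: transfer(4) distinct_map)
  show "card (leaves_in M' (h ` f)) = card (leaves_in M f)" if f: "f \<in> faces M" for f
  proof -
    have "h ` v \<inter> h ` f \<noteq> {} \<longleftrightarrow> v \<inter> f \<noteq> {}" if "v \<in> leaves M" for v
      using inj_on_image_Int[OF inj sub(4)[OF that] sub(3)[OF f]] by auto
    then have "leaves_in M' (h ` f) = image h ` leaves_in M f"
      unfolding leaves_in_def leaves by auto
    moreover have "inj_on (image h) (leaves_in M f)"
      using sub(4) by (intro inj_img) (auto simp: leaves_in_def)
    ultimately show ?thesis by (simp add: card_image)
  qed
  have "{v \<in> vertices M'. degree v = k} = image h ` {v \<in> vertices M. degree v = k}"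
    unfolding transfer(1) using deg by auto
  moreover have "inj_on (image h) {v \<in> vertices M. degree v = k}" using sub(1) by (intro inj_img) auto
  ultimately show "card {v \<in> vertices M'. degree v = k} = card {v \<in> vertices M. degree v = k}"
    by (simp add: card_image)
  have "h ` v \<in> leaves M' \<longleftrightarrow> v \<in> leaves M" if v: "v \<in> vertices M" for v
  proof
    assume "h ` v \<in> leaves M'"
    then obtain w where "w \<in> leaves M" "h ` v = h ` w" unfolding leaves by blast
    then show "v \<in> leaves M" using eq_img[OF sub(1)[OF v] sub(4)] by blast
  qed (auto simp: leaves)
  then show "\<forall>v\<in>vertices M'. Q (v \<in> leaves M') (degree v)" if "\<forall>v\<in>vertices M. Q (v \<in> leaves M) (degree v)"
    using that deg unfolding transfer(1) by auto
qed

text \<open>Conditions (a) to (d), which are transferred along isomorphisms. Condition (e) is kept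
  apart, since it is always derived afresh from an orientation with a rank.\<close>

definition shape :: "nat list \<Rightarrow> (nat \<Rightarrow> nat) \<Rightarrow> 'd marked_map \<Rightarrow> bool" where
  "shape \<alpha> \<beta> M \<longleftrightarrow>
     length (face_list M) = length \<alpha> \<and>
     (\<forall>v\<in>vertices M. v \<in> leaves M \<or> (even (degree v) \<and> degree v \<ge> 4)) \<and>
     (\<forall>i<length \<alpha>. card (leaves_in M (face_list M ! i)) = 2 * \<alpha> ! i) \<and>
     marked_leaf M \<in> leaves_in M (face_list M ! 0) \<and>
     (\<forall>k\<ge>2. card {v \<in> vertices M. degree v = 2 * k} = \<beta> k)"

lemma admissible_iff:
  "admissible \<alpha> \<beta> M \<longleftrightarrow> shape \<alpha> \<beta> M \<and> (\<forall>W. cycle_in M W \<longrightarrow> odd_corners M W > 0 \<and> even (odd_corners M W))"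
  unfolding admissible_def shape_def by blast

lemma shape_transfer:
  assumes M: "is_marked_map M" and iso: "map_iso h M M'"
    and perm: "rot M' permutes darts M'" "opp M' permutes darts M'"
    and \<alpha>: "\<alpha> \<noteq> []" and shape: "shape \<alpha> \<beta> M"
  shows "shape \<alpha> \<beta> M'"
proof -
  note transfer = map_iso_transfer[OF M iso perm]
  have fl: "face_list M' = map (image h) (face_list M)" "marked_leaf M' = h ` marked_leaf M"
    using iso unfolding map_iso_def by auto
  have len: "length (face_list M) = length \<alpha>" using shape unfolding shape_def by blast
  have "face_list M ! i \<in> faces M" if "i < length \<alpha>" for i
    using M that len nth_mem unfolding is_marked_map_def by metis
  then have "card (leaves_in M' (face_list M' ! i)) = 2 * \<alpha> ! i" if "i < length \<alpha>" for i
    using that transfer(4) shape len unfolding shape_def fl(1) by simp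
  moreover have "marked_leaf M' \<in> leaves_in M' (face_list M' ! 0)"
  proof -
    have l: "marked_leaf M \<in> leaves M" "marked_leaf M \<inter> face_list M ! 0 \<noteq> {}"
      using shape unfolding shape_def leaves_in_def by blast+
    then have "h ` marked_leaf M \<inter> h ` (face_list M ! 0) \<noteq> {}" by blast
    then show ?thesis using l(1) \<alpha> len unfolding leaves_in_def transfer(3) fl by auto
  qed
  moreover have "\<forall>v\<in>vertices M'. v \<in> leaves M' \<or> (even (degree v) \<and> degree v \<ge> 4)"
    by (rule transfer(6)[where Q = "\<lambda>l k. l \<or> (even k \<and> k \<ge> 4)"]) (use shape in \<open>auto simp: shape_def\<close>)
  ultimately show ?thesis using shape len unfolding shape_def transfer(5) by (simp add: fl)
qed

text \<open>Word maps have triples as half-edges, whereas the isomorphism classes to be counted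
  consist of maps on natural numbers.\<close>

lemma nat_copy:
  fixes M :: "'d :: countable marked_map"
  assumes M: "is_marked_map M"
  obtains N :: "nat marked_map" and h where "map_iso h M N"
    "rot N permutes darts N" "opp N permutes darts N"
proof -
  have m: "is_map M" using M unfolding is_marked_map_def by blast
  let ?h = "to_nat :: 'd \<Rightarrow> nat"
  have bij: "bij_betw ?h (darts M) (?h ` darts M)" by (auto simp: bij_betw_def inj_on_def)
  have inj: "inj_on ?h (darts M)" using bij by (rule bij_betw_imp_inj_on)
  define N where "N = \<lparr>darts = ?h ` darts M, rot = map_permutation (darts M) ?h (rot M),
    opp = map_permutation (darts M) ?h (opp M),
    face_list = map (image ?h) (face_list M), marked_leaf = ?h ` marked_leaf M\<rparr>"
  have "map_iso ?h M N"
    unfolding map_iso_def rot_iso_def N_def using bij map_permutation_apply[OF inj] by simp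
  moreover have "rot N permutes darts N" "opp N permutes darts N"
    unfolding N_def using map_permutation_permutes[OF bij] is_mapD(3,4)[OF m] by auto
  ultimately show thesis using that by blast
qed

section \<open>Counting conjugations\<close>

definition cycle_reps :: "nat \<Rightarrow> (nat \<Rightarrow> nat) \<Rightarrow> nat list \<Rightarrow> nat list \<Rightarrow> bool" where
  "cycle_reps n \<rho> xs \<alpha> \<longleftrightarrow> length xs = length \<alpha> \<and>
     (\<forall>i<length \<alpha>. xs ! i \<in> {1..n} \<and> card (orbit \<rho> (xs ! i)) = \<alpha> ! i) \<and>
     (\<forall>i<length \<alpha>. \<forall>j<length \<alpha>. orbit \<rho> (xs ! i) = orbit \<rho> (xs ! j) \<longrightarrow> i = j) \<and>
     (\<forall>x\<in>{1..n}. \<exists>i<length \<alpha>. x \<in> orbit \<rho> (xs ! i))"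

text \<open>Lifts the order of the parts of \<alpha> to an order of the cycles having these
  sizes.\<close>

lemma image_mset_eq_mset:
  "image_mset f A = mset ys \<Longrightarrow> \<exists>xs. mset xs = A \<and> map f xs = ys"
proof (induction ys arbitrary: A)
  case (Cons y ys)
  then obtain B x where B: "A = add_mset x B" "f x = y" "image_mset f B = mset ys"
    using msed_map_invR[of f A y "mset ys"] by auto
  then obtain xs where "mset xs = B" "map f xs = ys" using Cons.IH by blast
  then show ?case using B by (intro exI[where x = "x # xs"]) simp
qed simp

lemma cycle_reps_exist:
  assumes \<pi>: "\<pi> permutes {1..n}" and type: "cycle_type n \<pi> = mset \<alpha>"
  shows "\<exists>xs. cycle_reps n \<pi> xs \<alpha>"
proof -
  let ?C = "perm_cycles n \<pi>"
  have perm: "permutation \<pi>" using \<pi> permutation_permutes by blast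
  have fin: "finite ?C" unfolding perm_cycles_def by simp
  obtain Cs where Cs: "mset Cs = mset_set ?C" "map card Cs = \<alpha>"
    using image_mset_eq_mset type unfolding cycle_type_def by blast
  have set: "set Cs = ?C" using Cs(1) fin by (metis finite_set_mset_mset_set set_mset_mset)
  have "length Cs = card ?C" using Cs(1) by (metis size_mset size_mset_set)
  then have dist: "distinct Cs" using set by (metis card_distinct)
  have len: "length Cs = length \<alpha>" using Cs(2) by auto
  define xs where "xs = map (\<lambda>C. SOME c. c \<in> {1..n} \<and> orbit \<pi> c = C) Cs"
  have xs: "xs ! i \<in> {1..n} \<and> orbit \<pi> (xs ! i) = Cs ! i" if "i < length \<alpha>" for i
  proof -
    have "Cs ! i \<in> ?C" using that len set nth_mem by metis
    then have ex: "\<exists>c. c \<in> {1..n} \<and> orbit \<pi> c = Cs ! i" unfolding perm_cycles_def by blast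
    have "xs ! i = (SOME c. c \<in> {1..n} \<and> orbit \<pi> c = Cs ! i)" using that len by (simp add: xs_def)
    then show ?thesis using someI_ex[OF ex] by metis
  qed
  have "card (orbit \<pi> (xs ! i)) = \<alpha> ! i" if "i < length \<alpha>" for i
  proof -
    have "card (Cs ! i) = \<alpha> ! i" using Cs(2) that len nth_map by metis
    then show ?thesis using xs[OF that] by simp
  qed
  moreover have "i = j" if "i < length \<alpha>" "j < length \<alpha>" "orbit \<pi> (xs ! i) = orbit \<pi> (xs ! j)" for i j
    using xs that dist len nth_eq_iff_index_eq by metis
  moreover have "\<exists>i<length \<alpha>. x \<in> orbit \<pi> (xs ! i)" if "x \<in> {1..n}" for x
  proof -
    have "orbit \<pi> x \<in> set Cs" using that set unfolding perm_cycles_def by blast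
    then obtain i where "i < length \<alpha>" "Cs ! i = orbit \<pi> x" using len by (metis in_set_conv_nth)
    then show ?thesis using xs permutation_self_in_orbit[OF perm, of x] by metis
  qed
  moreover have "length xs = length \<alpha>" using len by (simp add: xs_def)
  ultimately show ?thesis unfolding cycle_reps_def using xs by (intro exI[where x = xs]) simp
qed

text \<open>Respecting face labels means sending the cycle of each \<open>xs ! i\<close> to that of
  \<open>cs ! i\<close>; the distinguished leaf fixes the image of \<open>xs ! 0\<close>
  exactly.\<close>

definition conjugators ::
    "nat \<Rightarrow> (nat \<Rightarrow> nat) \<Rightarrow> nat list \<Rightarrow> (nat \<Rightarrow> nat) \<Rightarrow> nat list \<Rightarrow> (nat \<Rightarrow> nat) set" where
  "conjugators n \<rho> xs \<pi> cs = {\<tau>. \<tau> permutes {1..n} \<and> \<tau> \<circ> \<rho> = \<pi> \<circ> \<tau> \<and> \<tau> (xs ! 0) = cs ! 0 \<and>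
     (\<forall>i<length xs. \<tau> (xs ! i) \<in> orbit \<pi> (cs ! i))}"

text \<open>An intertwiner is determined by its values at the representatives. Any values on the
  right cycles extend, because corresponding cycles have equal lengths; only position 0 leaves no
  choice.\<close>

lemma card_conjugators:
  assumes \<rho>: "\<rho> permutes {1..n}" and xs: "cycle_reps n \<rho> xs \<alpha>"
    and \<pi>: "\<pi> permutes {1..n}" and cs: "cycle_reps n \<pi> cs \<alpha>" and \<alpha>: "\<alpha> \<noteq> []"
  shows "card (conjugators n \<rho> xs \<pi> cs) = (\<Prod>i=2..length \<alpha>. \<alpha> ! (i - 1))"
proof -
  let ?m = "length \<alpha>" and ?T = "conjugators n \<rho> xs \<pi> cs"
  let ?E = "PiE {1..<?m} (\<lambda>i. orbit \<pi> (cs ! i))"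
  let ?\<Theta> = "\<lambda>\<tau>. \<lambda>i\<in>{1..<?m}. \<tau> (xs ! i)"
  have p\<rho>: "permutation \<rho>" and p\<pi>: "permutation \<pi>" using \<rho> \<pi> permutation_permutes by blast+
  have len: "length xs = ?m" "length cs = ?m" using xs cs unfolding cycle_reps_def by auto
  have m: "0 < ?m" using \<alpha> by simp
  have X: "xs ! i \<in> {1..n}" "card (orbit \<rho> (xs ! i)) = \<alpha> ! i" if "i < ?m" for i
    using xs that unfolding cycle_reps_def by blast+
  have C: "cs ! i \<in> {1..n}" "card (orbit \<pi> (cs ! i)) = \<alpha> ! i" if "i < ?m" for i
    using cs that unfolding cycle_reps_def by blast+
  have Xcov: "\<exists>i k. i < ?m \<and> x = (\<rho> ^^ k) (xs ! i)" if x: "x \<in> {1..n}" for x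
  proof -
    obtain i where "i < ?m" "x \<in> orbit \<rho> (xs ! i)" using xs x unfolding cycle_reps_def by blast
    then show ?thesis using orbit_altdef_permutation[OF p\<rho>] by blast
  qed
  have intertwine: "\<tau> ((\<rho> ^^ k) y) = (\<pi> ^^ k) (\<tau> y)" if "\<tau> \<circ> \<rho> = \<pi> \<circ> \<tau>" for \<tau> k y
    by (induction k) (use fun_cong[OF that] in auto)
  have "inj_on ?\<Theta> ?T"
  proof (rule inj_onI)
    fix \<tau> \<tau>' assume T: "\<tau> \<in> ?T" "\<tau>' \<in> ?T" and eq: "?\<Theta> \<tau> = ?\<Theta> \<tau>'"
    have base: "\<tau> (xs ! i) = \<tau>' (xs ! i)" if "i < ?m" for i
    proof (cases "i = 0")
      case True then show ?thesis using T unfolding conjugators_def by simp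
    next
      case False
      then have "i \<in> {1..<?m}" using that by simp
      then show ?thesis using fun_cong[OF eq, of i] by simp
    qed
    have "\<tau> x = \<tau>' x" for x
    proof (cases "x \<in> {1..n}")
      case True
      then obtain i k where ik: "i < ?m" "x = (\<rho> ^^ k) (xs ! i)" using Xcov by blast
      have c: "\<tau> \<circ> \<rho> = \<pi> \<circ> \<tau>" "\<tau>' \<circ> \<rho> = \<pi> \<circ> \<tau>'" using T unfolding conjugators_def by blast+
      show ?thesis
        unfolding ik(2) intertwine[OF c(1)] intertwine[OF c(2)] base[OF ik(1)] ..
    next
      case False
      moreover have "\<tau> permutes {1..n}" "\<tau>' permutes {1..n}" using T unfolding conjugators_def by blast+
      ultimately show ?thesis using permutes_not_in by metis
    qed
    then show "\<tau> = \<tau>'" by blast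
  qed
  moreover have "?\<Theta> ` ?T = ?E"
  proof (intro equalityI subsetI)
    fix f assume "f \<in> ?\<Theta> ` ?T"
    then show "f \<in> ?E" unfolding conjugators_def using len by auto
  next
    fix f assume f: "f \<in> ?E"
    define y where "y i = (if i = 0 then cs ! 0 else f i)" for i
    have y: "y i \<in> orbit \<pi> (cs ! i)" if "i < ?m" for i
      using f that permutation_self_in_orbit[OF p\<pi>] by (auto simp: y_def PiE_iff)
    have y_orb: "orbit \<pi> (y i) = orbit \<pi> (cs ! i)" if "i < ?m" for i
      using orbit_eq_orbit[OF p\<pi> y[OF that]] .
    have y_in: "y i \<in> {1..n}" if "i < ?m" for i
      using permutes_orbit_subset[OF \<pi> C(1)[OF that]] y[OF that] by blast
    \<comment> \<open>Any expression of x as a power applied to a representative will do: the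
      representative is unique, and the exponent is unique modulo the common cycle length.\<close>
    define \<tau> where "\<tau> x = (if x \<in> {1..n}
      then (let (i, k) = (SOME (i, k). i < ?m \<and> x = (\<rho> ^^ k) (xs ! i)) in (\<pi> ^^ k) (y i)) else x)" for x
    have pow_in: "(\<rho> ^^ k) x \<in> {1..n}" if "x \<in> {1..n}" for k x
      using that permutes_in_image[OF permutes_funpow[OF \<rho>]] by blast
    have pow_in': "(\<pi> ^^ k) x \<in> {1..n}" if "x \<in> {1..n}" for k x
      using that permutes_in_image[OF permutes_funpow[OF \<pi>]] by blast
    have \<tau>: "\<tau> ((\<rho> ^^ k) (xs ! i)) = (\<pi> ^^ k) (y i)" if i: "i < ?m" for i k
    proof -
      let ?x = "(\<rho> ^^ k) (xs ! i)"
      let ?P = "\<lambda>(j, l). j < ?m \<and> ?x = (\<rho> ^^ l) (xs ! j)"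
      have "?P (i, k)" using i by simp
      then have "?P (SOME p. ?P p)" by (rule someI)
      then obtain j l where jl: "(SOME p. ?P p) = (j, l)" "j < ?m" "?x = (\<rho> ^^ l) (xs ! j)"
        by (cases "SOME p. ?P p") auto
      have "?x \<in> orbit \<rho> (xs ! i)" "?x \<in> orbit \<rho> (xs ! j)"
        using jl(3) orbit_altdef_permutation[OF p\<rho>] by blast+
      then have "orbit \<rho> (xs ! i) = orbit \<rho> (xs ! j)" using orbit_eq_orbit[OF p\<rho>] by metis
      then have j: "j = i" using xs i jl(2) unfolding cycle_reps_def by blast
      then have "k mod card (orbit \<rho> (xs ! i)) = l mod card (orbit \<rho> (xs ! i))"
        using jl(3) funpow_eq_iff[OF p\<rho>] by simp
      then have "k mod card (orbit \<pi> (y i)) = l mod card (orbit \<pi> (y i))"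
        using X(2)[OF i] C(2)[OF i] y_orb[OF i] by simp
      then have "(\<pi> ^^ l) (y i) = (\<pi> ^^ k) (y i)" using funpow_eq_iff[OF p\<pi>] by metis
      then show ?thesis using pow_in[OF X(1)[OF i]] jl(1) j by (simp add: \<tau>_def)
    qed
    have \<tau>0: "\<tau> (xs ! i) = y i" if "i < ?m" for i using \<tau>[OF that, of 0] by simp
    have surj: "\<tau> ` {1..n} = {1..n}"
    proof (intro equalityI subsetI)
      fix z assume "z \<in> \<tau> ` {1..n}"
      then obtain x where "x \<in> {1..n}" "z = \<tau> x" by blast
      then show "z \<in> {1..n}" using Xcov[of x] \<tau> y_in pow_in' by metis
    next
      fix z assume "z \<in> {1..n}"
      then obtain i where i: "i < ?m" "z \<in> orbit \<pi> (cs ! i)" using cs unfolding cycle_reps_def by blast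
      then obtain k where "z = (\<pi> ^^ k) (y i)"
        using y_orb[OF i(1)] orbit_altdef_permutation[OF p\<pi>, of "y i"] by blast
      then have "z = \<tau> ((\<rho> ^^ k) (xs ! i))" using \<tau>[OF i(1)] by simp
      then show "z \<in> \<tau> ` {1..n}" using pow_in[OF X(1)[OF i(1)]] by blast
    qed
    then have "inj_on \<tau> {1..n}" by (intro eq_card_imp_inj_on) auto
    then have "\<tau> permutes {1..n}"
      using surj by (intro bij_imp_permutes) (auto simp: bij_betw_def \<tau>_def)
    moreover have "\<tau> \<circ> \<rho> = \<pi> \<circ> \<tau>"
    proof
      fix x
      show "(\<tau> \<circ> \<rho>) x = (\<pi> \<circ> \<tau>) x"
      proof (cases "x \<in> {1..n}")
        case True
        then obtain i k where ik: "i < ?m" "x = (\<rho> ^^ k) (xs ! i)" using Xcov by blast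
        then have "\<rho> x = (\<rho> ^^ Suc k) (xs ! i)" by simp
        then have 1: "\<tau> (\<rho> x) = (\<pi> ^^ Suc k) (y i)" using \<tau>[OF ik(1)] by metis
        have 2: "\<tau> x = (\<pi> ^^ k) (y i)" unfolding ik(2) by (rule \<tau>[OF ik(1)])
        show ?thesis unfolding comp_apply 1 2 by simp
      next
        case False
        then have "\<rho> x = x" "\<pi> x = x" using \<rho> \<pi> permutes_not_in by metis+
        moreover have "\<tau> x = x" unfolding \<tau>_def by (rule if_not_P[OF False])
        ultimately show ?thesis by simp
      qed
    qed
    ultimately have "\<tau> \<in> ?T" unfolding conjugators_def using \<tau>0 y m len by (auto simp: y_def)
    moreover have "?\<Theta> \<tau> = f"
    proof
      fix i show "?\<Theta> \<tau> i = f i"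
        using f \<tau>0[of i] by (cases "i \<in> {1..<?m}") (auto simp: y_def PiE_iff extensional_def)
    qed
    ultimately show "f \<in> ?\<Theta> ` ?T" by blast
  qed
  ultimately have "card ?T = card ?E" by (metis card_image)
  also have "\<dots> = (\<Prod>i\<in>{1..<?m}. card (orbit \<pi> (cs ! i)))" by (simp add: card_PiE)
  also have "\<dots> = (\<Prod>i\<in>{1..<?m}. \<alpha> ! i)" using C(2) by (intro prod.cong) auto
  \<comment> \<open>Passage from list positions counted from 0 to part numbers counted from
    1.\<close>
  also have "\<dots> = (\<Prod>i=2..?m. \<alpha> ! (i - 1))"
    by (rule prod.reindex_bij_witness[of _ "\<lambda>i. i - 1" Suc]) auto
  finally show ?thesis .
qed

section \<open>The correspondence\<close>

lemma cycle_repsD: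
  assumes "cycle_reps n \<rho> xs \<alpha>"
  shows "length xs = length \<alpha>"
    "i < length \<alpha> \<Longrightarrow> xs ! i \<in> {1..n}"
    "i < length \<alpha> \<Longrightarrow> card (orbit \<rho> (xs ! i)) = \<alpha> ! i"
    "i < length \<alpha> \<Longrightarrow> j < length \<alpha> \<Longrightarrow> orbit \<rho> (xs ! i) = orbit \<rho> (xs ! j) \<Longrightarrow> i = j"
    "x \<in> {1..n} \<Longrightarrow> \<exists>i<length \<alpha>. x \<in> orbit \<rho> (xs ! i)"
  using assms unfolding cycle_reps_def by blast+

lemma genus_factorization_iff:
  "genus_factorization n \<pi> g F \<longleftrightarrow>
     cycle_word n F \<and> word_prod F = \<pi> \<and> transitive n F \<and> genus_map g (word_map n cs F)"
proof -
  have "cycle_factorization n \<pi> F \<longleftrightarrow> cycle_word n F \<and> word_prod F = \<pi>"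
    unfolding cycle_factorization_def word_prod_def ex_k_cycle_iff ..
  then show ?thesis unfolding genus_factorization_def using genus_word_map_iff by blast
qed

lemma card_inner_vertices_word_map:
  assumes F: "cycle_word n F" and k: "2 \<le> k"
  shows "card {v \<in> vertices (word_map n cs F). degree v = 2 * k} = signature n F k"
proof -
  have "{v \<in> vertices (word_map n cs F). degree v = 2 * k} = {v \<in> inner_vertices F. card v = 2 * k}"
    unfolding vertices_word_map[OF F] degree_def using k by auto
  then show ?thesis using inner_vertices_facts(4)[OF F k] by simp
qed

lemma word_map_marked_map:
  assumes F: "cycle_word n F" and tr: "transitive n F" and n: "1 \<le> n"
    and cs: "cycle_reps n (word_prod F) cs \<alpha>" and \<alpha>: "\<alpha> \<noteq> []"
  shows "is_marked_map (word_map n cs F)"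
    and "(\<And>k. 2 \<le> k \<Longrightarrow> signature n F k = \<beta> k) \<Longrightarrow> shape \<alpha> \<beta> (word_map n cs F)"
proof -
  let ?M = "word_map n cs F" and ?\<pi> = "word_prod F"
  let ?face = "\<lambda>c. orbit (face_rot n F) (c, 0, True)"
  note len = cycle_repsD(1)[OF cs] and in_n = cycle_repsD(2)[OF cs]
  have \<pi>: "permutation ?\<pi>" using word_prod_permutes[OF F] permutation_permutes by blast
  have m: "0 < length \<alpha>" using \<alpha> by simp
  have face: "?face c = {e \<in> word_darts n F. face_label F e \<in> orbit ?\<pi> c}" if "c \<in> {1..n}" for c
    using orbit_face_rot_source[OF F that] .
  have face_inj: "i = j" if ij: "i < length \<alpha>" "j < length \<alpha>" and eq: "?face (cs ! i) = ?face (cs ! j)" for i j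
  proof -
    have "(cs ! i, 0, False) \<in> ?face (cs ! i)"
      unfolding face[OF in_n[OF ij(1)]] using in_n[OF ij(1)] permutation_self_in_orbit[OF \<pi>]
      by (simp add: face_label_def word_darts_def)
    then have "cs ! i \<in> orbit ?\<pi> (cs ! j)"
      unfolding eq unfolding face[OF in_n[OF ij(2)]] by (simp add: face_label_def)
    then show ?thesis using orbit_eq_orbit[OF \<pi>] cycle_repsD(4)[OF cs ij] by blast
  qed
  have "distinct (face_list ?M)"
    unfolding distinct_conv_nth
  proof (intro allI impI)
    fix i j assume "i < length (face_list ?M)" "j < length (face_list ?M)" "i \<noteq> j"
    then show "face_list ?M ! i \<noteq> face_list ?M ! j" using face_inj[of i j] len by auto
  qed
  moreover have "set (face_list ?M) = faces ?M"
  proof -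
    have "?face c \<in> ?face ` set cs" if c: "c \<in> {1..n}" for c
    proof -
      obtain i where i: "i < length \<alpha>" "c \<in> orbit ?\<pi> (cs ! i)" using cycle_repsD(5)[OF cs c] by blast
      then have "orbit ?\<pi> c = orbit ?\<pi> (cs ! i)" using orbit_eq_orbit[OF \<pi>] by blast
      then have "?face c = ?face (cs ! i)" using face[OF c] face[OF in_n[OF i(1)]] by simp
      then show ?thesis using i(1) len by simp
    qed
    moreover have "set cs \<subseteq> {1..n}" using in_n len by (metis in_set_conv_nth subsetI)
    ultimately show ?thesis unfolding faces_word_map(1)[OF F] by auto
  qed
  moreover have lf: "marked_leaf ?M \<in> leaves ?M"
    unfolding leaves_word_map[OF F] using in_n[OF m] by (simp add: leaf_darts_def)
  ultimately show "is_marked_map ?M"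
    unfolding is_marked_map_def using is_map_word_map_iff[OF F n] tr by blast
  have "\<forall>v\<in>vertices ?M. v \<in> leaves ?M \<or> even (degree v) \<and> 4 \<le> degree v"
    using inner_vertices_facts(3)[OF F] unfolding vertices_word_map[OF F] leaves_word_map[OF F] degree_def by blast
  moreover have "card (leaves_in ?M (face_list ?M ! i)) = 2 * \<alpha> ! i" if "i < length \<alpha>" for i
    using card_leaves_in_word_map[OF F in_n[OF that], of cs] cycle_repsD(3)[OF cs that] that len by simp
  moreover have "marked_leaf ?M \<in> leaves_in ?M (face_list ?M ! 0)"
    using lf m len permutation_self_in_orbit[OF face_rot_permutation[OF F]]
    unfolding leaves_in_def by simp
  ultimately show "shape \<alpha> \<beta> ?M" if "\<And>k. 2 \<le> k \<Longrightarrow> signature n F k = \<beta> k"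
    unfolding shape_def using card_inner_vertices_word_map[OF F] that len by simp
qed

text \<open>Direction and rank are pulled back along h, and their existence gives condition
  (e).\<close>

lemma admissible_if_iso_word_map:
  assumes M: "is_map M" and F: "cycle_word n F" and iso: "map_iso h M (word_map n cs F)"
    and shape: "shape \<alpha> \<beta> M"
  shows "admissible \<alpha> \<beta> M"
proof -
  have bij: "bij_betw h (darts M) (word_darts n F)"
    and h: "\<And>d. d \<in> darts M \<Longrightarrow> h (rot M d) = word_rot F (h d)" "\<And>d. d \<in> darts M \<Longrightarrow> h (opp M d) = word_opp n F (h d)"
    using iso unfolding map_iso_def rot_iso_def by auto
  have hin: "h d \<in> word_darts n F" if "d \<in> darts M" for d using bij_betwE[OF bij] that by blast
  have inj: "inj_on h (darts M)" using bij by (rule bij_betw_imp_inj_on)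
  let ?up = "\<lambda>d. up_dart (h d)"
  have alt: "alternating M ?up" unfolding alternating_def
  proof (intro ballI impI)
    fix d assume d: "d \<in> darts M" "rot M d \<noteq> d"
    then have "h (rot M d) \<noteq> h d" using inj_onD[OF inj _ is_mapD(11)[OF M d(1)] d(1)] by blast
    then show "?up (rot M d) \<noteq> ?up d" using word_rot_flip[OF F, of "h d"] h(1)[OF d(1)] by simp
  qed
  have opp: "?up (opp M d) \<noteq> ?up d" if "d \<in> darts M" for d
    using up_word_opp[OF hin[OF that]] h(2)[OF that] by simp
  obtain rk :: "dart \<Rightarrow> nat" where rk: "\<And>d. d \<in> word_darts n F \<Longrightarrow> rk (word_rot F d) = rk d"
    "\<And>d. d \<in> word_darts n F \<Longrightarrow> up_dart d \<Longrightarrow> rk d < rk (word_opp n F d)"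
    using word_map_rank[OF F] by blast
  have "0 < odd_corners M W \<and> even (odd_corners M W)" if "cycle_in M W" for W
  proof (rule oriented_cycle_corners[OF M alt opp _ _ that, where rk = "\<lambda>d. rk (h d)"])
    show "rk (h (rot M d)) = rk (h d)" if "d \<in> darts M" for d using h(1)[OF that] rk(1)[OF hin[OF that]] by simp
    show "rk (h d) < rk (h (opp M d))" if "d \<in> darts M" "?up d" for d
      using h(2)[OF that(1)] rk(2)[OF hin[OF that(1)] that(2)] by simp
  qed
  then show ?thesis using shape unfolding admissible_iff by blast
qed

section \<open>Reading an admissible map as a list of cycles\<close>

lemma oriented_from_leaf:
  assumes M: "is_map M" and adm: "admissible \<alpha> \<beta> M" and d0: "d0 \<in> darts M"
  obtains up and rk :: "'d \<Rightarrow> nat" where "alternating M up" "\<And>d. d \<in> darts M \<Longrightarrow> up (opp M d) \<noteq> up d"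
    "up d0" "\<And>d. d \<in> darts M \<Longrightarrow> rk (rot M d) = rk d" "\<And>d. d \<in> darts M \<Longrightarrow> up d \<Longrightarrow> rk d < rk (opp M d)"
proof -
  have corners: "0 < odd_corners M W" "even (odd_corners M W)" if "cycle_in M W" for W
    using adm that unfolding admissible_def by blast+
  obtain s where s: "alternating M s"
    using alternating_exists[OF M] adm unfolding admissible_def by blast
  obtain up where up: "alternating M up" "\<And>d. d \<in> darts M \<Longrightarrow> up (opp M d) \<noteq> up d"
    using orientation_exists[OF M s] corners(2) by blast
  \<comment> \<open>Reverses everything if necessary so that d0 points upwards; the rank is taken
    afterwards, as it depends on the direction.\<close>
  define up' where "up' d \<longleftrightarrow> (up d \<longleftrightarrow> up d0)" for d
  have up': "alternating M up'" "\<And>d. d \<in> darts M \<Longrightarrow> up' (opp M d) \<noteq> up' d" "up' d0"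
    using up unfolding up'_def alternating_def by auto
  then obtain rk :: "'d \<Rightarrow> nat" where "\<forall>d\<in>darts M. rk (rot M d) = rk d \<and> (up' d \<longrightarrow> rk d < rk (opp M d))"
    using rank_exists[OF M up'(1,2)] corners(1) by blast
  then show thesis using that[of up' rk] up' by blast
qed

lemma admissible_map_of_word:
  fixes M :: "'d marked_map"
  assumes M: "is_marked_map M" and adm: "admissible \<alpha> \<beta> M" and \<alpha>: "\<alpha> \<noteq> []" and n: "sum_list \<alpha> = n"
  shows "\<exists>G xs h. cycle_word n G \<and> cycle_reps n (word_prod G) xs \<alpha> \<and> map_iso h M (word_map n xs G)"
proof -
  have m: "is_map M" using M unfolding is_marked_map_def by blast
  have perm: "permutation (rot M)" using is_mapD(6)[OF m] .
  have len: "length (face_list M) = length \<alpha>" using adm unfolding admissible_def by blast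
  have m0: "0 < length \<alpha>" using \<alpha> by simp
  obtain d0 where d0: "d0 \<in> darts M" "marked_leaf M = {d0}" "rot M d0 = d0"
  proof -
    have "marked_leaf M \<in> leaves M" using M unfolding is_marked_map_def by blast
    then obtain d where d: "d \<in> darts M" "marked_leaf M = orbit (rot M) d" "card (marked_leaf M) = 1"
      unfolding leaves_def vertices_def vertex_at_def degree_def by blast
    then have "marked_leaf M = {d}"
      using permutation_self_in_orbit[OF perm, of d] by (metis card_1_singletonE singletonD)
    moreover from this have "rot M d = d" using d(2) orbit_eq_singleton_iff by metis
    ultimately show thesis using that d(1) by blast
  qed
  obtain up and rk :: "'d \<Rightarrow> nat" where up: "alternating M up" "\<And>d. d \<in> darts M \<Longrightarrow> up (opp M d) \<noteq> up d"
    "up d0" and rk: "\<And>d. d \<in> darts M \<Longrightarrow> rk (rot M d) = rk d" "\<And>d. d \<in> darts M \<Longrightarrow> up d \<Longrightarrow> rk d < rk (opp M d)"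
    using oriented_from_leaf[OF m adm d0(1)] by metis
  let ?S = "{d \<in> darts M. up d \<and> rot M d = d}"
  \<comment> \<open>The number of lines of the diagram. It is not yet known to be n; that follows at
    the end from the leaf counts of the faces.\<close>
  define N where "N = card ?S"
  have "finite ?S" "card ?S = card {1..N}" using is_mapD(1)[OF m] by (simp_all add: N_def)
  then obtain lab where lab: "bij_betw lab ?S {1..N}"
    using finite_same_card_bij finite_atLeastAtMost by metis
  have alt: "up (rot M d) \<noteq> up d" if "d \<in> darts M" "rot M d \<noteq> d" for d
    using up(1) that unfolding alternating_def by blast
  have deg: "rot M (rot M d) \<noteq> d" if d: "d \<in> darts M" "rot M d \<noteq> d" for d
  proof
    assume two: "rot M (rot M d) = d"
    have "orbit (rot M) d \<subseteq> {d, rot M d}"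
    proof
      fix e assume "e \<in> orbit (rot M) d"
      then show "e \<in> {d, rot M d}" by (induction rule: orbit.induct) (use two in auto)
    qed
    then have "card (orbit (rot M) d) \<le> card {d, rot M d}" by (intro card_mono) auto
    then have le: "card (orbit (rot M) d) \<le> 2" using d(2) by simp
    have v: "orbit (rot M) d \<in> vertices M" using d unfolding vertices_def vertex_at_def by blast
    have "card (orbit (rot M) d) \<noteq> 1"
    proof
      assume "card (orbit (rot M) d) = 1"
      then have "orbit (rot M) d = {d}"
        using permutation_self_in_orbit[OF perm, of d] by (metis card_1_singletonE singletonD)
      then show False using d(2) orbit_eq_singleton_iff by metis
    qed
    then show False using v le adm unfolding admissible_def leaves_def degree_def by fastforce
  qed
  obtain G h where G: "cycle_word N G" and h: "bij_betw h (darts M) (word_darts N G)"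
    and hrot: "\<And>d. d \<in> darts M \<Longrightarrow> h (rot M d) = word_rot G (h d)"
    and hopp: "\<And>d. d \<in> darts M \<Longrightarrow> h (opp M d) = word_opp N G (h d)"
    and hsrc: "\<And>d. d \<in> darts M \<Longrightarrow> up d \<Longrightarrow> rot M d = d \<Longrightarrow> h d = (lab d, 0, True)"
    using oriented_map_of_word[OF is_mapD(1)[OF m] is_mapD(3)[OF m] is_mapD(10)[OF m] is_mapD(9)[OF m]
        up(2) alt deg rk lab] by blast
  have riso: "rot_iso h M (word_map N cs G)" for cs unfolding rot_iso_def using h hrot hopp by simp
  have perms: "rot (word_map N cs G) permutes darts (word_map N cs G)" "opp (word_map N cs G) permutes darts (word_map N cs G)" for cs
    using word_rot_permutes[OF G] word_opp_permutes by auto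
  let ?face = "\<lambda>c. orbit (face_rot N G) (c, 0, True)" and ?\<rho> = "word_prod G"
  have faces: "image h ` faces M = ?face ` {1..N}"
    using rot_iso_transfer(3)[OF m riso perms] faces_word_map(1)[OF G] by metis
  define x0 where "x0 = lab d0"
  have x0: "h d0 = (x0, 0, True)" "x0 \<in> {1..N}"
    using hsrc[OF d0(1) up(3) d0(3)] bij_betwE[OF lab] d0 up(3) unfolding x0_def by blast+
  have fl: "face_list M ! i \<in> faces M" if "i < length \<alpha>" for i
    using M that len nth_mem unfolding is_marked_map_def by metis
  have "\<exists>c\<in>{1..N}. h ` (face_list M ! i) = ?face c" if "i < length \<alpha>" for i
  proof -
    have "h ` (face_list M ! i) \<in> ?face ` {1..N}" unfolding faces[symmetric] using fl[OF that] by simp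
    then show ?thesis by blast
  qed
  then obtain c where c: "\<And>i. i < length \<alpha> \<Longrightarrow> c i \<in> {1..N} \<and> h ` (face_list M ! i) = ?face (c i)"
    by metis
  have gperm: "permutation (face_rot N G)" using face_rot_permutation[OF G] .
  have c0: "h ` (face_list M ! 0) = ?face x0"
  proof -
    have "d0 \<in> face_list M ! 0" using adm d0(2) unfolding admissible_def leaves_in_def by auto
    then have "(x0, 0, True) \<in> ?face (c 0)" using c[OF m0] x0(1) by (metis image_eqI)
    then show ?thesis using c[OF m0] orbit_eq_orbit[OF gperm] by metis
  qed
  \<comment> \<open>Any line on a face may represent it, except that face 1 must be represented by
    the line of the distinguished leaf.\<close>
  define xs where "xs = map (\<lambda>i. if i = 0 then x0 else c i) [0..<length \<alpha>]"
  have xs: "xs ! i \<in> {1..N}" "h ` (face_list M ! i) = ?face (xs ! i)" if "i < length \<alpha>" for i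
    using c[OF that] c0 x0(2) that unfolding xs_def by auto
  have len_xs: "length xs = length \<alpha>" by (simp add: xs_def)
  have xs0: "xs ! 0 = x0" using m0 by (simp add: xs_def)
  have iso: "map_iso h M (word_map N xs G)"
  proof -
    have "map (image h) (face_list M) = map ?face xs"
      using xs(2) len len_xs by (intro nth_equalityI) auto
    then show ?thesis unfolding map_iso_def using riso d0(2) x0(1) xs0 by simp
  qed
  have face: "?face x = {e \<in> word_darts N G. face_label G e \<in> orbit ?\<rho> x}" if "x \<in> {1..N}" for x
    using orbit_face_rot_source[OF G that] .
  have \<rho>: "permutation ?\<rho>" using word_prod_permutes[OF G] permutation_permutes by blast
  have card: "card (orbit ?\<rho> (xs ! i)) = \<alpha> ! i" if i: "i < length \<alpha>" for i
  proof -
    have "card (leaves_in (word_map N xs G) (h ` (face_list M ! i))) = card (leaves_in M (face_list M ! i))"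
      using map_iso_transfer(4)[OF M iso perms fl[OF i]] .
    also have "\<dots> = 2 * \<alpha> ! i" using adm i unfolding admissible_def by blast
    finally show ?thesis unfolding xs(2)[OF i] card_leaves_in_word_map[OF G xs(1)[OF i]] by simp
  qed
  have diff: "i = j" if ij: "i < length \<alpha>" "j < length \<alpha>" and eq: "orbit ?\<rho> (xs ! i) = orbit ?\<rho> (xs ! j)" for i j
  proof -
    have "h ` (face_list M ! i) = h ` (face_list M ! j)"
      unfolding xs(2)[OF ij(1)] xs(2)[OF ij(2)] face[OF xs(1)[OF ij(1)]] face[OF xs(1)[OF ij(2)]] eq ..
    then have "face_list M ! i = face_list M ! j"
      using inj_on_image_eq_iff[OF bij_betw_imp_inj_on[OF h]] parts_subset_darts(3)[OF m] fl ij by metis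
    then show ?thesis using M nth_eq_iff_index_eq ij len unfolding is_marked_map_def by metis
  qed
  have cover: "\<exists>i<length \<alpha>. x \<in> orbit ?\<rho> (xs ! i)" if x: "x \<in> {1..N}" for x
  proof -
    have "?face x \<in> image h ` faces M" using faces x by blast
    then obtain f where f: "f \<in> set (face_list M)" "?face x = h ` f" using M unfolding is_marked_map_def by auto
    obtain i where i: "i < length \<alpha>" "f = face_list M ! i" using f(1) len by (metis in_set_conv_nth)
    have "(x, 0, False) \<in> ?face x"
      unfolding face[OF x] using x permutation_self_in_orbit[OF \<rho>] by (simp add: face_label_def word_darts_def)
    then have "(x, 0, False) \<in> ?face (xs ! i)" using f(2) i xs(2) by simp
    then have "x \<in> orbit ?\<rho> (xs ! i)" unfolding face[OF xs(1)[OF i(1)]] by (simp add: face_label_def)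
    then show ?thesis using i(1) by blast
  qed
  \<comment> \<open>The cycles through the entries of \<open>xs\<close> partition the lines, and
    their sizes are the parts of \<alpha>.\<close>
  have "N = n"
  proof -
    have "{1..N} = (\<Union>i\<in>{..<length \<alpha>}. orbit ?\<rho> (xs ! i))"
    proof
      show "{1..N} \<subseteq> (\<Union>i\<in>{..<length \<alpha>}. orbit ?\<rho> (xs ! i))" using cover by blast
      show "(\<Union>i\<in>{..<length \<alpha>}. orbit ?\<rho> (xs ! i)) \<subseteq> {1..N}"
        using permutes_orbit_subset[OF word_prod_permutes[OF G] xs(1)] by blast
    qed
    moreover have "card (\<Union>i\<in>{..<length \<alpha>}. orbit ?\<rho> (xs ! i)) = (\<Sum>i<length \<alpha>. card (orbit ?\<rho> (xs ! i)))"
    proof (rule card_UN_disjoint)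
      show "\<forall>i\<in>{..<length \<alpha>}. finite (orbit ?\<rho> (xs ! i))"
        using finite_orbit[OF permutation_self_in_orbit[OF \<rho>]] by simp
      show "\<forall>i\<in>{..<length \<alpha>}. \<forall>j\<in>{..<length \<alpha>}. i \<noteq> j \<longrightarrow> orbit ?\<rho> (xs ! i) \<inter> orbit ?\<rho> (xs ! j) = {}"
        using diff orbit_eq_orbit[OF \<rho>] by (metis disjoint_iff lessThan_iff)
    qed simp
    ultimately have "card {1..N} = (\<Sum>i<length \<alpha>. card (orbit ?\<rho> (xs ! i)))" by (simp only:)
    also have "\<dots> = (\<Sum>i<length \<alpha>. \<alpha> ! i)" using card by (intro sum.cong) auto
    also have "\<dots> = sum_list \<alpha>" by (simp add: sum_list_sum_nth atLeast0LessThan)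
    finally show ?thesis using n by simp
  qed
  moreover have "cycle_reps N ?\<rho> xs \<alpha>"
    unfolding cycle_reps_def using len_xs xs(1) card diff cover by blast
  ultimately show ?thesis using G iso by blast
qed

text \<open>Half of the description of a fibre: every conjugator turns G into a factorization of
  \<pi> with the same marked map.\<close>

lemma relabel_map_iso:
  assumes G: "cycle_word n G" and xs: "cycle_reps n (word_prod G) xs \<alpha>"
    and cs: "cycle_reps n \<pi> cs \<alpha>" and \<alpha>: "\<alpha> \<noteq> []"
    and \<tau>: "\<tau> \<in> conjugators n (word_prod G) xs \<pi> cs"
  shows "word_prod (relabel \<tau> G) = \<pi>" "map_iso (apfst \<tau>) (word_map n xs G) (word_map n cs (relabel \<tau> G))"
proof -
  have perm: "\<tau> permutes {1..n}" and comm: "\<tau> \<circ> word_prod G = \<pi> \<circ> \<tau>" and \<tau>0: "\<tau> (xs ! 0) = cs ! 0"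
    and \<tau>i: "\<And>i. i < length xs \<Longrightarrow> \<tau> (xs ! i) \<in> orbit \<pi> (cs ! i)"
    using \<tau> unfolding conjugators_def by blast+
  have bij: "bij \<tau>" using permutes_bij[OF perm] .
  let ?F = "relabel \<tau> G"
  have F: "cycle_word n ?F" using cycle_word_relabel[OF perm G] .
  have "\<tau> \<circ> word_prod G \<circ> inv' \<tau> = \<pi> \<circ> (\<tau> \<circ> inv' \<tau>)" unfolding comm by (rule comp_assoc)
  also have "\<tau> \<circ> inv' \<tau> = id" using permutes_inv_o(1)[OF perm] .
  finally show prod: "word_prod ?F = \<pi>" by (simp only: word_prod_relabel[OF bij] comp_id)
  have bijd: "bij_betw (apfst \<tau>) (word_darts n G) (word_darts n ?F)"
  proof -
    have "inj (apfst \<tau> :: dart \<Rightarrow> dart)"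
      using bij_is_inj[OF bij] by (auto simp: inj_def)
    then have "inj_on (apfst \<tau>) (word_darts n G)" by (rule inj_on_subset) simp
    moreover have "apfst \<tau> ` word_darts n G = word_darts n ?F"
    proof (intro equalityI subsetI)
      fix e assume "e \<in> word_darts n ?F"
      moreover obtain x where "fst e = \<tau> x" using bij_is_surj[OF bij] by (metis surj_def)
      then have "e = apfst \<tau> (x, snd e)" by (cases e) simp
      ultimately show "e \<in> apfst \<tau> ` word_darts n G" using apfst_word_darts_relabel[OF perm] by (metis image_eqI)
    qed (use apfst_word_darts_relabel[OF perm] in blast)
    ultimately show ?thesis unfolding bij_betw_def ..
  qed
  have riso: "rot_iso (apfst \<tau>) (word_map n xs G) (word_map n cs ?F)"
    unfolding rot_iso_def using bijd word_rot_relabel[OF bij] word_opp_relabel[OF perm] by simp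
  have len: "length xs = length \<alpha>" "length cs = length \<alpha>" using cycle_repsD(1) xs cs by blast+
  have \<pi>: "permutation \<pi>"
    using word_prod_permutes[OF F] permutation_permutes unfolding prod by blast
  have "apfst \<tau> ` orbit (face_rot n G) (x, 0, True) = orbit (face_rot n ?F) (\<tau> x, 0, True)" for x
  proof -
    have "apfst \<tau> ` orbit (face_rot n G) (x, 0, True) = orbit (face_rot n ?F) (apfst \<tau> (x, 0, True))"
    proof (rule orbit_inverse[OF permutation_self_in_orbit[OF face_rot_permutation[OF G]]])
      show "face_rot n ?F (apfst \<tau> d) = apfst \<tau> (face_rot n G d)" for d
        using word_rot_relabel[OF bij] word_opp_relabel[OF perm] by (simp only: comp_apply)
    qed
    then show ?thesis by simp
  qed
  moreover have "orbit (face_rot n ?F) (\<tau> (xs ! i), 0, True) = orbit (face_rot n ?F) (cs ! i, 0, True)"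
    if i: "i < length \<alpha>" for i
  proof -
    have "orbit \<pi> (\<tau> (xs ! i)) = orbit \<pi> (cs ! i)" using orbit_eq_orbit[OF \<pi>] \<tau>i i len by metis
    moreover have "\<tau> (xs ! i) \<in> {1..n}" using cycle_repsD(2)[OF xs i] permutes_in_image[OF perm] by blast
    ultimately show ?thesis
      using orbit_face_rot_source[OF F] cycle_repsD(2)[OF cs i] unfolding prod by simp
  qed
  ultimately have "map (image (apfst \<tau>)) (face_list (word_map n xs G)) = face_list (word_map n cs ?F)"
    using len by (intro nth_equalityI) auto
  then show "map_iso (apfst \<tau>) (word_map n xs G) (word_map n cs ?F)"
    unfolding map_iso_def using riso \<tau>0 by simp
qed

text \<open>The other half: the distinguished leaf has the same direction in both diagrams, so an
  isomorphism renames lines, and its compatibility with the marking makes the renaming a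
  conjugator.\<close>

lemma conjugator_of_map_iso:
  assumes G: "cycle_word n G" and xs: "cycle_reps n (word_prod G) xs \<alpha>"
    and F: "cycle_word n F" and cs: "cycle_reps n (word_prod F) cs \<alpha>" and \<alpha>: "\<alpha> \<noteq> []"
    and con: "connected_map (word_map n xs G)" and iso: "map_iso h (word_map n xs G) (word_map n cs F)"
  shows "\<exists>\<tau>\<in>conjugators n (word_prod G) xs (word_prod F) cs. (relabel \<tau> G, F) \<in> interchange\<^sup>*"
proof -
  let ?\<pi> = "word_prod F"
  have len: "length xs = length \<alpha>" "length cs = length \<alpha>" using cycle_repsD(1) xs cs by blast+
  have m0: "0 < length \<alpha>" using \<alpha> by simp
  have h: "bij_betw h (word_darts n G) (word_darts n F)"
    "\<And>d. d \<in> word_darts n G \<Longrightarrow> h (word_rot G d) = word_rot F (h d)" "\<And>d. d \<in> word_darts n G \<Longrightarrow> h (word_opp n G d) = word_opp n F (h d)"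
    and fl: "map (image h) (face_list (word_map n xs G)) = face_list (word_map n cs F)"
    and leaf: "h (xs ! 0, 0, True) = (cs ! 0, 0, True)"
    using iso unfolding map_iso_def rot_iso_def by auto
  have d0: "(xs ! 0, 0, True) \<in> word_darts n G" using cycle_repsD(2)[OF xs m0] by (simp add: word_darts_def)
  have up: "up_dart (h (xs ! 0, 0, True)) = up_dart (xs ! 0, 0, True)" unfolding leaf by simp
  obtain \<tau> where \<tau>: "\<tau> permutes {1..n}" "\<And>x. x \<in> {1..n} \<Longrightarrow> h (x, 0, True) = (\<tau> x, 0, True)"
    "(relabel \<tau> G, F) \<in> interchange\<^sup>*"
    using word_map_iso_relabel[OF G F con h d0 up] by blast
  have bij: "bij \<tau>" using permutes_bij[OF \<tau>(1)] .
  have "?\<pi> = \<tau> \<circ> word_prod G \<circ> inv' \<tau>"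
    using interchanges_invariant[OF \<tau>(3) cycle_word_relabel[OF \<tau>(1) G]] word_prod_relabel[OF bij] by simp
  then have "?\<pi> \<circ> \<tau> = \<tau> \<circ> word_prod G \<circ> (inv' \<tau> \<circ> \<tau>)" by (simp add: comp_assoc)
  also have "inv' \<tau> \<circ> \<tau> = id" using permutes_inv_o(2)[OF \<tau>(1)] .
  finally have "\<tau> \<circ> word_prod G = ?\<pi> \<circ> \<tau>" by (simp only: comp_id)
  moreover have "\<tau> (xs ! 0) = cs ! 0" using \<tau>(2)[OF cycle_repsD(2)[OF xs m0]] leaf by simp
  moreover have "\<tau> (xs ! i) \<in> orbit ?\<pi> (cs ! i)" if i: "i < length xs" for i
  proof -
    have x: "xs ! i \<in> {1..n}" and c: "cs ! i \<in> {1..n}" using cycle_repsD(2) xs cs i len by auto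
    have "(xs ! i, 0, True) \<in> orbit (face_rot n G) (xs ! i, 0, True)"
      using permutation_self_in_orbit[OF face_rot_permutation[OF G]] .
    then have "(\<tau> (xs ! i), 0, True) \<in> h ` orbit (face_rot n G) (xs ! i, 0, True)"
      using \<tau>(2)[OF x] by (metis image_eqI)
    also have "\<dots> = orbit (face_rot n F) (cs ! i, 0, True)"
      using arg_cong[OF fl, of "\<lambda>l. l ! i"] i len by simp
    \<comment> \<open>The face label at a lower leaf is already one step ahead on the cycle; this
      step is undone below.\<close>
    finally have "?\<pi> (\<tau> (xs ! i)) \<in> orbit ?\<pi> (cs ! i)"
      unfolding orbit_face_rot_source[OF F c] by (simp add: face_label_source)
    moreover have p: "permutation ?\<pi>" using word_prod_permutes[OF F] permutation_permutes by blast
    ultimately show ?thesis using permutation_orbit_step[OF p] orbit_eq_iff[OF p] by metis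
  qed
  ultimately show ?thesis using \<tau>(1,3) unfolding conjugators_def by blast
qed

lemma word_map_interchanges:
  assumes "(F, F') \<in> interchange\<^sup>*" "cycle_word n F"
  shows "word_map n cs F' = word_map n cs F"
proof -
  have "word_rot F' = word_rot F" "height F' = height F" using interchanges_invariant[OF assms] by auto
  then show ?thesis unfolding word_map_def word_darts_def word_opp_def by simp
qed

theorem correspondence:
  fixes n :: nat and \<alpha> :: "nat list" and \<pi> :: "nat \<Rightarrow> nat" and \<beta> :: "nat \<Rightarrow> nat" and g :: nat
  assumes \<alpha>: "\<alpha> \<noteq> []" "\<And>a. a \<in> set \<alpha> \<Longrightarrow> 1 \<le> a" "sum_list \<alpha> = n"
    and \<pi>: "\<pi> permutes {1..n}" and type: "cycle_type n \<pi> = mset \<alpha>"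
  shows "\<exists>\<Phi>. to_one_correspondence (\<Prod>i=2..length \<alpha>. \<alpha> ! (i - 1)) \<Phi>
    (inequivalent (\<lambda>F. genus_factorization n \<pi> g F \<and> (\<forall>k\<ge>2. signature n F k = \<beta> k)))
    (maps_up_to_iso (\<lambda>M. genus_map g M \<and> admissible \<alpha> \<beta> M))"
proof -
  define P where "P F \<longleftrightarrow> genus_factorization n \<pi> g F \<and> (\<forall>k\<ge>2. signature n F k = \<beta> k)" for F
  define Q :: "nat marked_map \<Rightarrow> bool" where "Q M \<longleftrightarrow> genus_map g M \<and> admissible \<alpha> \<beta> M" for M
  define R :: "(nat marked_map \<times> nat marked_map) set"
    where "R = {(M, M'). is_marked_map M \<and> is_marked_map M' \<and> isomorphic M M'}"
  let ?A = "inequivalent P" and ?B = "maps_up_to_iso Q" and ?r = "\<Prod>i=2..length \<alpha>. \<alpha> ! (i - 1)"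
  let ?cl = "\<lambda>F. interchange\<^sup>* `` {F}"
  obtain cs where cs: "cycle_reps n \<pi> cs \<alpha>" using cycle_reps_exist[OF \<pi> type] by blast
  have n: "1 \<le> n"
  proof -
    obtain a l where "\<alpha> = a # l" using \<alpha>(1) by (cases \<alpha>) auto
    then show ?thesis using \<alpha>(2)[of a] \<alpha>(3) by simp
  qed
  \<comment> \<open>Taking all maps on natural numbers isomorphic to the diagram avoids choosing a
    representative; it yields a whole isomorphism class.\<close>
  define \<Phi> :: "(nat \<Rightarrow> nat) list set \<Rightarrow> nat marked_map set" where
    "\<Phi> K = {M. is_marked_map M \<and> (\<exists>F\<in>K. \<exists>h. map_iso h M (word_map n cs F))}" for K
  have PD: "cycle_word n F" "word_prod F = \<pi>" "transitive n F" "genus_map g (word_map n cs F)"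
    "2 \<le> k \<Longrightarrow> signature n F k = \<beta> k" if "P F" for F k
    using that genus_factorization_iff[of n \<pi> g F cs] unfolding P_def by blast+
  have PI: "P F" if "cycle_word n F" "word_prod F = \<pi>" "transitive n F" "genus_map g (word_map n cs F)"
    "\<And>k. 2 \<le> k \<Longrightarrow> signature n F k = \<beta> k" for F
    using that genus_factorization_iff[of n \<pi> g F cs] unfolding P_def by blast
  have \<Phi>_cl: "\<Phi> (?cl F) = {M. is_marked_map M \<and> (\<exists>h. map_iso h M (word_map n cs F))}" if "cycle_word n F" for F
  proof -
    have "word_map n cs F' = word_map n cs F" if "F' \<in> ?cl F" for F'
      using word_map_interchanges[OF _ \<open>cycle_word n F\<close>] that by blast
    moreover have "F \<in> ?cl F" by simp
    ultimately show ?thesis unfolding \<Phi>_def by metis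
  qed
  have word_map_marked: "is_marked_map (word_map n cs F)" and word_map_shape: "shape \<alpha> \<beta> (word_map n cs F)" if "P F" for F
    using word_map_marked_map[OF PD(1,3)[OF that] n _ \<alpha>(1), of cs] cs PD(2,5)[OF that] by metis+
  have R_iff: "R `` {M} = {M'. is_marked_map M' \<and> (\<exists>h. map_iso h M M')}" if "is_marked_map M" for M
    unfolding R_def isomorphic_iff using that by blast
  have R_eq: "R `` {M} = \<Phi> (?cl F)" if M: "is_marked_map M" and h: "map_iso h M (word_map n cs F)" and F: "cycle_word n F" for M h F
  proof (intro equalityI subsetI)
    fix M' assume "M' \<in> R `` {M}"
    then obtain k where k: "is_marked_map M'" "map_iso k M M'" unfolding R_iff[OF M] by blast
    then show "M' \<in> \<Phi> (?cl F)"
      unfolding \<Phi>_cl[OF F] using map_iso_trans[OF map_iso_sym[OF M k(2)] h] by blast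
  next
    fix M' assume "M' \<in> \<Phi> (?cl F)"
    then obtain k where k: "is_marked_map M'" "map_iso k M' (word_map n cs F)" unfolding \<Phi>_cl[OF F] by blast
    have marked: "is_marked_map (word_map n cs F)"
      using map_iso_transfer(1)[OF M h] word_rot_permutes[OF F] word_opp_permutes by simp
    show "M' \<in> R `` {M}"
      unfolding R_iff[OF M] using k(1) map_iso_trans[OF h map_iso_sym[OF k]] by blast
  qed
  have Q_of_P: "Q M" if F: "P F" and M: "is_marked_map M" and h: "map_iso h M (word_map n cs F)" for M h F
  proof -
    have m: "is_map M" using M unfolding is_marked_map_def by blast
    note back_iso = map_iso_sym[OF M h]
    have "genus_map g M"
      using map_iso_transfer(2)[OF word_map_marked[OF F] back_iso is_mapD(3,4)[OF m]] PD(4)[OF F] by blast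
    moreover have "shape \<alpha> \<beta> M"
      using shape_transfer[OF word_map_marked[OF F] back_iso is_mapD(3,4)[OF m] \<alpha>(1) word_map_shape[OF F]] .
    ultimately show ?thesis
      unfolding Q_def using admissible_if_iso_word_map[OF m PD(1)[OF F] h] by blast
  qed
  have fibre: "card {K \<in> ?A. \<Phi> K = b} = ?r" if b: "b \<in> ?B" for b
  proof -
    obtain M where M: "is_marked_map M" "Q M" and bM: "b = R `` {M}"
      using b unfolding maps_up_to_iso_def R_def[symmetric] by (auto elim!: quotientE)
    have adm: "admissible \<alpha> \<beta> M" and gM: "genus_map g M" using M(2) unfolding Q_def by auto
    obtain G xs h where G: "cycle_word n G" and xs: "cycle_reps n (word_prod G) xs \<alpha>"
      and h: "map_iso h M (word_map n xs G)"
      using admissible_map_of_word[OF M(1) adm \<alpha>(1,3)] by blast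
    have marked_G: "is_marked_map (word_map n xs G)"
      using map_iso_transfer(1)[OF M(1) h] word_rot_permutes[OF G] word_opp_permutes by simp
    then have con: "connected_map (word_map n xs G)" unfolding is_marked_map_def is_map_def by blast
    let ?T = "conjugators n (word_prod G) xs \<pi> cs"
    have m0: "0 < length \<alpha>" using \<alpha>(1) by simp
    have T_perm: "\<tau> permutes {1..n}" if "\<tau> \<in> ?T" for \<tau> using that unfolding conjugators_def by blast
    \<comment> \<open>With one reading G of the map held fixed, the fibre consists of the classes of
      the relabellings of G by conjugators.\<close>
    have "{K \<in> ?A. \<Phi> K = b} = (\<lambda>\<tau>. ?cl (relabel \<tau> G)) ` ?T"
    proof (intro equalityI subsetI)
      fix K assume K: "K \<in> {K \<in> ?A. \<Phi> K = b}"
      then obtain F where F: "P F" "K = ?cl F" unfolding inequivalent_def by (auto elim!: quotientE)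
      have "map_iso id M M" unfolding map_iso_def rot_iso_def by simp
      then have "M \<in> \<Phi> (?cl F)" using K F(2) M(1) bM R_iff[OF M(1)] by blast
      then obtain k where k: "map_iso k M (word_map n cs F)" unfolding \<Phi>_cl[OF PD(1)[OF F(1)]] by blast
      have "\<exists>\<tau>\<in>?T. (relabel \<tau> G, F) \<in> interchange\<^sup>*"
        using conjugator_of_map_iso[OF G xs PD(1)[OF F(1)] _ \<alpha>(1) con map_iso_trans[OF map_iso_sym[OF M(1) h] k]]
          cs PD(2)[OF F(1)] by blast
      then obtain \<tau> where \<tau>: "\<tau> \<in> ?T" "(relabel \<tau> G, F) \<in> interchange\<^sup>*" by blast
      then have "?cl F = ?cl (relabel \<tau> G)"
        using symD[OF sym_interchanges] by (auto intro: rtrancl_trans)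
      then show "K \<in> (\<lambda>\<tau>. ?cl (relabel \<tau> G)) ` ?T" using \<tau>(1) F(2) by blast
    next
      fix K assume "K \<in> (\<lambda>\<tau>. ?cl (relabel \<tau> G)) ` ?T"
      then obtain \<tau> where \<tau>: "\<tau> \<in> ?T" and K: "K = ?cl (relabel \<tau> G)" by blast
      let ?F = "relabel \<tau> G"
      have F: "cycle_word n ?F" using cycle_word_relabel[OF T_perm[OF \<tau>] G] .
      note rel = relabel_map_iso[OF G xs cs \<alpha>(1) \<tau>]
      have iso: "map_iso (apfst \<tau> \<circ> h) M (word_map n cs ?F)" using map_iso_trans[OF h rel(2)] .
      have perms: "rot (word_map n cs ?F) permutes darts (word_map n cs ?F)" "opp (word_map n cs ?F) permutes darts (word_map n cs ?F)"
        using word_rot_permutes[OF F] word_opp_permutes by auto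
      note transfer = map_iso_transfer[OF M(1) iso perms]
      have "P ?F"
      proof (rule PI[OF F rel(1)])
        show "transitive n ?F"
          using transfer(1) is_map_word_map_iff[OF F n] unfolding is_marked_map_def by blast
        show "genus_map g (word_map n cs ?F)" using transfer(2) gM by blast
        show "signature n ?F k = \<beta> k" if "2 \<le> k" for k
          using card_inner_vertices_word_map[OF F that, of cs] transfer(5)[of "2 * k"] adm that
          unfolding admissible_def by simp
      qed
      then have "K \<in> ?A" unfolding inequivalent_def K by (simp add: quotientI)
      then show "K \<in> {K \<in> ?A. \<Phi> K = b}" using R_eq[OF M(1) iso F] bM K by blast
    qed
    \<comment> \<open>All conjugators agree at \<open>xs ! 0\<close>, so rigidity separates their
      classes.\<close>
    moreover have "inj_on (\<lambda>\<tau>. ?cl (relabel \<tau> G)) ?T"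
    proof (rule inj_onI)
      fix \<tau> \<tau>' assume T: "\<tau> \<in> ?T" "\<tau>' \<in> ?T" and eq: "?cl (relabel \<tau> G) = ?cl (relabel \<tau>' G)"
      then have "(relabel \<tau> G, relabel \<tau>' G) \<in> interchange\<^sup>*" by blast
      moreover have "\<tau> (xs ! 0) = \<tau>' (xs ! 0)" using T unfolding conjugators_def by simp
      ultimately show "\<tau> = \<tau>'"
        using relabel_rigid[OF G con T_perm[OF T(1)] T_perm[OF T(2)]] cycle_repsD(2)[OF xs m0] by blast
    qed
    ultimately have "card {K \<in> ?A. \<Phi> K = b} = card ?T" by (simp add: card_image)
    also have "\<dots> = ?r" using card_conjugators[OF word_prod_permutes[OF G] xs \<pi> cs \<alpha>(1)] .
    finally show ?thesis .
  qed
  have into: "\<Phi> K \<in> ?B" if K: "K \<in> ?A" for K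
  proof -
    obtain F where F: "P F" "K = ?cl F" using K unfolding inequivalent_def by (auto elim!: quotientE)
    obtain N :: "nat marked_map" and h where N: "map_iso h (word_map n cs F) N"
      "rot N permutes darts N" "opp N permutes darts N"
      using nat_copy[OF word_map_marked[OF F(1)]] by blast
    have mN: "is_marked_map N" using map_iso_transfer(1)[OF word_map_marked[OF F(1)] N] .
    note iso = map_iso_sym[OF word_map_marked[OF F(1)] N(1)]
    have "Q N" using Q_of_P[OF F(1) mN iso] .
    then have "R `` {N} \<in> ?B" unfolding maps_up_to_iso_def R_def[symmetric] using mN by (simp add: quotientI)
    then show ?thesis using R_eq[OF mN iso PD(1)[OF F(1)]] F(2) by simp
  qed
  \<comment> \<open>Surjectivity comes for free: a fibre of positive cardinality is
    nonempty.\<close>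
  have "0 < ?r"
  proof (rule prod_pos)
    fix i assume "i \<in> {2..length \<alpha>}"
    then have "\<alpha> ! (i - 1) \<in> set \<alpha>" by (intro nth_mem) auto
    then show "0 < \<alpha> ! (i - 1)" using \<alpha>(2) by fastforce
  qed
  then have "{K \<in> ?A. \<Phi> K = b} \<noteq> {}" if "b \<in> ?B" for b
    using fibre[OF that] by (metis card.empty less_numeral_extra(3))
  then have "\<Phi> ` ?A = ?B" using into by blast
  then show ?thesis
    unfolding to_one_correspondence_def P_def[symmetric] Q_def[symmetric] using fibre by blast
qed

theorem theorem4p3:
  fixes n m :: nat and \<alpha> :: "nat list" and \<pi> :: "nat \<Rightarrow> nat" and \<beta> :: "nat \<Rightarrow> nat"
  assumes "m \<ge> 1" and "composition m \<alpha> n"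
    and "\<pi> permutes {1..n}" and "cycle_type n \<pi> = mset \<alpha>"
    and "finite {k. k \<ge> 2 \<and> \<beta> k \<noteq> 0}"
  shows
    "(\<exists>\<Phi>. to_one_correspondence (\<Prod>i=2..m. \<alpha> ! (i - 1)) \<Phi>
        (inequivalent (\<lambda>F. minimal_transitive_factorization n \<pi> F \<and>
                           (\<forall>k\<ge>2. signature n F k = \<beta> k)))
        (maps_up_to_iso (\<lambda>M. planar M \<and> admissible \<alpha> \<beta> M))) \<and>
     (\<forall>g. \<exists>\<Phi>. to_one_correspondence (\<Prod>i=2..m. \<alpha> ! (i - 1)) \<Phi>
        (inequivalent (\<lambda>F. genus_factorization n \<pi> g F \<and>
                           (\<forall>k\<ge>2. signature n F k = \<beta> k)))
        (maps_up_to_iso (\<lambda>M. genus_map g M \<and> admissible \<alpha> \<beta> M)))"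
proof -
  have \<alpha>: "\<alpha> \<noteq> []" "\<And>a. a \<in> set \<alpha> \<Longrightarrow> 1 \<le> a" "sum_list \<alpha> = n" and m: "m = length \<alpha>"
    using assms(1,2) unfolding composition_def by auto
  show ?thesis
    unfolding minimal_transitive_factorization_def planar_def m
    using correspondence[OF \<alpha> assms(3,4)] by blast
qed

end
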